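(* Let $R$ be a skew-invertible Hecke symmetry with generic parameter $q$ and of bi-rank $(m|0)$, $m\ge 2$, and let $L$ be the generating matrix of the Reflection Equation algebra $\mathcal L(R)$. Then the polynomial $$Q(t)=\sum_{k=0}^m t^{m-k}(-q)^k e_k(L)$$ is identically equal to the expression $$Q(t)=q^m\,\mathrm{Tr}_{R(1\dots m)}\Big(\mathcal P_-^{(m)}(tI-L_{\overline 1})(q^2tI-L_{\overline 2})\cdots(q^{2(m-1)}tI-L_{\overline m})\Big).$$
   Context: Let $\mathbb K=\mathbb C$ or $\mathbb R$, $V$ a $\mathbb K$-vector space with $\dim V=N$ and basis $\{x_i\}$. A braiding is an operator $R:V^{\otimes 2}\to V^{\otimes 2}$ with $R_{12}R_{23}R_{12}=R_{23}R_{12}R_{23}$ on $V^{\otimes 3}$ (lower indices label the tensor factors on which an operator acts; $R_k:=R_{k\,k+1}$). It is a Hecke symmetry if $(qI-R)(q^{-1}I+R)=0$, $q\in\mathbb K$, $q^2\neq 1$; $q$ is generic, i.e. $q^n\ne 1$ for every nonzero integer $n$. Matrix of $R$: $R(x_i\otimes x_j)=R_{ij}^{kl}x_k\otimes x_l$ (summation over repeated indices; lower index = row, upper index = column). $R$ is skew-invertible if there is $\Psi:V^{\otimes 2}\to V^{\otimes 2}$ with $\mathrm{Tr}_2R_{12}\Psi_{23}=P_{13}$ ($P$ the flip), i.e. $R_{ij}^{kl}\Psi_{lp}^{jq}=\delta_i^q\delta_p^k$. Put $C=\mathrm{Tr}_2\Psi$, i.e. $C_i^j=\Psi_{ik}^{jk}$.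 The $R$-trace of an $N\times N$ matrix $M$ is $\mathrm{Tr}_RM=\mathrm{Tr}(CM)$, and $\mathrm{Tr}_{R(i_1\dots i_k)}X=\mathrm{Tr}_{i_1\dots i_k}(C_{i_1}\cdots C_{i_k}X)$. $k_q=(q^k-q^{-k})/(q-q^{-1})$. Skew-symmetrizers: $\mathcal P_-^{(1)}=I$, $\mathcal P_-^{(k)}=\frac1{k_q}\mathcal P_-^{(k-1)}\big(q^{k-1}I-(k-1)_qR_{k-1}\big)\mathcal P_-^{(k-1)}$, acting in positions $1,\dots,k$. Bi-rank: let $\bigwedge_R(V)=T(V)/\langle\mathrm{Im}(q^{-1}I+R)\rangle$ and $P_-(t)=\sum_k\dim\bigwedge_R^{(k)}(V)\,t^k$ (Poincaré–Hilbert series; a rational function). Written in lowest terms, if its numerator has degree $m$ and its denominator degree $n$, the bi-rank of $R$ is $(m|n)$. The Reflection Equation algebra $\mathcal L(R)$ is the unital associative algebra generated by the entries of $L=\|l_i^j\|_{1\le i,j\le N}$ subject to $RL_1RL_1-L_1RL_1R=0$, $L_1=L\otimes I$. Put $L_{\overline 1}=L_1$, $L_{\overline k}=R_{k-1}L_{\overline{k-1}}R_{k-1}^{-1}$ for $k\ge2$. Finally $e_0(L)=1$ and $e_k(L)=\mathrm{Tr}_{R(1\dots k)}\big(\mathcal P_-^{(k)}L_{\overline 1}L_{\overline 2}\cdots L_{\overline k}\big)$ for $k\ge1$ (these elements are central in $\mathcal L(R)$). *)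

theory Defs
  imports
    "HOL-Analysis.Cartesian_Space"
    "HOL-Library.Poly_Mapping"
    "HOL-Computational_Algebra.Polynomial_FPS"
    "HOL-Computational_Algebra.Polynomial_Factorial"
    "HOL-Algebra.QuotRing"
    "HOL-Algebra.UnivPoly"
    "HOL-Algebra.Embedded_Algebras"
    "HOL-Algebra.Algebraic_Closure_Type"
begin

unbundle no fps_syntax

section \<open>Free associative algebras\<close>

abbreviation type_ring :: "'a::ring_1 ring" where
  "type_ring \<equiv> ring_of_type_algebra"

text \<open>Words under concatenation form the free monoid, written additively so that
  \<^typ>\<open>'m \<Rightarrow>\<^sub>0 'k\<close> with its convolution product is the monoid algebra.\<close>

datatype 'x free_word = Word "'x list"

instantiation free_word :: (type) monoid_add
begin

definition zero_free_word :: "'a free_word" where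
  "0 = Word []"

fun plus_free_word :: "'a free_word \<Rightarrow> 'a free_word \<Rightarrow> 'a free_word" where
  "Word u + Word v = Word (u @ v)"

instance
proof
  fix a b c :: "'a free_word"
  show "a + b + c = a + (b + c)" by (cases a; cases b; cases c) simp
  show "0 + a = a" by (cases a) (simp add: zero_free_word_def)
  show "a + 0 = a" by (cases a) (simp add: zero_free_word_def)
qed

end

type_synonym ('x, 'k) free_algebra = "'x free_word \<Rightarrow>\<^sub>0 'k"

definition free_const :: "'k \<Rightarrow> ('x, 'k::ring_1) free_algebra" where
  "free_const c = Poly_Mapping.single 0 c"

definition free_gen :: "'x \<Rightarrow> ('x, 'k::ring_1) free_algebra" where
  "free_gen x = Poly_Mapping.single (Word [x]) 1"


section \<open>Matrices on tensor powers\<close>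

text \<open>
  The tensor powers of \<open>V\<close> have the basis \<open>x\<^bsub>I\<^esub>\<close> with \<open>I\<close> a list of basis indices whose length is the
  tensor degree.  An operator is a family of square matrices \<open>S I J\<close> (row \<open>I\<close>, column \<open>J\<close>), one
  block for every degree \<open>length I = length J\<close>; so \<open>R\<^sub>i\<close> stands at once for the operator on all
  tensor powers of degree at least \<open>i + 1\<close>.  Entries lie in a ring \<open>A\<close> that need not be
  commutative.  Tensor positions are counted from 1.
\<close>

type_synonym ('n, 'a) tensor_op = "'n list \<Rightarrow> 'n list \<Rightarrow> 'a"

definition tensor_mult ::
  "('a, 'b) ring_scheme \<Rightarrow> ('n::finite, 'a) tensor_op \<Rightarrow> ('n, 'a) tensor_op \<Rightarrow> ('n, 'a) tensor_op"
  (infixl \<open>\<star>\<index>\<close> 70)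
  where "S \<star>\<^bsub>A\<^esub> T = (\<lambda>I J. \<Oplus>\<^bsub>A\<^esub>K\<in>{K. length K = length I}. S I K \<otimes>\<^bsub>A\<^esub> T K J)"

definition tensor_id :: "('a, 'b) ring_scheme \<Rightarrow> ('n, 'a) tensor_op" where
  "tensor_id A = (\<lambda>I J. if I = J then \<one>\<^bsub>A\<^esub> else \<zero>\<^bsub>A\<^esub>)"

primrec tensor_prod ::
  "('a, 'b) ring_scheme \<Rightarrow> (nat \<Rightarrow> ('n::finite, 'a) tensor_op) \<Rightarrow> nat \<Rightarrow> ('n, 'a) tensor_op" where
  "tensor_prod A S 0 = tensor_id A"
| "tensor_prod A S (Suc k) = tensor_prod A S k \<star>\<^bsub>A\<^esub> S (Suc k)"

definition tensor_trace ::
  "('a, 'b) ring_scheme \<Rightarrow> nat \<Rightarrow> ('n::finite, 'a) tensor_op \<Rightarrow> 'a" where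
  "tensor_trace A k S = (\<Oplus>\<^bsub>A\<^esub>I\<in>{I. length I = k}. S I I)"

definition at_pos :: "('a, 'b) ring_scheme \<Rightarrow> nat \<Rightarrow> 'a^'n^('n::finite) \<Rightarrow> ('n, 'a) tensor_op" where
  "at_pos A i M = (\<lambda>I J.
     if length I = length J \<and> take (i - 1) I = take (i - 1) J \<and> drop i I = drop i J
     then M $ (I ! (i - 1)) $ (J ! (i - 1)) else \<zero>\<^bsub>A\<^esub>)"

definition at_pos2 ::
  "('a, 'b) ring_scheme \<Rightarrow> nat \<Rightarrow> 'a^('n::finite \<times> 'n)^('n \<times> 'n) \<Rightarrow> ('n, 'a) tensor_op" where
  "at_pos2 A i M = (\<lambda>I J.
     if length I = length J \<and> take (i - 1) I = take (i - 1) J \<and> drop (i + 1) I = drop (i + 1) J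
     then M $ (I ! (i - 1), I ! i) $ (J ! (i - 1), J ! i) else \<zero>\<^bsub>A\<^esub>)"


section \<open>Hecke symmetries\<close>

text \<open>The matrix element \<open>R\<^bsub>ij\<^esub>\<^bsup>kl\<^esup>\<close> is \<open>R $ (i, j) $ (k, l)\<close>.\<close>

type_synonym ('k, 'n) braid_matrix = "'k^('n::finite \<times> 'n)^('n \<times> 'n)"

definition braiding :: "('k::field, 'n::finite) braid_matrix \<Rightarrow> bool" where
  "braiding R \<longleftrightarrow>
     (let K = type_ring; R1 = at_pos2 K 1 R; R2 = at_pos2 K 2 R in
      \<forall>I J. length I = 3 \<longrightarrow> length J = 3 \<longrightarrow>
        (R1 \<star>\<^bsub>K\<^esub> R2 \<star>\<^bsub>K\<^esub> R1) I J = (R2 \<star>\<^bsub>K\<^esub> R1 \<star>\<^bsub>K\<^esub> R2) I J)"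

definition hecke_symmetry :: "'k::field \<Rightarrow> ('k, 'n::finite) braid_matrix \<Rightarrow> bool" where
  "hecke_symmetry q R \<longleftrightarrow>
     q \<noteq> 0 \<and> q\<^sup>2 \<noteq> 1 \<and> braiding R \<and> (mat q - R) ** (mat (inverse q) + R) = 0"

text \<open>\<open>0 powi n\<close> is never 1 for \<open>n \<noteq> 0\<close>, hence the separate condition.\<close>

definition generic :: "'k::field \<Rightarrow> bool" where
  "generic q \<longleftrightarrow> q \<noteq> 0 \<and> (\<forall>n::int. n \<noteq> 0 \<longrightarrow> q powi n \<noteq> 1)"

definition skew_inverse ::
  "('k::field, 'n::finite) braid_matrix \<Rightarrow> ('k, 'n) braid_matrix \<Rightarrow> bool" where
  "skew_inverse R \<Psi> \<longleftrightarrow>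
     (\<forall>i k p r. (\<Sum>j\<in>UNIV. \<Sum>l\<in>UNIV. R $ (i, j) $ (k, l) * \<Psi> $ (l, p) $ (j, r)) =
        (if i = r \<and> p = k then 1 else 0))"

definition skew_invertible :: "('k::field, 'n::finite) braid_matrix \<Rightarrow> bool" where
  "skew_invertible R \<longleftrightarrow> (\<exists>\<Psi>. skew_inverse R \<Psi>)"

text \<open>The skew inverse is unique: its defining equation says that two square matrices, obtained
  by rearranging the indices of \<open>R\<close> and \<open>\<Psi>\<close>, are mutually inverse.\<close>

definition C_matrix :: "('k::field, 'n::finite) braid_matrix \<Rightarrow> 'k^'n^'n" where
  "C_matrix R = (\<chi> i j. \<Sum>k\<in>UNIV. (SOME \<Psi>. skew_inverse R \<Psi>) $ (i, k) $ (j, k))"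

definition q_number :: "'k::field \<Rightarrow> nat \<Rightarrow> 'k" where
  "q_number q k = (q ^ k - inverse q ^ k) / (q - inverse q)"

fun skew_symmetrizer ::
  "'k::field \<Rightarrow> ('k, 'n::finite) braid_matrix \<Rightarrow> nat \<Rightarrow> ('n, 'k) tensor_op" where
  "skew_symmetrizer q R 0 = tensor_id type_ring"
| "skew_symmetrizer q R (Suc 0) = tensor_id type_ring"
| "skew_symmetrizer q R (Suc (Suc k)) =
     (let K = type_ring; P = skew_symmetrizer q R (Suc k);
          M = (\<lambda>I J. q ^ Suc k * tensor_id K I J - q_number q (Suc k) * at_pos2 K (Suc k) R I J)
      in (\<lambda>I J. 1 / q_number q (Suc (Suc k)) * (P \<star>\<^bsub>K\<^esub> M \<star>\<^bsub>K\<^esub> P) I J))"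


section \<open>Bi-rank\<close>

text \<open>The tensor algebra \<open>T(V)\<close> is the free algebra on the basis of \<open>V\<close>.\<close>

definition tensor2 :: "'k::field^('n::finite \<times> 'n) \<Rightarrow> ('n, 'k) free_algebra" where
  "tensor2 v = (\<Sum>i\<in>UNIV. \<Sum>j\<in>UNIV. free_const (v $ (i, j)) * (free_gen i * free_gen j))"

text \<open>Rows carry the lower indices, so an operator with matrix \<open>M\<close> takes the coordinate vector
  \<open>v\<close> to \<open>v v* M\<close>.\<close>

definition exterior_ideal ::
  "'k::field \<Rightarrow> ('k, 'n::finite) braid_matrix \<Rightarrow> ('n, 'k) free_algebra set" where
  "exterior_ideal q R = Idl\<^bsub>type_ring\<^esub> (range (\<lambda>v. tensor2 (v v* (mat (inverse q) + R))))"

definition exterior_algebra ::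
  "'k::field \<Rightarrow> ('k, 'n::finite) braid_matrix \<Rightarrow> ('n, 'k) free_algebra set ring" where
  "exterior_algebra q R = type_ring Quot exterior_ideal q R"

text \<open>The dimension of a graded component is taken over the copy of \<open>K\<close> inside the quotient ring.\<close>

definition exterior_scalars ::
  "'k::field \<Rightarrow> ('k, 'n::finite) braid_matrix \<Rightarrow> ('n, 'k) free_algebra set set" where
  "exterior_scalars q R = range (\<lambda>c. exterior_ideal q R +>\<^bsub>type_ring\<^esub> free_const c)"

definition exterior_component ::
  "'k::field \<Rightarrow> ('k, 'n::finite) braid_matrix \<Rightarrow> nat \<Rightarrow> ('n, 'k) free_algebra set set" where
  "exterior_component q R k =
     (\<lambda>p. exterior_ideal q R +>\<^bsub>type_ring\<^esub> p) ` {p. Poly_Mapping.keys p \<subseteq> {Word w | w. length w = k}}"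

definition exterior_dim :: "'k::field \<Rightarrow> ('k, 'n::finite) braid_matrix \<Rightarrow> nat \<Rightarrow> nat" where
  "exterior_dim q R k =
     ring.dim (exterior_algebra q R) (exterior_scalars q R) (exterior_component q R k)"

definition exterior_series :: "'k::field \<Rightarrow> ('k, 'n::finite) braid_matrix \<Rightarrow> rat fps" where
  "exterior_series q R = Abs_fps (\<lambda>k. of_nat (exterior_dim q R k))"

definition has_bi_rank ::
  "'k::field \<Rightarrow> ('k, 'n::finite) braid_matrix \<Rightarrow> nat \<Rightarrow> nat \<Rightarrow> bool" where
  "has_bi_rank q R m n \<longleftrightarrow>
     (\<exists>a b :: rat poly. b \<noteq> 0 \<and> coprime a b \<and> degree a = m \<and> degree b = n \<and>
        fps_of_poly b * exterior_series q R = fps_of_poly a)"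


section \<open>The Reflection Equation algebra\<close>

text \<open>
  Below \<open>A\<close> is a \<open>K\<close>-algebra given as a ring together with its structure map \<open>\<iota>\<close> from \<open>K\<close>, and \<open>L\<close>
  is a matrix over \<open>A\<close>.
\<close>

fun L_bar ::
  "('a, 'b) ring_scheme \<Rightarrow> ('k::field \<Rightarrow> 'a) \<Rightarrow> ('k, 'n::finite) braid_matrix \<Rightarrow> 'a^'n^'n \<Rightarrow> nat
     \<Rightarrow> ('n, 'a) tensor_op" where
  "L_bar A \<iota> R L 0 = tensor_id A"
| "L_bar A \<iota> R L (Suc 0) = at_pos A 1 L"
| "L_bar A \<iota> R L (Suc (Suc k)) =
     at_pos2 A (Suc k) (map_matrix \<iota> R) \<star>\<^bsub>A\<^esub> L_bar A \<iota> R L (Suc k)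
       \<star>\<^bsub>A\<^esub> at_pos2 A (Suc k) (map_matrix \<iota> (matrix_inv R))"

definition R_trace ::
  "('a, 'b) ring_scheme \<Rightarrow> ('k::field \<Rightarrow> 'a) \<Rightarrow> ('k, 'n::finite) braid_matrix \<Rightarrow> nat
     \<Rightarrow> ('n, 'a) tensor_op \<Rightarrow> 'a" where
  "R_trace A \<iota> R k S =
     tensor_trace A k (tensor_prod A (\<lambda>i. at_pos A i (map_matrix \<iota> (C_matrix R))) k \<star>\<^bsub>A\<^esub> S)"

definition skew_symmetrizer_over ::
  "('k::field \<Rightarrow> 'a) \<Rightarrow> 'k \<Rightarrow> ('k, 'n::finite) braid_matrix \<Rightarrow> nat \<Rightarrow> ('n, 'a) tensor_op" where
  "skew_symmetrizer_over \<iota> q R k = (\<lambda>I J. \<iota> (skew_symmetrizer q R k I J))"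

definition elem_sym ::
  "('a, 'b) ring_scheme \<Rightarrow> ('k::field \<Rightarrow> 'a) \<Rightarrow> 'k \<Rightarrow> ('k, 'n::finite) braid_matrix \<Rightarrow> 'a^'n^'n
     \<Rightarrow> nat \<Rightarrow> 'a" where
  "elem_sym A \<iota> q R L k =
     (if k = 0 then \<one>\<^bsub>A\<^esub>
      else R_trace A \<iota> R k (skew_symmetrizer_over \<iota> q R k \<star>\<^bsub>A\<^esub> tensor_prod A (L_bar A \<iota> R L) k))"

text \<open>The generator \<open>l\<^bsub>i\<^esub>\<^bsup>j\<^esup>\<close> of the free algebra on the entries of \<open>L\<close> is \<open>free_gen (i, j)\<close>.\<close>

definition rea_relations ::
  "('k::field, 'n::finite) braid_matrix \<Rightarrow> ('n \<times> 'n, 'k) free_algebra set" where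
  "rea_relations R =
     (let A = type_ring; R1 = at_pos2 A 1 (map_matrix free_const R);
          L1 = at_pos A 1 (\<chi> i j. free_gen (i, j))
      in {(R1 \<star>\<^bsub>A\<^esub> L1 \<star>\<^bsub>A\<^esub> R1 \<star>\<^bsub>A\<^esub> L1) I J - (L1 \<star>\<^bsub>A\<^esub> R1 \<star>\<^bsub>A\<^esub> L1 \<star>\<^bsub>A\<^esub> R1) I J
          | I J. length I = 2 \<and> length J = 2})"

definition rea_ideal ::
  "('k::field, 'n::finite) braid_matrix \<Rightarrow> ('n \<times> 'n, 'k) free_algebra set" where
  "rea_ideal R = Idl\<^bsub>type_ring\<^esub> (rea_relations R)"

definition rea ::
  "('k::field, 'n::finite) braid_matrix \<Rightarrow> ('n \<times> 'n, 'k) free_algebra set ring" where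
  "rea R = type_ring Quot rea_ideal R"

definition rea_const ::
  "('k::field, 'n::finite) braid_matrix \<Rightarrow> 'k \<Rightarrow> ('n \<times> 'n, 'k) free_algebra set" where
  "rea_const R c = rea_ideal R +>\<^bsub>type_ring\<^esub> free_const c"

definition rea_L ::
  "('k::field, 'n::finite) braid_matrix \<Rightarrow> (('n \<times> 'n, 'k) free_algebra set)^'n^'n" where
  "rea_L R = (\<chi> i j. rea_ideal R +>\<^bsub>type_ring\<^esub> free_gen (i, j))"

definition rea_e ::
  "'k::field \<Rightarrow> ('k, 'n::finite) braid_matrix \<Rightarrow> nat \<Rightarrow> ('n \<times> 'n, 'k) free_algebra set" where
  "rea_e q R = elem_sym (rea R) (rea_const R) q R (rea_L R)"


section \<open>Polynomials over the Reflection Equation algebra\<close>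

text \<open>\<^const>\<open>UP\<close> is the ring of polynomials in a central variable \<open>t\<close>; it is defined for
  noncommutative coefficient rings as well.\<close>

abbreviation rea_poly ::
  "('k::field, 'n::finite) braid_matrix
     \<Rightarrow> (('n \<times> 'n, 'k) free_algebra set, nat \<Rightarrow> ('n \<times> 'n, 'k) free_algebra set) up_ring" where
  "rea_poly R \<equiv> UP (rea R)"

definition coeff_poly ::
  "('k::field, 'n::finite) braid_matrix \<Rightarrow> ('n \<times> 'n, 'k) free_algebra set
     \<Rightarrow> nat \<Rightarrow> ('n \<times> 'n, 'k) free_algebra set" where
  "coeff_poly R a = up_ring.monom (rea_poly R) a 0"

definition const_poly ::
  "('k::field, 'n::finite) braid_matrix \<Rightarrow> 'k \<Rightarrow> nat \<Rightarrow> ('n \<times> 'n, 'k) free_algebra set" where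
  "const_poly R c = coeff_poly R (rea_const R c)"

definition t_var ::
  "('k::field, 'n::finite) braid_matrix \<Rightarrow> nat \<Rightarrow> ('n \<times> 'n, 'k) free_algebra set" where
  "t_var R = up_ring.monom (rea_poly R) \<one>\<^bsub>rea R\<^esub> 1"

definition char_factor ::
  "'k::field \<Rightarrow> ('k, 'n::finite) braid_matrix \<Rightarrow> nat
     \<Rightarrow> ('n, nat \<Rightarrow> ('n \<times> 'n, 'k) free_algebra set) tensor_op" where
  "char_factor q R i =
     (let A = rea_poly R in
      (\<lambda>I J. const_poly R (q ^ (2 * (i - 1))) \<otimes>\<^bsub>A\<^esub> t_var R \<otimes>\<^bsub>A\<^esub> tensor_id A I J
        \<ominus>\<^bsub>A\<^esub> L_bar A (const_poly R) R (map_matrix (coeff_poly R) (rea_L R)) i I J))"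

end

theory Submission
  imports Defs
begin

unbundle no Formal_Power_Series.fps_syntax
unbundle no Formal_Laurent_Series.fps_syntax

text \<open>
  \<^emph>\<open>Why the identity holds.\<close>
  Multiply out the product \<open>(t - L\<^sub>1)(q\<^sup>2t - L\<^sub>2)\<dots>\<close>, where \<open>L\<^sub>k\<close> stands for the \<open>k\<close>-th copy of \<open>L\<close>.
  The term of a set \<open>i\<^sub>1 < \<dots> < i\<^sub>k\<close> of positions contributes the \<open>R\<close>-trace of \<open>P L\<^bsub>i\<^sub>1\<^esub> \<dots> L\<^bsub>i\<^sub>k\<^esub>\<close> with \<open>P\<close> the skew-symmetrizer of degree
  \<open>m\<close>.  A copy \<open>L\<^bsub>i+1\<^esub>\<close> is the conjugate of \<open>L\<^sub>i\<close> by \<open>R\<^sub>i\<close>.  If \<open>i\<close> does not occur among the positions,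
  \<open>R\<^sub>i\<close> commutes with all other factors; as it also passes through the \<open>R\<close>-trace and is a scalar
  next to \<open>P\<close>, the index \<open>i + 1\<close> can be lowered to \<open>i\<close> for free (\<open>trace_shift\<close>).  So
  every set of size \<open>k\<close> contributes the trace of \<open>P L\<^sub>1 \<dots> L\<^sub>k\<close>, and the powers of \<open>q\<close> in front add up to
  a Gaussian binomial coefficient (\<open>trace_char_prod\<close>, \<open>gauss_coeff_q_fact\<close>).

  It remains to remove the superfluous tensor factors \<open>k + 1, \<dots>, m\<close>.  The partial \<open>R\<close>-trace of the
  skew-symmetrizer of degree \<open>j + 1\<close> is a multiple of that of degree \<open>j\<close>, and the factor depends only
  on the trace of the matrix \<open>C\<close> (\<open>partial_trace_skew_symmetrizer\<close>).  This trace is determined by the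
  bi-rank: a component of the exterior algebra vanishes exactly if its skew-symmetrizer does, so for
  bi-rank \<open>(m|0)\<close> the skew-symmetrizer of degree \<open>m + 1\<close> vanishes and that of degree \<open>m\<close> does not;
  then the factor that links them is zero, which gives \<open>q\<^sup>m Tr C = m\<^sub>q\<close> (\<open>C_tr_bi_rank\<close>).  With this
  value the factors multiply to the inverse of the same Gaussian coefficient up to a power of \<open>q\<close>
  (\<open>R_trace_reduce\<close>, \<open>char_poly_identity\<close>).

  Two facts support this.  The \<open>R\<close>-trace is cyclic with respect to the \<open>R\<^sub>i\<close> because \<open>C \<otimes> C\<close> commutes
  with \<open>R\<close> (\<open>C_C_commute\<close>), a consequence of the braid relation and of the skew inverse.  And the
  skew-symmetrizer of degree \<open>k\<close> is an eigenvector of \<open>R\<^sub>1, \<dots>, R\<^bsub>k-1\<^esub>\<close> on both sides (\<open>skew_eigen\<close>),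
  by the relations of the Hecke algebra.

  The computation is carried out for a matrix over an arbitrary ring that is a type, and is applied
  to polynomials over the free algebra on the entries of \<open>L\<close>; the ring homomorphism to
  polynomials over the Reflection Equation algebra transports the result (\<open>rea_eval_hom\<close>).
\<close>

section \<open>Quantum integers\<close>

text \<open>An equality would give \<open>q ^ (2 * k) = 1\<close>.\<close>

lemma generic_power_neq:
  fixes q :: "'k::field"
  assumes "generic q" and "k > 0"
  shows "q ^ k \<noteq> inverse q ^ k"
proof
  assume eq: "q ^ k = inverse q ^ k"
  have q: "q \<noteq> 0" using assms by (simp add: generic_def)
  have "q ^ (2 * k) = q ^ k * inverse q ^ k"
    using eq by (simp add: mult_2 power_add)
  also have "\<dots> = 1" using q by (simp add: power_inverse)
  finally have "q powi (int (2 * k)) = 1" by (simp only: power_int_of_nat)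
  moreover have "int (2 * k) \<noteq> 0" using assms(2) by simp
  ultimately show False using assms(1) unfolding generic_def by blast
qed

lemma q_number_nonzero:
  fixes q :: "'k::field"
  assumes "generic q" and "k > 0"
  shows "q_number q k \<noteq> 0"
  using generic_power_neq[OF assms] generic_power_neq[OF assms(1), of 1]
  by (simp add: q_number_def)

lemma q_number_0 [simp]: "q_number q 0 = 0"
  by (simp add: q_number_def)

lemma q_number_Suc_0 [simp]:
  "generic q \<Longrightarrow> q_number q (Suc 0) = 1"
  using generic_power_neq[of q 1] by (simp add: q_number_def)

lemma q_number_times:
  "generic q \<Longrightarrow> q_number q k * (q - inverse q) = q ^ k - inverse q ^ k"
  using generic_power_neq[of q 1] by (simp add: q_number_def)

lemma q_number_Suc:
  fixes q :: "'k::field"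
  assumes "generic q"
  shows "q_number q (Suc k) = q ^ k + inverse q * q_number q k"
    and "q * q_number q (Suc k) = q ^ Suc k + q_number q k"
proof -
  have q: "q \<noteq> 0" "q - inverse q \<noteq> 0"
    using assms generic_power_neq[OF assms, of 1] by (auto simp: generic_def)
  have "q_number q (Suc k) * (q - inverse q) = q ^ k * (q - inverse q) + inverse q * (q_number q k * (q - inverse q))"
    unfolding q_number_times[OF assms] by (simp add: algebra_simps)
  also have "\<dots> = (q ^ k + inverse q * q_number q k) * (q - inverse q)"
    by (simp only: distrib_right mult.assoc)
  finally show 1: "q_number q (Suc k) = q ^ k + inverse q * q_number q k" using q by simp
  show "q * q_number q (Suc k) = q ^ Suc k + q_number q k"
    unfolding 1 using q by (simp add: distrib_left mult.assoc[symmetric])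
qed

section \<open>Representations of the Hecke algebra\<close>

text \<open>
  The ring \<open>'b\<close> is an algebra over the field; the scalars act by a function rather than through a
  ring embedding, because then every product has a normal form with one scalar in front.
  The elements \<open>s i\<close> are the inverses of the generators \<open>r i\<close> for \<open>1 \<le> i < n\<close>.
\<close>

locale hecke_algebra =
  fixes scale :: "'k::field \<Rightarrow> 'b::ring_1 \<Rightarrow> 'b" (infixr \<open>\<cdot>\<close> 75)
    and q :: 'k and r s :: "nat \<Rightarrow> 'b" and n :: nat
  assumes generic: "generic q"
    and scale_one [simp]: "1 \<cdot> x = x"
    and scale_scale [simp]: "a \<cdot> b \<cdot> x = (a * b) \<cdot> x"
    and scale_add_left: "(a + b) \<cdot> x = a \<cdot> x + b \<cdot> x"
    and scale_add_right: "a \<cdot> (x + y) = a \<cdot> x + a \<cdot> y"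
    and mult_scale_left [simp]: "(a \<cdot> x) * y = a \<cdot> (x * y)"
    and mult_scale_right [simp]: "x * (a \<cdot> y) = a \<cdot> (x * y)"
    and hecke: "1 \<le> i \<Longrightarrow> i < n \<Longrightarrow> (q \<cdot> 1 - r i) * (inverse q \<cdot> 1 + r i) = 0"
    and braid: "1 \<le> i \<Longrightarrow> Suc i < n \<Longrightarrow> r i * r (Suc i) * r i = r (Suc i) * r i * r (Suc i)"
    and far: "1 \<le> i \<Longrightarrow> i + 2 \<le> j \<Longrightarrow> j < n \<Longrightarrow> r i * r j = r j * r i"
    and inv_right: "1 \<le> i \<Longrightarrow> i < n \<Longrightarrow> r i * s i = 1"
    and inv_left: "1 \<le> i \<Longrightarrow> i < n \<Longrightarrow> s i * r i = 1"
begin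

lemma scale_zero_left [simp]: "0 \<cdot> x = 0"
  using scale_add_left[of 0 0 x] by simp

lemma scale_zero_right [simp]: "a \<cdot> 0 = 0"
  using scale_add_right[of a 0 0] by simp

lemma scale_minus_left: "(- a) \<cdot> x = - (a \<cdot> x)"
  using scale_add_left[of a "- a" x] by (simp add: eq_neg_iff_add_eq_0 add.commute)

lemma scale_minus_right: "a \<cdot> (- x) = - (a \<cdot> x)"
  using scale_add_right[of a x "- x"] by (simp add: eq_neg_iff_add_eq_0 add.commute)

lemma scale_diff_left: "(a - b) \<cdot> x = a \<cdot> x - b \<cdot> x"
  using scale_add_left[of a "- b" x] by (simp add: scale_minus_left)

lemma scale_diff_right: "a \<cdot> (x - y) = a \<cdot> x - a \<cdot> y"
  using scale_add_right[of a x "- y"] by (simp add: scale_minus_right)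

lemma q_nonzero: "q \<noteq> 0"
  using generic by (simp add: generic_def)

fun skew :: "nat \<Rightarrow> 'b" where
  "skew 0 = 1"
| "skew (Suc 0) = 1"
| "skew (Suc (Suc k)) = (1 / q_number q (Suc (Suc k))) \<cdot>
     (skew (Suc k) * (q ^ Suc k \<cdot> 1 - q_number q (Suc k) \<cdot> r (Suc k)) * skew (Suc k))"

lemma skew_commute:
  assumes "\<And>i. 1 \<le> i \<Longrightarrow> i < k \<Longrightarrow> y * r i = r i * y"
  shows "y * skew k = skew k * y"
  using assms
proof (induction k rule: skew.induct)
  case (3 k)
  let ?M = "q ^ Suc k \<cdot> 1 - q_number q (Suc k) \<cdot> r (Suc k)"
  have IH: "y * skew (Suc k) = skew (Suc k) * y" using 3 by simp
  have r: "y * r (Suc k) = r (Suc k) * y" using 3(3)[of "Suc k"] by simp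
  have M: "y * ?M = ?M * y"
    by (simp add: right_diff_distrib left_diff_distrib r)
  have "y * (skew (Suc k) * ?M * skew (Suc k)) = skew (Suc k) * ?M * skew (Suc k) * y"
  proof -
    have "y * (skew (Suc k) * ?M * skew (Suc k)) = skew (Suc k) * (y * ?M) * skew (Suc k)"
      by (simp only: mult.assoc[symmetric] IH)
    also have "\<dots> = skew (Suc k) * ?M * (y * skew (Suc k))"
      by (simp only: M mult.assoc)
    finally show ?thesis by (simp only: IH mult.assoc)
  qed
  then show ?case by (simp only: skew.simps mult_scale_right mult_scale_left)
qed simp_all

lemma hecke_right:
  assumes "1 \<le> i" "i < n"
  shows "r i * (inverse q \<cdot> 1 + r i) = q \<cdot> (inverse q \<cdot> 1 + r i)"
  using hecke[OF assms] by (simp add: left_diff_distrib)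

lemma hecke_left:
  assumes "1 \<le> i" "i < n"
  shows "(inverse q \<cdot> 1 + r i) * r i = q \<cdot> (inverse q \<cdot> 1 + r i)"
  using hecke_right[OF assms] by (simp add: distrib_left distrib_right)

text \<open>
  The coefficient that remains in the two lemmas below after the braid relation has removed
  the term of third order.
\<close>

lemma skew_scalar_zero:
  "q ^ Suc k * q ^ k + q ^ Suc k * q_number q k * inverse q - q_number q (Suc k) * q ^ k * q = 0"
proof -
  have "q ^ k * (q ^ Suc k + q_number q k - q * q_number q (Suc k)) = 0"
    using q_number_Suc(2)[OF generic, of k] by simp
  moreover have "q ^ Suc k * q_number q k * inverse q = q ^ k * q_number q k"
    using q_nonzero by simp
  ultimately show ?thesis by (simp only: right_diff_distrib distrib_left) (simp add: mult_ac)
qed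

text \<open>
  Write \<open>Y\<close> for the last factor, which \<open>r (Suc k)\<close> multiplies by \<open>q\<close>.  In the expansion, the
  product \<open>g * r (Suc k) * r k * Y\<close> is zero: in its part with three generators the braid relation moves
  \<open>r k\<close> to \<open>g\<close>, where it becomes \<open>- inverse q\<close>, and this cancels the other part.
  The other three terms are multiples of \<open>g * Y\<close>.
\<close>

lemma skew_step_right:
  assumes k: "1 \<le> k" "Suc k < n" and g: "g * r k = - inverse q \<cdot> g"
  shows "g * (q ^ Suc k \<cdot> 1 - q_number q (Suc k) \<cdot> r (Suc k)) *
     (q ^ k \<cdot> 1 - q_number q k \<cdot> r k) * (inverse q \<cdot> 1 + r (Suc k)) = 0"
proof -
  let ?n = "q_number q (Suc k)" and ?m = "q_number q k"
  let ?A = "r k" and ?B = "r (Suc k)"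
  let ?Y = "inverse q \<cdot> 1 + ?B"
  have BY: "?B * ?Y = q \<cdot> ?Y" using hecke_right[of "Suc k"] k by simp
  have gA: "g * (?A * x) = - inverse q \<cdot> (g * x)" for x
    using g by (metis mult.assoc mult_scale_left)
  have "g * (?B * (?A * ?Y)) = g * (?B * ?A * ?B) + inverse q \<cdot> (g * (?B * ?A))"
    by (simp add: distrib_left mult.assoc)
  also have "\<dots> = 0"
    using k by (simp add: braid[symmetric]) (simp add: mult.assoc gA scale_minus_left)
  finally have BAY: "g * (?B * (?A * ?Y)) = 0" .
  define Y where "Y = ?Y"
  have "g * (q ^ Suc k \<cdot> 1 - ?n \<cdot> ?B) * (q ^ k \<cdot> 1 - ?m \<cdot> ?A) * Y
     = (q ^ Suc k * q ^ k) \<cdot> (g * Y) - (q ^ Suc k * ?m) \<cdot> (g * (?A * Y))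
       - (?n * q ^ k) \<cdot> (g * (?B * Y)) + (?n * ?m) \<cdot> (g * (?B * (?A * Y)))"
    by (simp add: right_diff_distrib left_diff_distrib mult.assoc scale_diff_right mult.commute
        del: power_Suc)
  also have "\<dots> = (q ^ Suc k * q ^ k + q ^ Suc k * ?m * inverse q - ?n * q ^ k * q) \<cdot> (g * Y)"
    unfolding gA using BAY BY
    by (simp add: Y_def[symmetric] scale_add_left scale_diff_left scale_minus_left scale_minus_right mult.assoc del: power_Suc)
  finally show ?thesis unfolding skew_scalar_zero by (simp add: Y_def)
qed

text \<open>The mirror image of the previous computation.\<close>

lemma skew_step_left:
  assumes k: "1 \<le> k" "Suc k < n" and g: "r k * g = - inverse q \<cdot> g"
  shows "(inverse q \<cdot> 1 + r (Suc k)) * (q ^ k \<cdot> 1 - q_number q k \<cdot> r k) *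
     (q ^ Suc k \<cdot> 1 - q_number q (Suc k) \<cdot> r (Suc k)) * g = 0"
proof -
  let ?n = "q_number q (Suc k)" and ?m = "q_number q k"
  let ?A = "r k" and ?B = "r (Suc k)"
  let ?Y = "inverse q \<cdot> 1 + ?B"
  have YB: "?Y * (?B * x) = q \<cdot> (?Y * x)" for x
    using hecke_left[of "Suc k"] k by (metis Suc_leI le_SucI mult.assoc mult_scale_left)
  have "?Y * (?A * (?B * g)) = ?B * ?A * ?B * g + inverse q \<cdot> (?A * (?B * g))"
    by (simp add: distrib_right mult.assoc)
  also have "\<dots> = 0"
    using k by (simp add: braid[symmetric]) (simp add: mult.assoc g scale_minus_left)
  finally have YAB: "?Y * (?A * (?B * g)) = 0" .
  define Y where "Y = ?Y"
  have "Y * (q ^ k \<cdot> 1 - ?m \<cdot> ?A) * (q ^ Suc k \<cdot> 1 - ?n \<cdot> ?B) * g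
     = (q ^ Suc k * q ^ k) \<cdot> (Y * g) - (q ^ Suc k * ?m) \<cdot> (Y * (?A * g))
       - (?n * q ^ k) \<cdot> (Y * (?B * g)) + (?n * ?m) \<cdot> (Y * (?A * (?B * g)))"
    by (simp add: right_diff_distrib left_diff_distrib mult.assoc scale_diff_right mult.commute
        del: power_Suc)
  also have "\<dots> = (q ^ Suc k * q ^ k + q ^ Suc k * ?m * inverse q - ?n * q ^ k * q) \<cdot> (Y * g)"
    unfolding g using YAB YB
    by (simp add: Y_def[symmetric] scale_add_left scale_diff_left scale_minus_left scale_minus_right mult.assoc del: power_Suc)
  finally show ?thesis unfolding skew_scalar_zero by (simp add: Y_def)
qed

text \<open>
  On an element on which all generators act by the sign character, each step of the recursion
  multiplies by \<open>(q ^ k + inverse q * k\<^sub>q) / (k+1)\<^sub>q = 1\<close>.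
\<close>

lemma absorb_skew_right:
  assumes "\<And>i. 1 \<le> i \<Longrightarrow> i < k \<Longrightarrow> g * r i = - inverse q \<cdot> g"
  shows "g * skew k = g"
  using assms
proof (induction k rule: skew.induct)
  case (3 k)
  have IH: "g * skew (Suc k) = g" using 3 by simp
  have "g * skew (Suc (Suc k)) = (1 / q_number q (Suc (Suc k))) \<cdot>
      (g * skew (Suc k) * (q ^ Suc k \<cdot> 1 - q_number q (Suc k) \<cdot> r (Suc k)) * skew (Suc k))"
    by (simp add: mult.assoc)
  also have "\<dots> = (1 / q_number q (Suc (Suc k))) \<cdot>
      ((q ^ Suc k + inverse q * q_number q (Suc k)) \<cdot> (g * skew (Suc k)))"
    using 3(3)[of "Suc k"]
    by (simp add: IH right_diff_distrib left_diff_distrib distrib_right scale_add_left scale_minus_left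
        scale_minus_right mult.assoc mult.commute del: power_Suc)
  also have "\<dots> = g"
    using q_number_Suc(1)[OF generic, of "Suc k"] q_number_nonzero[OF generic, of "Suc (Suc k)"]
    by (simp add: IH del: power_Suc)
  finally show ?case .
qed simp_all

lemma absorb_skew_left:
  assumes "\<And>i. 1 \<le> i \<Longrightarrow> i < k \<Longrightarrow> r i * g = - inverse q \<cdot> g"
  shows "skew k * g = g"
  using assms
proof (induction k rule: skew.induct)
  case (3 k)
  have IH: "skew (Suc k) * g = g" using 3 by simp
  have "skew (Suc (Suc k)) * g = (1 / q_number q (Suc (Suc k))) \<cdot>
      (skew (Suc k) * ((q ^ Suc k \<cdot> 1 - q_number q (Suc k) \<cdot> r (Suc k)) * (skew (Suc k) * g)))"
    by (simp add: mult.assoc)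
  also have "\<dots> = (1 / q_number q (Suc (Suc k))) \<cdot>
      ((q ^ Suc k + inverse q * q_number q (Suc k)) \<cdot> (skew (Suc k) * g))"
    using 3(3)[of "Suc k"]
    by (simp add: IH right_diff_distrib left_diff_distrib distrib_left scale_add_left scale_minus_left
        scale_minus_right mult.assoc mult.commute del: power_Suc)
  also have "\<dots> = g"
    using q_number_Suc(1)[OF generic, of "Suc k"] q_number_nonzero[OF generic, of "Suc (Suc k)"]
    by (simp add: IH del: power_Suc)
  finally show ?case .
qed simp_all

text \<open>
  For \<open>i < k - 1\<close> the outer factors \<open>skew (k - 1)\<close> of the recursion do it.  For
  \<open>i = k - 1\<close>, unfold one of these outer factors once more.  The copies of \<open>skew (k - 2)\<close> produced in this
  way commute with \<open>r (k - 1)\<close> and are absorbed, and what is left is the product of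
  \<open>skew_step_right\<close> or \<open>skew_step_left\<close>.
\<close>

lemma skew_eigen:
  assumes "k \<le> n" "1 \<le> i" "i < k"
  shows "skew k * r i = - inverse q \<cdot> skew k" and "r i * skew k = - inverse q \<cdot> skew k"
proof -
  have "skew k * r i = - inverse q \<cdot> skew k \<and> r i * skew k = - inverse q \<cdot> skew k"
    using assms
  proof (induction k arbitrary: i rule: skew.induct)
    case (3 k)
    let ?P = "skew (Suc k)" and ?B = "r (Suc k)"
    let ?M = "q ^ Suc k \<cdot> 1 - q_number q (Suc k) \<cdot> ?B"
    have P: "?P * r j = - inverse q \<cdot> ?P" "r j * ?P = - inverse q \<cdot> ?P"
      if "1 \<le> j" "j < Suc k" for j
      using 3(1)[of j] 3(3) that by auto
    \<comment> \<open>The new generator; in degree 2 this is the Hecke relation itself.\<close>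
    have zero: "?P * ?M * ?P * (inverse q \<cdot> 1 + ?B) = 0 \<and> (inverse q \<cdot> 1 + ?B) * (?P * ?M * ?P) = 0"
    proof (cases k)
      case 0
      have "?M = q \<cdot> 1 - r 1" using generic by (simp add: 0)
      moreover have "(q \<cdot> 1 - r 1) * (inverse q \<cdot> 1 + r 1) = 0"
        using hecke[of 1] 3(3) by simp
      moreover have "(inverse q \<cdot> 1 + r 1) * (q \<cdot> 1 - r 1) = 0"
        using hecke_left[of 1] 3(3) by (simp add: right_diff_distrib)
      ultimately show ?thesis by (simp add: 0)
    next
      case (Suc j)
      let ?P' = "skew k" and ?A = "q ^ k \<cdot> 1 - q_number q k \<cdot> r k" and ?Y = "inverse q \<cdot> 1 + ?B"
      have comm: "?B * ?P' = ?P' * ?B"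
      proof (rule skew_commute)
        show "?B * r i = r i * ?B" if "1 \<le> i" "i < k" for i
          using far[of i "Suc k"] that 3(3) by simp
      qed
      have MP: "?M * ?P' = ?P' * ?M" and YP: "?Y * ?P' = ?P' * ?Y"
        by (simp_all add: right_diff_distrib left_diff_distrib distrib_left distrib_right comm)
      have PP: "?P * ?P' = ?P" "?P' * ?P = ?P"
        using P by (auto intro!: absorb_skew_right absorb_skew_left)
      have P_rec: "?P = (1 / q_number q (Suc k)) \<cdot> (?P' * ?A * ?P')"
        by (simp add: Suc)
      have "?P * ?M * ?A * ?Y = 0"
        using skew_step_right[of k ?P] P[of k] 3(3) Suc by simp
      moreover have "?P * ?M * (?P' * ?A * ?P') * ?Y = ?P * ?M * ?A * ?Y * ?P'"
      proof -
        have "?P * ?M * (?P' * ?A * ?P') * ?Y = ?P * (?M * ?P') * ?A * (?P' * ?Y)"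
          by (simp only: mult.assoc)
        also have "\<dots> = (?P * ?P') * ?M * ?A * (?Y * ?P')"
          by (simp only: MP YP mult.assoc)
        finally show ?thesis by (simp only: PP mult.assoc)
      qed
      ultimately have 1: "?P * ?M * (?P' * ?A * ?P') * ?Y = 0" by simp
      have "?Y * ?A * ?M * ?P = 0"
        using skew_step_left[of k ?P] P[of k] 3(3) Suc by simp
      moreover have "?Y * ((?P' * ?A * ?P') * ?M * ?P) = ?P' * (?Y * ?A * ?M * ?P)"
      proof -
        have "?Y * ((?P' * ?A * ?P') * ?M * ?P) = (?Y * ?P') * ?A * (?P' * ?M) * ?P"
          by (simp only: mult.assoc)
        also have "\<dots> = ?P' * ?Y * ?A * ?M * (?P' * ?P)"
          by (simp only: MP[symmetric] YP mult.assoc)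
        finally show ?thesis by (simp only: PP mult.assoc)
      qed
      ultimately have 2: "?Y * ((?P' * ?A * ?P') * ?M * ?P) = 0" by simp
      have "?P * ?M * ?P * ?Y = (1 / q_number q (Suc k)) \<cdot> (?P * ?M * (?P' * ?A * ?P') * ?Y)"
        by (subst (2) P_rec) (simp only: mult_scale_left mult_scale_right)
      moreover have "?Y * (?P * ?M * ?P) = (1 / q_number q (Suc k)) \<cdot> (?Y * ((?P' * ?A * ?P') * ?M * ?P))"
        by (subst (1) P_rec) (simp only: mult_scale_left mult_scale_right)
      ultimately show ?thesis using 1 2 by simp
    qed
    show ?case
    proof (cases "i = Suc k")
      case True
      define Z where "Z = ?P * ?M * ?P"
      have "Z * ?B = - inverse q \<cdot> Z" "?B * Z = - inverse q \<cdot> Z"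
        using zero unfolding Z_def[symmetric]
        by (auto simp: distrib_left distrib_right scale_minus_left eq_neg_iff_add_eq_0 add.commute)
      moreover have "skew (Suc (Suc k)) = (1 / q_number q (Suc (Suc k))) \<cdot> Z"
        by (simp add: Z_def)
      ultimately show ?thesis by (simp add: True mult.commute)
    next
      case False
      then have i: "1 \<le> i" "i < Suc k" using 3 by auto
      have "?P * ?M * ?P * r i = - inverse q \<cdot> (?P * ?M * ?P)"
        "r i * (?P * ?M * ?P) = - inverse q \<cdot> (?P * ?M * ?P)"
        using P[OF i] by (metis mult.assoc mult_scale_right, metis mult.assoc mult_scale_left)
      moreover have "skew (Suc (Suc k)) = (1 / q_number q (Suc (Suc k))) \<cdot> (?P * ?M * ?P)"
        by simp
      ultimately show ?thesis by (simp only: mult_scale_left mult_scale_right scale_scale mult.commute)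
    qed
  qed simp_all
  then show "skew k * r i = - inverse q \<cdot> skew k" "r i * skew k = - inverse q \<cdot> skew k" by auto
qed

lemma skew_idem:
  assumes "k \<le> n"
  shows "skew k * skew k = skew k"
  using assms by (intro absorb_skew_right skew_eigen)

section \<open>Copies of a quantum matrix\<close>

text \<open>The braid relation with two of the generators moved to the other side.\<close>

lemma inverse_shift:
  assumes "1 \<le> i" "Suc i < n"
  shows "r (Suc i) * (s i * s (Suc i)) = s i * s (Suc i) * r i"
proof -
  have inv: "r i * s i = 1" "s i * r i = 1" "r (Suc i) * s (Suc i) = 1" "s (Suc i) * r (Suc i) = 1"
    using assms by (simp_all add: inv_left inv_right)
  have "r (Suc i) * r i * (r (Suc i) * (s i * s (Suc i))) = r i * r (Suc i) * (r i * s i) * s (Suc i)"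
    using braid[OF assms] by (metis mult.assoc)
  also have "\<dots> = r i" using inv by (simp add: mult.assoc)
  finally have "s i * (s (Suc i) * (r (Suc i) * r i * (r (Suc i) * (s i * s (Suc i))))) = s i * s (Suc i) * r i"
    by (simp add: mult.assoc)
  moreover have "s i * (s (Suc i) * (r (Suc i) * r i * y)) = y" for y
    by (metis inv(2,4) mult.assoc mult_1_left)
  ultimately show ?thesis by simp
qed

lemma commute_inverse:
  assumes "1 \<le> i" "i < n" "y * r i = r i * y"
  shows "y * s i = s i * y"
  by (metis assms inv_left inv_right mult.assoc mult_1_left mult_1_right)

end

text \<open>The element \<open>x i\<close> stands for the \<open>i\<close>-th copy of a matrix \<open>L\<close>.\<close>

locale quantum_matrix = hecke_algebra scale q r s n
  for scale :: "'k::field \<Rightarrow> 'b::ring_1 \<Rightarrow> 'b" (infixr \<open>\<cdot>\<close> 75) and q r s n +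
  fixes x :: "nat \<Rightarrow> 'b"
  assumes first_commute: "2 \<le> j \<Longrightarrow> j < n \<Longrightarrow> x 1 * r j = r j * x 1"
    and copy: "1 \<le> i \<Longrightarrow> i < n \<Longrightarrow> x (Suc i) = r i * x i * s i"
begin

text \<open>
  Since \<open>x i = r (i - 1) \<cdots> r 1 * x 1 * s 1 \<cdots> s (i - 1)\<close>, a generator \<open>r j\<close> with \<open>j < i - 1\<close> becomes
  \<open>r (j + 1)\<close> when it passes the first group, and \<open>r j\<close> again after the second one.
\<close>

lemma copy_commute:
  assumes "1 \<le> i" "i \<le> n" "1 \<le> j" "j < n" "j \<noteq> i" "Suc j \<noteq> i"
  shows "x i * r j = r j * x i"
  using assms
proof (induction i arbitrary: j rule: less_induct)
  case (less i')
  show ?case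
  proof (cases "i' = 1")
    case True
    then show ?thesis using less.prems by (auto intro: first_commute[simplified])
  next
    case False
    then obtain i where i': "i' = Suc i" and i_pos: "1 \<le> i"
      using less.prems by (cases i') auto
  note x = copy[of i]
  show ?thesis
  proof (cases "Suc j = i")
    case False
    have r: "r i * r j = r j * r i"
      using less.prems False i' i_pos far[of i j] far[of j i] by (cases "j < i") auto
    have "x i * r j = r j * x i"
      using less.IH[of i j] less.prems i' i_pos False by simp
    moreover have "s i * r j = r j * s i"
      using commute_inverse[of i "r j"] r less.prems i' i_pos by simp
    ultimately have "r i * x i * s i * r j = r j * (r i * x i * s i)"
      using r by (metis mult.assoc)
    then show ?thesis using x less.prems i' i_pos by simp
  next
    case True
    then have i: "i = Suc j" by simp
    have j: "1 \<le> j" "Suc j < n" using less.prems i i' by auto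
    have xi: "x i = r j * x j * s j" using copy[of j] i j by simp
    have c: "x j * r i = r i * x j"
      using less.IH[of j i] less.prems i i' j by simp
    have "x (Suc i) * r j = r i * (r j * x j * s j) * s i * r j"
      using x xi j i by simp
    also have "\<dots> = r i * r j * x j * (s j * s i * r j)"
      by (simp add: mult.assoc)
    also have "\<dots> = r i * r j * (x j * r i) * (s j * s i)"
      using inverse_shift[OF j] i by (simp add: mult.assoc)
    also have "\<dots> = r i * r j * r i * x j * (s j * s i)"
      unfolding c by (simp add: mult.assoc)
    also have "\<dots> = r j * r i * r j * x j * (s j * s i)"
      using braid[OF j] i by simp
    also have "\<dots> = r j * x (Suc i)"
      using x xi j i by (simp add: mult.assoc)
    finally show ?thesis by (simp add: i')
    qed
  qed
qed

end

section \<open>Gaussian coefficients\<close>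

text \<open>The elementary symmetric polynomial of degree \<open>j - k\<close> in \<open>1, q\<^sup>2, \<dots>, q\<^bsup>2(j-1)\<^esup>\<close>.\<close>

fun gauss_coeff :: "'k::field \<Rightarrow> nat \<Rightarrow> nat \<Rightarrow> 'k" where
  "gauss_coeff q 0 k = (if k = 0 then 1 else 0)"
| "gauss_coeff q (Suc j) 0 = q ^ (2 * j) * gauss_coeff q j 0"
| "gauss_coeff q (Suc j) (Suc k) = q ^ (2 * j) * gauss_coeff q j (Suc k) + gauss_coeff q j k"

lemma gauss_coeff_above: "j < k \<Longrightarrow> gauss_coeff q j k = 0"
  by (induction q j k rule: gauss_coeff.induct) auto

definition q_fact :: "'k::field \<Rightarrow> nat \<Rightarrow> 'k" where
  "q_fact q n = (\<Prod>i=1..n. q_number q i)"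

lemma q_fact_0 [simp]: "q_fact q 0 = 1"
  by (simp add: q_fact_def)

lemma q_fact_Suc: "q_fact q (Suc n) = q_number q (Suc n) * q_fact q n"
  by (simp add: q_fact_def prod.atLeast1_atMost_eq mult.commute)

lemma q_fact_nonzero: "generic q \<Longrightarrow> q_fact q n \<noteq> 0"
  by (simp add: q_fact_def q_number_nonzero)

text \<open>The Pascal rule of the Gaussian coefficients, with the common factorials cancelled.\<close>

lemma q_number_pascal:
  assumes "generic q"
  shows "q ^ (d + k) * q_number q d + q_number q k = q ^ d * q_number q (d + k)"
proof -
  have q: "q \<noteq> 0" "q - inverse q \<noteq> 0"
    using assms generic_power_neq[OF assms, of 1] by (auto simp: generic_def)
  have cancel: "q ^ d * inverse q ^ d = 1" using q by (simp add: power_inverse)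
  have "(q ^ (d + k) * q_number q d + q_number q k) * (q - inverse q)
      = q ^ (d + k) * (q ^ d - inverse q ^ d) + (q ^ k - inverse q ^ k)"
    using q_number_times[OF assms, of d] q_number_times[OF assms, of k]
    by (simp add: distrib_right mult.assoc)
  also have "\<dots> = q ^ d * q ^ (d + k) - inverse q ^ k + q ^ k * (1 - q ^ d * inverse q ^ d)"
    by (simp add: power_add algebra_simps)
  also have "\<dots> = q ^ d * q ^ (d + k) - (q ^ d * inverse q ^ d) * inverse q ^ k"
    by (simp only: cancel) simp
  also have "\<dots> = q ^ d * q_number q (d + k) * (q - inverse q)"
    by (simp only: mult.assoc q_number_times[OF assms]) (simp add: power_add algebra_simps)
  finally show ?thesis using q by simp
qed

text \<open>The closed form \<open>q ^ ((j - k) * (j - 1))\<close> times the Gaussian binomial, written without a quotient.\<close>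

lemma gauss_coeff_q_fact:
  assumes "generic q" and "k \<le> j"
  shows "gauss_coeff q j k * (q_fact q k * q_fact q (j - k)) = q ^ ((j - k) * (j - 1)) * q_fact q j"
  using assms(2)
proof (induction j arbitrary: k)
  case (Suc j)
  note nz = q_fact_nonzero[OF assms(1)]
  show ?case
  proof (cases k)
    case 0
    have "gauss_coeff q j 0 = q ^ (j * (j - 1))" using Suc.IH[of 0] nz[of j] by simp
    moreover have "2 * j + j * (j - 1) = Suc j * j" by (cases j) simp_all
    ultimately show ?thesis by (simp add: 0 power_add[symmetric] del: mult_Suc)
  next
    case (Suc i)
    with Suc.prems have i: "i \<le> j" by simp
    show ?thesis
    proof (cases "i = j")
      case True
      have "gauss_coeff q j j = 1" using Suc.IH[of j] nz[of j] by simp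
      then show ?thesis by (simp add: True Suc gauss_coeff_above)
    next
      case False
      with i obtain e where e: "j = Suc (i + e)" by (metis less_imp_Suc_add le_neq_implies_less)
      let ?F = "\<lambda>k. q_fact q k" and ?d = "Suc e"
      have 1: "gauss_coeff q j (Suc i) * (?F (Suc i) * ?F e) = q ^ (e * (i + e)) * ?F j"
        using Suc.IH[of "Suc i"] e by simp
      have 2: "gauss_coeff q j i * (?F i * ?F ?d) = q ^ (?d * (i + e)) * ?F j"
        using Suc.IH[of i] e by (simp add: Suc_diff_le)
      have "gauss_coeff q (Suc j) (Suc i) * (?F (Suc i) * ?F ?d)
          = q ^ (2 * j) * (gauss_coeff q j (Suc i) * (?F (Suc i) * ?F e)) * q_number q ?d
            + gauss_coeff q j i * (?F i * ?F ?d) * q_number q (Suc i)"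
        by (simp add: q_fact_Suc algebra_simps)
      also have "\<dots> = q ^ (?d * (i + e)) * ?F j * (q ^ (?d + Suc i) * q_number q ?d + q_number q (Suc i))"
      proof -
        have "2 * j + e * (i + e) = ?d * (i + e) + (?d + Suc i)" by (simp add: e)
        then have "q ^ (2 * j) * q ^ (e * (i + e)) = q ^ (?d * (i + e)) * q ^ (?d + Suc i)"
          by (simp only: power_add[symmetric])
        then have *: "q ^ (2 * j) * (q ^ (e * (i + e)) * y) = q ^ (?d * (i + e)) * q ^ (?d + Suc i) * y" for y
          by (simp only: mult.assoc[symmetric])
        show ?thesis unfolding 1 2 * by (simp only: distrib_left mult_ac)
      qed
      also have "\<dots> = q ^ (?d * j) * (q_number q (Suc j) * ?F j)"
        unfolding q_number_pascal[OF assms(1)] by (simp add: e power_add mult_ac add.commute)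
      finally show ?thesis using Suc e by (simp add: q_fact_Suc Suc_diff_le)
    qed
  qed
qed simp

section \<open>Expansion of the characteristic product under a trace\<close>

primrec upto_prod :: "(nat \<Rightarrow> 'b::monoid_mult) \<Rightarrow> nat \<Rightarrow> 'b" where
  "upto_prod f 0 = 1"
| "upto_prod f (Suc k) = upto_prod f k * f (Suc k)"

lemma commute_mult:
  fixes a b y :: "'b::semigroup_mult"
  assumes "a * y = y * a" "b * y = y * b"
  shows "a * b * y = y * (a * b)"
  by (metis assms mult.assoc)

text \<open>The functional \<open>\<tau>\<close> abstracts the \<open>R\<close>-trace over all \<open>n\<close> tensor factors.\<close>

locale quantum_trace = quantum_matrix scale q r s n x
  for scale :: "'k::field \<Rightarrow> 'b::ring_1 \<Rightarrow> 'b" (infixr \<open>\<cdot>\<close> 75) and q r s n x +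
  fixes \<tau> :: "'b \<Rightarrow> 'a::ring_1" and t :: 'b
  assumes trace_add: "\<tau> (y + z) = \<tau> y + \<tau> z"
    and trace_cyclic: "1 \<le> i \<Longrightarrow> i < n \<Longrightarrow> \<tau> (r i * y) = \<tau> (y * r i)"
    and t_central: "t * y = y * t"
begin

lemma trace_diff: "\<tau> (y - z) = \<tau> y - \<tau> z"
  using trace_add[of "y - z" z] by simp

lemma trace_zero: "\<tau> 0 = 0"
  using trace_add[of 0 0] by simp

lemma trace_cyclic_inverse:
  assumes "1 \<le> i" "i < n"
  shows "\<tau> (y * s i) = \<tau> (s i * y)"
proof -
  have "\<tau> (y * s i) = \<tau> (r i * (s i * y * s i))"
    using inv_right[OF assms] by (simp add: mult.assoc[symmetric])
  also have "\<dots> = \<tau> (s i * y)"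
    using trace_cyclic[OF assms] inv_left[OF assms] by (simp add: mult.assoc)
  finally show ?thesis .
qed

lemma skew_eigen_inverse:
  assumes "1 \<le> i" "i < n"
  shows "s i * skew n = - q \<cdot> skew n"
proof -
  have "skew n = s i * (r i * skew n)"
    using inv_left[OF assms] by (simp add: mult.assoc[symmetric])
  also have "\<dots> = - inverse q \<cdot> (s i * skew n)"
    using skew_eigen(2)[of n i] assms by simp
  finally have "- q \<cdot> skew n = - q \<cdot> - inverse q \<cdot> (s i * skew n)" by simp
  then show ?thesis using q_nonzero by simp
qed

lemma prod_commute:
  assumes "k < i" "i < n"
  shows "upto_prod x k * r i = r i * upto_prod x k"
  using assms
proof (induction k)
  case (Suc k)
  then have "x (Suc k) * r i = r i * x (Suc k)" by (intro copy_commute) auto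
  with Suc show ?case by (simp add: commute_mult)
qed simp

text \<open>
  To lower \<open>i + 1\<close> to \<open>i\<close>, write \<open>x (i + 1) = r i * x i * s i\<close>.  All factors other than \<open>x i\<close> commute with
  \<open>r i\<close> and \<open>s i\<close>, so \<open>r i\<close> reaches \<open>skew n\<close> from the right and gives \<open>- inverse q\<close>, while \<open>s i\<close>
  travels around the trace to \<open>skew n\<close> and gives \<open>- q\<close>.
\<close>

lemma trace_shift:
  assumes "Suc k \<le> i" "i \<le> n" "\<And>j. 1 \<le> j \<Longrightarrow> j < i \<Longrightarrow> z * r j = r j * z"
  shows "\<tau> (skew n * upto_prod x k * x i * z) = \<tau> (skew n * upto_prod x (Suc k) * z)"
  using assms
proof (induction i rule: dec_induct)
  case base
  then show ?case by (simp add: mult.assoc)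
next
  case (step i)
  have i: "1 \<le> i" "i < n" using step by auto
  have z: "z * s i = s i * z"
    using commute_inverse[OF i] step i by simp
  define Y where "Y = upto_prod x k * x i * z"
  have "skew n * upto_prod x k * x (Suc i) * z = skew n * (upto_prod x k * r i) * x i * (s i * z)"
    using copy[OF i] by (simp add: mult.assoc)
  also have "\<dots> = skew n * r i * Y * s i"
    unfolding prod_commute[of k i, OF _ i(2)] using prod_commute[of k i] step z
    by (simp add: Y_def mult.assoc)
  also have "\<dots> = - inverse q \<cdot> (skew n * Y) * s i"
    using skew_eigen(1)[of n i] i by (simp add: mult.assoc)
  finally have "\<tau> (skew n * upto_prod x k * x (Suc i) * z) = \<tau> (s i * (- inverse q \<cdot> (skew n * Y)))"
    by (simp only: trace_cyclic_inverse[OF i])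
  also have "s i * (- inverse q \<cdot> (skew n * Y)) = skew n * Y"
    using skew_eigen_inverse[OF i] q_nonzero by (simp add: mult.assoc[symmetric])
  finally show ?case using step by (simp add: Y_def mult.assoc)
qed

text \<open>
  The factor \<open>z\<close> makes the induction possible: it holds the factors of the product that have not
  been expanded yet, and it commutes with the generators used in lowering indices.
\<close>

lemma trace_char_prod_aux:
  assumes "j \<le> n" "\<And>i. 1 \<le> i \<Longrightarrow> i < j \<Longrightarrow> z * r i = r i * z"
  shows "\<tau> (skew n * upto_prod (\<lambda>i. q ^ (2 * (i - 1)) \<cdot> t - x i) j * z) =
    (\<Sum>k\<le>j. \<tau> (((- 1) ^ k * gauss_coeff q j k) \<cdot> (skew n * upto_prod x k * (t ^ (j - k) * z))))"
  using assms
proof (induction j arbitrary: z)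
  case (Suc j)
  \<comment> \<open>The last factor joins \<open>z\<close>; its summand with \<open>x (Suc j)\<close> is then lowered to \<open>x (Suc k)\<close>.\<close>
  define T where "T k = skew n * upto_prod x k * (t ^ (Suc j - k) * z)" for k
  define c where "c k = (- 1) ^ k * gauss_coeff q j k" for k
  let ?z = "(q ^ (2 * j) \<cdot> t - x (Suc j)) * z"
  have tp: "t ^ i * y = y * t ^ i" for i y
    by (induction i) (simp, metis mult.assoc power_Suc t_central)
  have comm: "?z * r i = r i * ?z" if "1 \<le> i" "i < j" for i
  proof -
    have "z * r i = r i * z" "x (Suc j) * r i = r i * x (Suc j)"
      using Suc.prems that by (auto intro: copy_commute)
    then have "(q ^ (2 * j) \<cdot> t - x (Suc j)) * r i = r i * (q ^ (2 * j) \<cdot> t - x (Suc j))"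
      by (simp add: left_diff_distrib right_diff_distrib t_central)
    then show ?thesis using \<open>z * r i = r i * z\<close> by (rule commute_mult)
  qed
  have "\<tau> (c k \<cdot> (skew n * upto_prod x k * (t ^ (j - k) * ?z)))
      = \<tau> ((q ^ (2 * j) * c k) \<cdot> T k) - \<tau> (c k \<cdot> T (Suc k))" if "k \<le> j" for k
  proof -
    have 1: "t ^ (j - k) * (t * z) = t ^ (Suc j - k) * z"
      using that by (simp add: Suc_diff_le power_commutes mult.assoc[symmetric])
    have "c k \<cdot> (skew n * upto_prod x k * (t ^ (j - k) * ?z)) = 
       (q ^ (2 * j) * c k) \<cdot> T k - skew n * upto_prod x k * x (Suc j) * (c k \<cdot> (t ^ (j - k) * z))"
      unfolding T_def 1[symmetric]
      by (simp add: left_diff_distrib right_diff_distrib scale_diff_right mult.commute[of "c k"] mult.assoc tp[of _ "x _ * _"] tp[of _ z])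
    moreover have "\<tau> (skew n * upto_prod x k * x (Suc j) * (c k \<cdot> (t ^ (j - k) * z))) = \<tau> (skew n * upto_prod x (Suc k) * (c k \<cdot> (t ^ (j - k) * z)))"
    proof (rule trace_shift)
      show "c k \<cdot> (t ^ (j - k) * z) * r i = r i * c k \<cdot> (t ^ (j - k) * z)" if "1 \<le> i" "i < Suc j" for i
        using Suc.prems(2)[OF that] tp[of "j - k" "r i"] commute_mult[of "t ^ (j - k)" "r i" z] by simp
    qed (use that Suc.prems in auto)
    ultimately show ?thesis by (simp add: trace_diff T_def)
  qed
  then have "\<tau> (skew n * upto_prod (\<lambda>i. q ^ (2 * (i - 1)) \<cdot> t - x i) (Suc j) * z)
     = (\<Sum>k\<le>j. \<tau> ((q ^ (2 * j) * c k) \<cdot> T k) - \<tau> (c k \<cdot> T (Suc k)))"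
    using Suc.IH[of ?z] comm Suc.prems(1) by (simp add: mult.assoc c_def)
  also have "\<dots> = (\<Sum>k\<le>Suc j. \<tau> ((q ^ (2 * j) * c k) \<cdot> T k)) - (\<Sum>k\<le>j. \<tau> (c k \<cdot> T (Suc k)))"
    by (simp add: sum_subtractf c_def gauss_coeff_above trace_zero)
  also have "\<dots> = \<tau> ((q ^ (2 * j) * c 0) \<cdot> T 0) +
     (\<Sum>k\<le>j. \<tau> ((q ^ (2 * j) * c (Suc k)) \<cdot> T (Suc k)) - \<tau> (c k \<cdot> T (Suc k)))"
    by (simp only: sum.atMost_Suc_shift sum_subtractf) simp
  also have "\<dots> = (\<Sum>k\<le>Suc j. \<tau> (((- 1) ^ k * gauss_coeff q (Suc j) k) \<cdot> T k))"
  proof -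
    have "q ^ (2 * j) * c (Suc k) - c k = (- 1) ^ Suc k * gauss_coeff q (Suc j) (Suc k)" for k
      by (simp add: c_def algebra_simps)
    then have "\<tau> ((q ^ (2 * j) * c (Suc k)) \<cdot> y) - \<tau> (c k \<cdot> y)
        = \<tau> (((- 1) ^ Suc k * gauss_coeff q (Suc j) (Suc k)) \<cdot> y)" for k y
      by (simp only: trace_diff[symmetric] scale_diff_left[symmetric])
    then show ?thesis
      by (simp only: sum.atMost_Suc_shift) (simp add: c_def)
  qed
  finally show ?case by (simp add: T_def)
qed (simp add: gauss_coeff_above)

lemma trace_char_prod:
  "\<tau> (skew n * upto_prod (\<lambda>i. q ^ (2 * (i - 1)) \<cdot> t - x i) n) =
    (\<Sum>k\<le>n. \<tau> (((- 1) ^ k * gauss_coeff q n k) \<cdot> (t ^ (n - k) * (skew n * upto_prod x k))))"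
proof -
  have tp: "t ^ i * y = y * t ^ i" for i y
    by (induction i) (simp, metis mult.assoc power_Suc t_central)
  show ?thesis using trace_char_prod_aux[of n 1] by (simp add: tp)
qed

end

section \<open>Matrices over the ring of a type\<close>

lemma type_ring_simps [simp]:
  "carrier (type_ring :: 'a::ring_1 ring) = UNIV"
  "x \<otimes>\<^bsub>type_ring\<^esub> y = x * (y :: 'a)" "x \<oplus>\<^bsub>type_ring\<^esub> y = x + (y :: 'a)"
  "\<one>\<^bsub>type_ring\<^esub> = (1 :: 'a)" "\<zero>\<^bsub>type_ring\<^esub> = (0 :: 'a)"
  by (simp_all add: ring_of_type_algebra_def)

lemma ring_type_ring: "ring (type_ring :: 'a::ring_1 ring)"
proof -
  have "\<exists>y. x + y = 0" for x :: 'a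
    using add.right_inverse by blast
  moreover have "\<exists>y. y + x = 0" for x :: 'a
    using add.left_inverse by blast
  ultimately show ?thesis
    by unfold_locales (auto simp: ring_of_type_algebra_def algebra_simps Units_def)
qed

lemma finsum_type_ring:
  fixes f :: "'i \<Rightarrow> 'a::ring_1"
  assumes "finite S"
  shows "finsum type_ring f S = sum f S"
proof -
  interpret ring "type_ring :: 'a ring" by (rule ring_type_ring)
  show ?thesis using assms by (induction S rule: finite_induct) simp_all
qed

lemma minus_type_ring: "x \<ominus>\<^bsub>type_ring\<^esub> y = x - (y :: 'a::ring_1)"
proof -
  interpret ring "type_ring :: 'a ring" by (rule ring_type_ring)
  have "(x \<ominus>\<^bsub>type_ring\<^esub> y) + y = x"
    using l_neg[of y] by (simp add: a_minus_def add.assoc)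
  then show ?thesis by (simp add: eq_diff_eq)
qed

abbreviation op_mult :: "('n::finite, 'a::ring_1) tensor_op \<Rightarrow> ('n, 'a) tensor_op \<Rightarrow> ('n, 'a) tensor_op"
  (infixl \<open>\<diamondop>\<close> 70) where
  "S \<diamondop> T \<equiv> S \<star>\<^bsub>type_ring\<^esub> T"

abbreviation op_id :: "('n, 'a::ring_1) tensor_op" where
  "op_id \<equiv> tensor_id type_ring"

lemma finite_words [simp]: "finite {K :: 'n::finite list. length K = n}"
  using finite_lists_length_eq[of "UNIV :: 'n set" n] by simp

lemma op_mult_eq: "(S \<diamondop> T) I J = (\<Sum>K | length K = length I. S I K * T K J)"
  by (simp add: tensor_mult_def finsum_type_ring)

lemma op_id_eq: "op_id I J = (if I = J then 1 else 0)"
  by (simp add: tensor_id_def)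

lemma op_mult_assoc: "S \<diamondop> T \<diamondop> U = S \<diamondop> (T \<diamondop> U)"
proof (intro ext)
  fix I J
  have "(S \<diamondop> T \<diamondop> U) I J = (\<Sum>K | length K = length I. \<Sum>M | length M = length I. S I M * T M K * U K J)"
    by (simp add: op_mult_eq sum_distrib_right)
  also have "\<dots> = (\<Sum>M | length M = length I. \<Sum>K | length K = length I. S I M * T M K * U K J)"
    by (rule sum.swap)
  also have "\<dots> = (S \<diamondop> (T \<diamondop> U)) I J"
    by (simp add: op_mult_eq sum_distrib_left mult.assoc)
  finally show "(S \<diamondop> T \<diamondop> U) I J = (S \<diamondop> (T \<diamondop> U)) I J" .
qed

lemma op_id_mult: "op_id \<diamondop> S = S"
  by (intro ext) (simp add: op_mult_eq op_id_eq sum.delta[of _ _ "\<lambda>K. S K _"] if_distrib[of "\<lambda>x. x * _"] cong: if_cong)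

lemma op_mult_id: "length I = length J \<Longrightarrow> (S \<diamondop> op_id) I J = S I J"
  by (simp add: op_mult_eq op_id_eq if_distrib[of "\<lambda>x. _ * x"] cong: if_cong)

subsection \<open>Sums over words\<close>

lemma sum_words_append:
  "(\<Sum>K | length K = n + p. f K) = (\<Sum>U | length U = n. \<Sum>V | length V = p. f (U @ V))"
  for f :: "'n::finite list \<Rightarrow> 'a::comm_monoid_add"
proof -
  have "(\<Sum>K | length K = n + p. f K) = (\<Sum>(U, V) \<in> {U. length U = n} \<times> {V. length V = p}. f (U @ V))"
    by (rule sum.reindex_bij_witness[where i = "\<lambda>(U, V). U @ V" and j = "\<lambda>K. (take n K, drop n K)"]) auto
  then show ?thesis by (simp add: sum.cartesian_product)
qed

lemma sum_words_one: "(\<Sum>K | length K = Suc 0. f K) = (\<Sum>a\<in>UNIV. f [a])"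
  for f :: "'n::finite list \<Rightarrow> 'a::comm_monoid_add"
  by (rule sum.reindex_bij_witness[where i = "\<lambda>a. [a]" and j = hd]) (auto simp: length_Suc_conv)

lemma sum_words_snoc:
  "(\<Sum>K | length K = Suc n. f K) = (\<Sum>U | length U = n. \<Sum>a\<in>UNIV. f (U @ [a]))"
  for f :: "'n::finite list \<Rightarrow> 'a::comm_monoid_add"
  using sum_words_append[of f n 1] by (simp add: sum_words_one)

lemma sum_words_two: "(\<Sum>K | length K = 2. f K) = (\<Sum>a\<in>UNIV. \<Sum>b\<in>UNIV. f [a, b])"
  for f :: "'n::finite list \<Rightarrow> 'a::comm_monoid_add"
  using sum_words_snoc[of f 1] by (simp add: sum_words_one numeral_2_eq_2)

subsection \<open>Operators on neighbouring tensor factors\<close>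

text \<open>The operator \<open>1 \<otimes> S \<otimes> 1\<close> with \<open>p\<close> tensor factors before the \<open>k\<close> factors of \<open>S\<close>.\<close>

definition local_op :: "nat \<Rightarrow> nat \<Rightarrow> ('n, 'a::ring_1) tensor_op \<Rightarrow> ('n, 'a) tensor_op" where
  "local_op p k S = (\<lambda>I J.
     if length I = length J \<and> take p I = take p J \<and> drop (p + k) I = drop (p + k) J
     then S (take k (drop p I)) (take k (drop p J)) else 0)"

lemma local_op_append:
  assumes "length U = p" "length U' = p" "length B = k" "length B' = k"
  shows "local_op p k S (U @ B @ V) (U' @ B' @ V') = (if U = U' \<and> V = V' then S B B' else 0)"
  using assms by (auto simp: local_op_def)

lemma word_split:
  assumes "p + k \<le> length I"
  obtains U B V where "I = U @ B @ V" "length U = p" "length B = k"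
proof
  show "I = take p I @ take k (drop p I) @ drop (p + k) I"
    by (metis append_take_drop_id drop_drop add.commute)
qed (use assms in auto)

text \<open>
  With the word split at the tensor factors concerned, a product with a local operator is a sum over
  the middle part alone.  Together with its mirror image this carries all computations with \<open>R\<^sub>i\<close>.
\<close>

lemma local_op_mult_left:
  assumes "length U = p" "length B = k"
  shows "(local_op p k S \<diamondop> T) (U @ B @ V) J = (\<Sum>B' | length B' = k. S B B' * T (U @ B' @ V) J)"
proof -
  let ?f = "\<lambda>U' B' V'. local_op p k S (U @ B @ V) (U' @ B' @ V') * T (U' @ B' @ V') J"
  have "(local_op p k S \<diamondop> T) (U @ B @ V) J = (\<Sum>K | length K = p + (k + length V). local_op p k S (U @ B @ V) K * T K J)"
    by (simp add: op_mult_eq assms)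
  also have "\<dots> = (\<Sum>U' | length U' = p. \<Sum>B' | length B' = k. \<Sum>V' | length V' = length V. ?f U' B' V')"
    by (simp only: sum_words_append)
  also have "\<dots> = (\<Sum>U' | length U' = p. if U = U' then (\<Sum>B' | length B' = k. S B B' * T (U' @ B' @ V) J) else 0)"
    by (intro sum.cong refl) (auto simp: local_op_append assms if_distrib[of "\<lambda>x. x * _"] cong: if_cong)
  also have "\<dots> = (\<Sum>B' | length B' = k. S B B' * T (U @ B' @ V) J)"
    by (simp add: assms)
  finally show ?thesis .
qed

lemma local_op_mult_right:
  assumes "length U = p" "length B = k" "length I = length (U @ B @ V)"
  shows "(T \<diamondop> local_op p k S) I (U @ B @ V) = (\<Sum>B' | length B' = k. T I (U @ B' @ V) * S B' B)"
proof -
  let ?f = "\<lambda>U' B' V'. T I (U' @ B' @ V') * local_op p k S (U' @ B' @ V') (U @ B @ V)"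
  have "(T \<diamondop> local_op p k S) I (U @ B @ V) = (\<Sum>K | length K = p + (k + length V). T I K * local_op p k S K (U @ B @ V))"
    by (simp add: op_mult_eq assms)
  also have "\<dots> = (\<Sum>U' | length U' = p. \<Sum>B' | length B' = k. \<Sum>V' | length V' = length V. ?f U' B' V')"
    by (simp only: sum_words_append)
  also have "\<dots> = (\<Sum>U' | length U' = p. if U' = U then (\<Sum>B' | length B' = k. T I (U' @ B' @ V) * S B' B) else 0)"
    by (intro sum.cong refl) (auto simp: local_op_append assms if_distrib[of "\<lambda>x. _ * x"] cong: if_cong)
  also have "\<dots> = (\<Sum>B' | length B' = k. T I (U @ B' @ V) * S B' B)"
    by (simp add: assms)
  finally show ?thesis .
qed

lemma length_mismatch_mult:
  assumes "\<And>I J. length I \<noteq> length J \<Longrightarrow> T I J = 0" "length I \<noteq> length J"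
  shows "(S \<diamondop> T) I J = 0"
  using assms by (auto simp: op_mult_eq intro!: sum.neutral)

lemma local_op_length: "length I \<noteq> length J \<Longrightarrow> local_op p k S I J = 0"
  by (simp add: local_op_def)

lemma local_op_mult:
  assumes "p + k \<le> length I"
  shows "(local_op p k S \<diamondop> local_op p k T) I J = local_op p k (S \<diamondop> T) I J"
proof (cases "length I = length J")
  case True
  obtain U B V where I: "I = U @ B @ V" "length U = p" "length B = k"
    using assms by (rule word_split)
  obtain U' B' V' where J: "J = U' @ B' @ V'" "length U' = p" "length B' = k"
    using assms True by (metis word_split)
  show ?thesis unfolding I(1) J(1) using I(2,3) J(2,3)
    by (simp add: local_op_mult_left local_op_append op_mult_eq[of S T])
      (auto simp: if_distrib[of "\<lambda>x. _ * x"] cong: if_cong)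
qed (simp add: length_mismatch_mult local_op_length)

lemma local_op_commute:
  assumes "p + k \<le> p'" "p' + k' \<le> length I"
    and comm: "\<And>B B' Y Y'. S B B' * T Y Y' = T Y Y' * S B B'"
  shows "(local_op p k S \<diamondop> local_op p' k' T) I J = (local_op p' k' T \<diamondop> local_op p k S) I J"
proof (cases "length I = length J")
  case True
  define l where "l = p' - (p + k)"
  have split: "\<exists>U B W Y V. K = U @ B @ W @ Y @ V \<and> length U = p \<and> length B = k \<and> length W = l \<and> length Y = k'"
    if len: "length K = length I" for K
  proof -
    obtain U B Z where 1: "K = U @ B @ Z" "length U = p" "length B = k"
      by (rule word_split[of p k K]) (use len assms in auto)
    moreover obtain W Y V where "Z = W @ Y @ V" "length W = l" "length Y = k'"
      by (rule word_split[of l k' Z]) (use len assms 1 l_def in auto)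
    ultimately show ?thesis by metis
  qed
  obtain U B W Y V where I: "I = U @ B @ W @ Y @ V" "length U = p" "length B = k" "length W = l" "length Y = k'"
    using split[of I] by auto
  obtain U' B' W' Y' V' where J: "J = U' @ B' @ W' @ Y' @ V'" "length U' = p" "length B' = k" "length W' = l" "length Y' = k'"
    using split[of J] True by auto
  have p': "p' = length (U @ B @ W)" using I l_def assms by simp
  have loc: "local_op p' k' T (U @ B1 @ W @ Y @ V) (U' @ B' @ W' @ Y' @ V')
      = (if U = U' \<and> B1 = B' \<and> W = W' \<and> V = V' then T Y Y' else 0)" if "length B1 = k" for B1
    using local_op_append[of "U @ B1 @ W" p' "U' @ B' @ W'" Y k' Y' T V V'] I J p' that by auto
  have "(local_op p k S \<diamondop> local_op p' k' T) I J
      = (\<Sum>B1 | length B1 = k. S B B1 * local_op p' k' T (U @ B1 @ W @ Y @ V) (U' @ B' @ W' @ Y' @ V'))"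
    unfolding I(1) J(1) using I by (intro local_op_mult_left) auto
  also have "\<dots> = (\<Sum>B1 | length B1 = k. if B1 = B' then (if U = U' \<and> W = W' \<and> V = V' then S B B' * T Y Y' else 0) else 0)"
    by (intro sum.cong refl) (auto simp: loc)
  also have "\<dots> = (if U = U' \<and> W = W' \<and> V = V' then S B B' * T Y Y' else 0)"
    using J by simp
  finally have 1: "(local_op p k S \<diamondop> local_op p' k' T) I J = \<dots>" .
  have "(local_op p' k' T \<diamondop> local_op p k S) I J
      = (\<Sum>Y1 | length Y1 = k'. T Y Y1 * local_op p k S (U @ B @ W @ Y1 @ V) (U' @ B' @ W' @ Y' @ V'))"
    unfolding I(1) J(1) using I p' local_op_mult_left[of "U @ B @ W" p' Y k' T "local_op p k S" V] by simp
  also have "\<dots> = (\<Sum>Y1 | length Y1 = k'. if Y1 = Y' then (if U = U' \<and> W = W' \<and> V = V' then T Y Y' * S B B' else 0) else 0)"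
    using I J by (intro sum.cong refl) (auto simp: local_op_append)
  also have "\<dots> = (if U = U' \<and> W = W' \<and> V = V' then T Y Y' * S B B' else 0)"
    using J by simp
  finally show ?thesis using 1 comm by simp
qed (simp add: length_mismatch_mult local_op_length)

lemma at_pos2_local:
  assumes "1 \<le> j" "Suc j \<le> k" "p + k \<le> length I"
  shows "at_pos2 type_ring (p + j) M I J = local_op p k (at_pos2 type_ring j M) I J"
proof (cases "length I = length J")
  case True
  obtain U B V where I: "I = U @ B @ V" "length U = p" "length B = k"
    using assms(3) by (rule word_split)
  obtain U' B' V' where J: "J = U' @ B' @ V'" "length U' = p" "length B' = k"
    using assms(3) True by (metis word_split)
  have "j - 1 < k" "j < k" "p + j - 1 = p + (j - 1)" "p + j + 1 = p + (j + 1)" using assms by auto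
  then show ?thesis
    using I(2,3) J(2,3) assms(1,2) True unfolding I(1) J(1) local_op_append[OF I(2) J(2) I(3) J(3)]
    by (auto simp: at_pos2_def nth_append)
qed (simp add: at_pos2_def local_op_def)

lemma at_pos_local:
  assumes "1 \<le> j" "j \<le> k" "p + k \<le> length I"
  shows "at_pos type_ring (p + j) M I J = local_op p k (at_pos type_ring j M) I J"
proof (cases "length I = length J")
  case True
  obtain U B V where I: "I = U @ B @ V" "length U = p" "length B = k"
    using assms(3) by (rule word_split)
  obtain U' B' V' where J: "J = U' @ B' @ V'" "length U' = p" "length B' = k"
    using assms(3) True by (metis word_split)
  have "j - 1 < k" "p + j - 1 = p + (j - 1)" using assms by auto
  then show ?thesis
    using I(2,3) J(2,3) assms(1,2) True unfolding I(1) J(1) local_op_append[OF I(2) J(2) I(3) J(3)]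
    by (auto simp: at_pos_def nth_append)
qed (simp add: at_pos_def local_op_def)

text \<open>
  Used to exchange operators that agree in the degree at hand, such as \<open>R\<^sub>i\<close> and its local form, which
  differ in degrees that are too small.
\<close>

lemma op_mult_cong:
  assumes "\<And>K. length K = length I \<Longrightarrow> S I K = S' I K"
    and "\<And>K. length K = length I \<Longrightarrow> T K J = T' K J"
  shows "(S \<diamondop> T) I J = (S' \<diamondop> T') I J"
  using assms by (simp add: op_mult_eq)

lemma at_pos2_one_entries:
  "length B = 2 \<Longrightarrow> length B' = 2 \<Longrightarrow> at_pos2 type_ring (Suc 0) M B B' = M $ (B ! 0, B ! 1) $ (B' ! 0, B' ! 1)"
  by (simp add: at_pos2_def)

lemma at_pos2_mult:
  assumes "1 \<le> i" "i < length I"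
  shows "(at_pos2 type_ring i M \<diamondop> at_pos2 type_ring i N) I J = at_pos2 type_ring i (M ** N) I J"
proof -
  have *: "at_pos2 type_ring i M I' J' = local_op (i - 1) 2 (at_pos2 type_ring 1 M) I' J'"
    if "length I' = length I" for I' J' and M :: "'b^('a \<times> 'a)^('a \<times> 'a)"
    using at_pos2_local[of 1 2 "i - 1" I' M J'] assms that by (simp add: numeral_2_eq_2)
  have "(at_pos2 type_ring i M \<diamondop> at_pos2 type_ring i N) I J
      = (local_op (i - 1) 2 (at_pos2 type_ring 1 M) \<diamondop> local_op (i - 1) 2 (at_pos2 type_ring 1 N)) I J"
    by (rule op_mult_cong) (auto simp: *)
  also have "\<dots> = local_op (i - 1) 2 (at_pos2 type_ring 1 M \<diamondop> at_pos2 type_ring 1 N) I J"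
    using assms by (intro local_op_mult) simp
  also have "\<dots> = local_op (i - 1) 2 (at_pos2 type_ring 1 (M ** N)) I J"
  proof -
    have "(at_pos2 type_ring 1 M \<diamondop> at_pos2 type_ring 1 N) B B' = at_pos2 type_ring 1 (M ** N) B B'"
      if "length B = 2" "length B' = 2" for B B'
      using that
      by (simp add: op_mult_eq sum_words_two at_pos2_one_entries matrix_matrix_mult_def UNIV_Times_UNIV[symmetric] sum.cartesian_product
           del: UNIV_Times_UNIV)
    then show ?thesis using assms by (auto simp: local_op_def)
  qed
  finally show ?thesis by (simp add: *)
qed

lemma at_pos2_scalar:
  assumes "1 \<le> i" "i < length I"
  shows "at_pos2 type_ring i (mat c) I J = (if I = J then c else 0)"
proof (cases "length I = length J")
  case True
  have len: "i - 1 + 2 \<le> length I" using assms by simp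
  obtain U B V where I: "I = U @ B @ V" "length U = i - 1" "length B = 2"
    using len by (rule word_split)
  obtain U' B' V' where J: "J = U' @ B' @ V'" "length U' = i - 1" "length B' = 2"
    using len[unfolded True] by (rule word_split)
  have "at_pos2 type_ring i (mat c) I J = local_op (i - 1) 2 (at_pos2 type_ring 1 (mat c)) I J"
    using at_pos2_local[of 1 2 "i - 1" I "mat c" J] assms by (simp add: numeral_2_eq_2)
  also have "\<dots> = (if I = J then c else 0)"
    unfolding I(1) J(1) local_op_append[OF I(2) J(2) I(3) J(3)]
    using I(2,3) J(2,3) by (auto simp: at_pos2_one_entries mat_def length_Suc_conv numeral_2_eq_2)
  finally show ?thesis .
qed (auto simp: at_pos2_def)

lemma at_pos2_far:
  assumes "1 \<le> i" "i + 2 \<le> j" "j < length I" "\<And>a b c d. M $ a $ b * N $ c $ d = N $ c $ d * M $ a $ b"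
  shows "(at_pos2 type_ring i M \<diamondop> at_pos2 type_ring j N) I J = (at_pos2 type_ring j N \<diamondop> at_pos2 type_ring i M) I J"
proof -
  have *: "at_pos2 type_ring i M I' J' = local_op (i - 1) 2 (at_pos2 type_ring 1 M) I' J'"
    if "length I' = length I" "1 \<le> i" "i < length I" for I' J' i and M :: "'b^('a \<times> 'a)^('a \<times> 'a)"
    using at_pos2_local[of 1 2 "i - 1" I' M J'] that by (simp add: numeral_2_eq_2)
  have "(at_pos2 type_ring i M \<diamondop> at_pos2 type_ring j N) I J
      = (local_op (i - 1) 2 (at_pos2 type_ring 1 M) \<diamondop> local_op (j - 1) 2 (at_pos2 type_ring 1 N)) I J"
    using assms by (intro op_mult_cong) (auto simp: *)
  also have "\<dots> = (local_op (j - 1) 2 (at_pos2 type_ring 1 N) \<diamondop> local_op (i - 1) 2 (at_pos2 type_ring 1 M)) I J"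
    using assms by (intro local_op_commute) (auto simp: at_pos2_def)
  also have "\<dots> = (at_pos2 type_ring j N \<diamondop> at_pos2 type_ring i M) I J"
    using assms by (intro op_mult_cong) (auto simp: *)
  finally show ?thesis .
qed

lemma at_pos_first_commute:
  assumes "2 \<le> j" "j < length I" "\<And>a b c d. M $ a $ b * N $ c $ d = N $ c $ d * M $ a $ b"
  shows "(at_pos type_ring 1 M \<diamondop> at_pos2 type_ring j N) I J = (at_pos2 type_ring j N \<diamondop> at_pos type_ring 1 M) I J"
proof -
  have *: "at_pos2 type_ring j N I' J' = local_op (j - 1) 2 (at_pos2 type_ring 1 N) I' J'"
    if "length I' = length I" for I' J'
    using at_pos2_local[of 1 2 "j - 1" I' N J'] that assms by (simp add: numeral_2_eq_2)
  have **: "at_pos type_ring 1 M I' J' = local_op 0 1 (at_pos type_ring 1 M) I' J'"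
    if "length I' = length I" for I' J'
    using at_pos_local[of 1 1 0 I' M J'] that assms by simp
  have "(at_pos type_ring 1 M \<diamondop> at_pos2 type_ring j N) I J
      = (local_op 0 1 (at_pos type_ring 1 M) \<diamondop> local_op (j - 1) 2 (at_pos2 type_ring 1 N)) I J"
    using assms by (intro op_mult_cong) (simp_all add: * ** del: One_nat_def)
  also have "\<dots> = (local_op (j - 1) 2 (at_pos2 type_ring 1 N) \<diamondop> local_op 0 1 (at_pos type_ring 1 M)) I J"
    using assms by (intro local_op_commute) (auto simp: at_pos2_def at_pos_def)
  also have "\<dots> = (at_pos2 type_ring j N \<diamondop> at_pos type_ring 1 M) I J"
    using assms by (intro op_mult_cong) (simp_all add: * ** del: One_nat_def)
  finally show ?thesis .
qed

text \<open>
  Both \<open>R\<^sub>i\<close> and \<open>R\<^bsub>i+1\<^esub>\<close> are operators of degree 3 applied to three neighbouring tensor factors, so the relation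
  is inherited from degree 3.
\<close>

lemma at_pos2_braid:
  fixes R :: "('k::field, 'n::finite) braid_matrix"
  assumes "braiding R" "1 \<le> i" "Suc i < length I"
  shows "(at_pos2 type_ring i R \<diamondop> at_pos2 type_ring (Suc i) R \<diamondop> at_pos2 type_ring i R) I J
    = (at_pos2 type_ring (Suc i) R \<diamondop> at_pos2 type_ring i R \<diamondop> at_pos2 type_ring (Suc i) R) I J"
proof -
  let ?l = "\<lambda>j. local_op (i - 1) 3 (at_pos2 type_ring j R)"
  have *: "at_pos2 type_ring i R I' J' = ?l 1 I' J'" "at_pos2 type_ring (Suc i) R I' J' = ?l 2 I' J'"
    if "length I' = length I" for I' J'
    using at_pos2_local[of 1 3 "i - 1" I' R J'] at_pos2_local[of 2 3 "i - 1" I' R J'] that assms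
    by simp_all
  have triple: "(?l a \<diamondop> ?l b \<diamondop> ?l c) I J = local_op (i - 1) 3 (at_pos2 type_ring a R \<diamondop> at_pos2 type_ring b R \<diamondop> at_pos2 type_ring c R) I J" for a b c
  proof -
    have "(?l a \<diamondop> ?l b \<diamondop> ?l c) I J = (local_op (i - 1) 3 (at_pos2 type_ring a R \<diamondop> at_pos2 type_ring b R) \<diamondop> ?l c) I J"
      using assms by (intro op_mult_cong local_op_mult) auto
    also have "\<dots> = local_op (i - 1) 3 (at_pos2 type_ring a R \<diamondop> at_pos2 type_ring b R \<diamondop> at_pos2 type_ring c R) I J"
      using assms by (intro local_op_mult) auto
    finally show ?thesis .
  qed
  have "(at_pos2 type_ring i R \<diamondop> at_pos2 type_ring (Suc i) R \<diamondop> at_pos2 type_ring i R) I J = (?l 1 \<diamondop> ?l 2 \<diamondop> ?l 1) I J"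
    by (intro op_mult_cong) (simp_all only: *)
  also have "\<dots> = (?l 2 \<diamondop> ?l 1 \<diamondop> ?l 2) I J"
    unfolding triple using assms by (auto simp: local_op_def braiding_def Let_def)
  also have "\<dots> = (at_pos2 type_ring (Suc i) R \<diamondop> at_pos2 type_ring i R \<diamondop> at_pos2 type_ring (Suc i) R) I J"
    by (intro op_mult_cong) (simp_all only: *)
  finally show ?thesis .
qed

section \<open>The ring of graded operators\<close>

text \<open>
  The operators that preserve the tensor degree form a ring, to which the results on representations
  of the Hecke algebra apply.
\<close>

typedef (overloaded) ('n, 'a::zero) block_op =
  "{S :: ('n, 'a) tensor_op. \<forall>I J. length I \<noteq> length J \<longrightarrow> S I J = 0}"
  morphisms entry Block
  by (rule exI[of _ "\<lambda>_ _. 0"]) simp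

lemma op_id_length: "length I \<noteq> length J \<Longrightarrow> op_id I J = 0"
  by (auto simp: op_id_eq)

setup_lifting type_definition_block_op

instantiation block_op :: (finite, ring_1) ring_1
begin

lift_definition zero_block_op :: "('a, 'b) block_op" is "\<lambda>_ _. 0" by simp
lift_definition one_block_op :: "('a, 'b) block_op" is "op_id" by (auto simp: op_id_eq)
lift_definition plus_block_op :: "('a, 'b) block_op \<Rightarrow> ('a, 'b) block_op \<Rightarrow> ('a, 'b) block_op"
  is "\<lambda>S T I J. S I J + T I J" by simp
lift_definition minus_block_op :: "('a, 'b) block_op \<Rightarrow> ('a, 'b) block_op \<Rightarrow> ('a, 'b) block_op"
  is "\<lambda>S T I J. S I J - T I J" by simp
lift_definition uminus_block_op :: "('a, 'b) block_op \<Rightarrow> ('a, 'b) block_op"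
  is "\<lambda>S I J. - S I J" by simp
lift_definition times_block_op :: "('a, 'b) block_op \<Rightarrow> ('a, 'b) block_op \<Rightarrow> ('a, 'b) block_op"
  is "\<lambda>S T. S \<diamondop> T" by (simp add: length_mismatch_mult)

instance
proof
  fix a b c :: "('a, 'b) block_op"
  show "a * b * c = a * (b * c)" by transfer (rule op_mult_assoc)
  show "1 * a = a" by transfer (rule op_id_mult)
  show "a * 1 = a"
  proof transfer
    fix a :: "('a, 'b) tensor_op"
    assume a: "\<forall>I J. length I \<noteq> length J \<longrightarrow> a I J = 0"
    show "a \<diamondop> op_id = a"
    proof (intro ext)
      fix I J
      show "(a \<diamondop> op_id) I J = a I J"
        using a op_mult_id[of I J a] length_mismatch_mult[of op_id I J a, OF op_id_length]
        by (cases "length I = length J") auto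
    qed
  qed
  show "(a + b) * c = a * c + b * c"
    by transfer (simp add: op_mult_eq distrib_right sum.distrib fun_eq_iff)
  show "a * (b + c) = a * b + a * c"
    by transfer (simp add: op_mult_eq distrib_left sum.distrib fun_eq_iff)
  show "(0 :: ('a, 'b) block_op) \<noteq> 1"
    by transfer (auto simp: fun_eq_iff op_id_eq)
qed (transfer; simp add: fun_eq_iff algebra_simps)+

end

lift_definition left_scale :: "'a \<Rightarrow> ('n, 'a::ring_1) block_op \<Rightarrow> ('n, 'a) block_op"
  is "\<lambda>c S I J. c * S I J" by simp

text \<open>
  A single degree \<open>n\<close> is cut out by letting the operator be a scalar \<open>c\<close> in all other degrees.
  This is multiplicative in the pair \<open>(c, S)\<close>, so relations that hold in degree \<open>n\<close> and for the
  scalars hold in the ring.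
\<close>

lift_definition block :: "nat \<Rightarrow> 'a \<Rightarrow> ('n, 'a::ring_1) tensor_op \<Rightarrow> ('n, 'a) block_op"
  is "\<lambda>n c S I J. if length I = n \<and> length J = n then S I J else if I = J then c else 0"
  by auto

lemma entry_block: "length I = n \<Longrightarrow> length J = n \<Longrightarrow> entry (block n c S) I J = S I J"
  by transfer simp

lemma block_cong:
  assumes "\<And>I J. length I = n \<Longrightarrow> length J = n \<Longrightarrow> S I J = T I J" "c = d"
  shows "block n c S = block n d T"
  using assms by transfer (auto simp: fun_eq_iff)

lemma block_mult: "block n c S * block n d T = block n (c * d) (S \<diamondop> T)"
proof (transfer, intro ext)
  fix n :: nat and c d :: 'b and S T :: "('a, 'b) tensor_op" and I J :: "'a list"
  let ?S = "\<lambda>I J. if length I = n \<and> length J = n then S I J else if I = J then c else 0"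
  let ?T = "\<lambda>I J. if length I = n \<and> length J = n then T I J else if I = J then d else 0"
  show "(?S \<diamondop> ?T) I J = (if length I = n \<and> length J = n then (S \<diamondop> T) I J else if I = J then c * d else 0)"
  proof (cases "length I = n")
    case True
    then show ?thesis by (auto simp: op_mult_eq intro!: sum.neutral)
  next
    case False
    then have "(?S \<diamondop> ?T) I J = (\<Sum>K | length K = length I. if K = I then c * ?T I J else 0)"
      unfolding op_mult_eq by (intro sum.cong refl) auto
    with False show ?thesis by simp
  qed
qed

lemma block_add: "block n c S + block n d T = block n (c + d) (\<lambda>I J. S I J + T I J)"
  by transfer (auto simp: fun_eq_iff)

lemma block_diff: "block n c S - block n d T = block n (c - d) (\<lambda>I J. S I J - T I J)"
  by transfer (auto simp: fun_eq_iff)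

lemma block_one: "block n 1 op_id = 1"
  by transfer (auto simp: fun_eq_iff op_id_eq)

lemma block_zero: "block n 0 (\<lambda>_ _. 0) = 0"
  by transfer (auto simp: fun_eq_iff)

lemma left_scale_block: "left_scale a (block n c S) = block n (a * c) (\<lambda>I J. a * S I J)"
  by transfer (auto simp: fun_eq_iff)

lemma upto_prod_block:
  "upto_prod (\<lambda>i. block n (c i) (S i)) k = block n (upto_prod c k) (tensor_prod type_ring S k)"
  by (induction k) (simp_all add: block_one block_mult)

section \<open>Extension of scalars\<close>

text \<open>The structure map of an algebra over a field.\<close>

locale central_hom =
  fixes \<iota> :: "'k::field \<Rightarrow> 'a::ring_1"
  assumes hom_one: "\<iota> 1 = 1"
    and hom_add: "\<iota> (a + b) = \<iota> a + \<iota> b"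
    and hom_mult: "\<iota> (a * b) = \<iota> a * \<iota> b"
    and hom_central: "\<iota> a * x = x * \<iota> a"
begin

lemma hom_zero: "\<iota> 0 = 0"
  using hom_add[of 0 0] by simp

lemma hom_minus: "\<iota> (- a) = - \<iota> a"
  using hom_add[of a "- a"] by (simp add: hom_zero eq_neg_iff_add_eq_0 add.commute)

lemma hom_diff: "\<iota> (a - b) = \<iota> a - \<iota> b"
  using hom_add[of a "- b"] by (simp add: hom_minus)

lemma hom_sum: "\<iota> (sum f I) = (\<Sum>i\<in>I. \<iota> (f i))"
  by (induction I rule: infinite_finite_induct) (simp_all add: hom_add hom_zero)

definition map_op :: "('n, 'k) tensor_op \<Rightarrow> ('n, 'a) tensor_op" where
  "map_op S = (\<lambda>I J. \<iota> (S I J))"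

lemma map_op_mult: "map_op (S \<diamondop> T) = map_op S \<diamondop> map_op T"
  by (intro ext) (simp add: map_op_def op_mult_eq hom_sum hom_mult)

lemma map_op_id: "map_op op_id = op_id"
  by (intro ext) (simp add: map_op_def op_id_eq hom_one hom_zero)

lemma map_op_at_pos2: "at_pos2 type_ring i (map_matrix \<iota> M) = map_op (at_pos2 type_ring i M)"
  by (intro ext) (simp add: map_op_def at_pos2_def map_matrix_def hom_zero)

lemma map_op_at_pos: "at_pos type_ring i (map_matrix \<iota> M) = map_op (at_pos type_ring i M)"
  by (intro ext) (simp add: map_op_def at_pos_def map_matrix_def hom_zero)

lemma map_op_tensor_prod:
  "tensor_prod type_ring (\<lambda>i. map_op (S i)) k = map_op (tensor_prod type_ring S k)"
  by (induction k) (simp_all add: map_op_id map_op_mult)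

end

section \<open>The Hecke algebra acting on a tensor power\<close>

text \<open>The Hecke relation says \<open>R (R - (q - 1/q) I) = I\<close>.\<close>

lemma hecke_symmetry_inverse:
  fixes R :: "('k::field, 'n::finite) braid_matrix"
  assumes "hecke_symmetry q R"
  shows "R ** matrix_inv R = mat 1" "matrix_inv R ** R = mat 1"
proof -
  have q: "q \<noteq> 0" and H: "(mat q - R) ** (mat (inverse q) + R) = 0"
    using assms by (auto simp: hecke_symmetry_def)
  have mat: "mat c ** M = (\<chi> i j. c * M $ i $ j)" "M ** mat c = (\<chi> i j. c * M $ i $ j)"
    for c and M :: "('k, 'n) braid_matrix"
    by (simp_all add: vec_eq_iff matrix_matrix_mult_def mat_def if_distrib[of "\<lambda>x. x * _"]
        if_distrib[of "\<lambda>x. _ * x"] mult.commute cong: if_cong)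
  have "R ** (R - mat (q - inverse q)) = mat 1"
  proof -
    have "(mat q - R) ** (mat (inverse q) + R)
        = mat q ** mat (inverse q) + mat q ** R - R ** mat (inverse q) - R ** R"
      by (simp add: vec_eq_iff matrix_matrix_mult_def sum.distrib[symmetric] sum_subtractf[symmetric] algebra_simps)
    then have *: "(R ** R) $ i $ j = (mat q ** mat (inverse q) + mat q ** R - R ** mat (inverse q)) $ i $ j" for i j
      by (simp add: H)
    have "R ** (R - mat (q - inverse q)) = R ** R - R ** mat (q - inverse q)"
      by (simp add: vec_eq_iff matrix_matrix_mult_def right_diff_distrib sum_subtractf)
    moreover have "(mat q ** mat (inverse q) :: ('k, 'n) braid_matrix) = mat 1"
      unfolding mat using q by (simp add: mat_def vec_eq_iff)
    ultimately show ?thesis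
      by (simp add: vec_eq_iff *) (simp add: mat left_diff_distrib)
  qed
  then have "\<exists>S. R ** S = mat 1 \<and> S ** R = mat 1"
    using matrix_left_right_inverse by blast
  then show "R ** matrix_inv R = mat 1" "matrix_inv R ** R = mat 1"
    unfolding matrix_inv_def by (metis (mono_tags, lifting) someI_ex)+
qed

locale hecke_operators = central_hom \<iota>
  for \<iota> :: "'k::field \<Rightarrow> 'a::ring_1" +
  fixes q :: 'k and R :: "('k, 'n::finite) braid_matrix"
  assumes symmetry: "hecke_symmetry q R" and generic: "generic q"
begin

text \<open>
  In the degrees other than \<open>n\<close> the generators act by the sign character \<open>- inverse q\<close>, which satisfies
  the Hecke relation; on this character the skew-symmetrizers are \<open>1\<close>.
\<close>

definition gen :: "nat \<Rightarrow> nat \<Rightarrow> ('n, 'a) block_op" where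
  "gen n i = block n (\<iota> (- inverse q)) (at_pos2 type_ring i (map_matrix \<iota> R))"

definition gen_inv :: "nat \<Rightarrow> nat \<Rightarrow> ('n, 'a) block_op" where
  "gen_inv n i = block n (\<iota> (- q)) (at_pos2 type_ring i (map_matrix \<iota> (matrix_inv R)))"

lemma q_nonzero: "q \<noteq> 0"
  using generic by (simp add: generic_def)

lemma hecke_operator:
  assumes "1 \<le> i" "i < n"
  shows "(left_scale (\<iota> q) 1 - gen n i) * (left_scale (\<iota> (inverse q)) 1 + gen n i) = 0"
proof -
  have scal: "left_scale (\<iota> c) 1 = block n (\<iota> c) (map_op (at_pos2 type_ring i (mat c)))" for c
  proof -
    have "left_scale (\<iota> c) 1 = block n (\<iota> c) (\<lambda>I J. \<iota> c * op_id I J)"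
      by (simp only: block_one[of n, symmetric] left_scale_block mult_1_right)
    also have "\<dots> = block n (\<iota> c) (map_op (at_pos2 type_ring i (mat c)))"
      using assms by (intro block_cong) (auto simp: map_op_def at_pos2_scalar op_id_eq hom_zero)
    finally show ?thesis .
  qed
  let ?P = "\<lambda>M. map_op (at_pos2 type_ring i M)"
  have 1: "left_scale (\<iota> q) 1 - gen n i = block n (\<iota> (q + inverse q)) (?P (mat q - R))"
    unfolding scal gen_def map_op_at_pos2 block_diff
    by (intro block_cong) (auto simp: map_op_def at_pos2_def hom_diff hom_add hom_minus hom_zero)
  have 2: "left_scale (\<iota> (inverse q)) 1 + gen n i = block n 0 (?P (mat (inverse q) + R))"
    unfolding scal gen_def map_op_at_pos2 block_add
    by (intro block_cong) (auto simp: map_op_def at_pos2_def hom_diff hom_add hom_minus hom_zero)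
  have "block n 0 (?P (mat q - R) \<diamondop> ?P (mat (inverse q) + R)) = block n 0 (\<lambda>_ _. 0)"
  proof (rule block_cong)
    fix I J :: "'n list"
    assume "length I = n" "length J = n"
    then have "(at_pos2 type_ring i (mat q - R) \<diamondop> at_pos2 type_ring i (mat (inverse q) + R)) I J = 0"
      using symmetry assms by (subst at_pos2_mult) (auto simp: hecke_symmetry_def at_pos2_def)
    then show "(?P (mat q - R) \<diamondop> ?P (mat (inverse q) + R)) I J = 0"
      by (simp add: map_op_mult[symmetric]) (simp add: map_op_def hom_zero)
  qed simp
  then show ?thesis by (simp add: 1 2 block_mult block_zero)
qed

lemma gen_braid:
  assumes "1 \<le> i" "Suc i < n"
  shows "gen n i * gen n (Suc i) * gen n i = gen n (Suc i) * gen n i * gen n (Suc i)"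
  unfolding gen_def block_mult map_op_at_pos2 map_op_mult[symmetric]
  using assms symmetry at_pos2_braid[of R i]
  by (intro block_cong) (auto simp: map_op_def hecke_symmetry_def)

lemma gen_far:
  assumes "1 \<le> i" "i + 2 \<le> j" "j < n"
  shows "gen n i * gen n j = gen n j * gen n i"
  unfolding gen_def block_mult map_op_at_pos2 map_op_mult[symmetric]
  using assms at_pos2_far[of i j _ R R]
  by (intro block_cong) (auto simp: map_op_def mult.commute)

lemma gen_inverse:
  assumes "1 \<le> i" "i < n"
  shows "gen n i * gen_inv n i = 1" "gen_inv n i * gen n i = 1"
proof -
  have c: "\<iota> (- inverse q) * \<iota> (- q) = 1" "\<iota> (- q) * \<iota> (- inverse q) = 1"
    using q_nonzero by (simp_all add: hom_mult[symmetric] hom_one)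
  have "gen n i * gen_inv n i = block n 1 op_id"
    unfolding gen_def gen_inv_def block_mult map_op_at_pos2 map_op_mult[symmetric] c
    using assms by (intro block_cong)
      (auto simp: map_op_def at_pos2_mult hecke_symmetry_inverse[OF symmetry] at_pos2_scalar op_id_eq hom_one hom_zero)
  then show "gen n i * gen_inv n i = 1" by (simp add: block_one)
  have "gen_inv n i * gen n i = block n 1 op_id"
    unfolding gen_def gen_inv_def block_mult map_op_at_pos2 map_op_mult[symmetric] c
    using assms by (intro block_cong)
      (auto simp: map_op_def at_pos2_mult hecke_symmetry_inverse[OF symmetry] at_pos2_scalar op_id_eq hom_one hom_zero)
  then show "gen_inv n i * gen n i = 1" by (simp add: block_one)
qed

lemma hecke_algebra_block: "hecke_algebra (\<lambda>c. left_scale (\<iota> c)) q (gen n) (gen_inv n) n"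
proof
  show "left_scale (\<iota> 1) x = x" for x :: "('n, 'a) block_op"
    unfolding hom_one by transfer simp
  show "left_scale (\<iota> a) (left_scale (\<iota> b) x) = left_scale (\<iota> (a * b)) x" for a b and x :: "('n, 'a) block_op"
    unfolding hom_mult by transfer (simp add: mult.assoc)
  show "left_scale (\<iota> (a + b)) x = left_scale (\<iota> a) x + left_scale (\<iota> b) x" for a b and x :: "('n, 'a) block_op"
    unfolding hom_add by transfer (simp add: distrib_right)
  show "left_scale (\<iota> a) (x + y) = left_scale (\<iota> a) x + left_scale (\<iota> a) y" for a and x y :: "('n, 'a) block_op"
    by transfer (simp add: distrib_left)
  show "left_scale (\<iota> a) x * y = left_scale (\<iota> a) (x * y)" for a and x y :: "('n, 'a) block_op"
    by transfer (simp add: op_mult_eq sum_distrib_left mult.assoc fun_eq_iff)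
  show "x * left_scale (\<iota> a) y = left_scale (\<iota> a) (x * y)" for a and x y :: "('n, 'a) block_op"
  proof -
    have *: "u * (\<iota> a * v) = \<iota> a * (u * v)" for u v by (metis hom_central mult.assoc)
    show ?thesis by (rule entry_inject[THEN iffD1])
        (simp add: left_scale.rep_eq times_block_op.rep_eq op_mult_eq sum_distrib_left * fun_eq_iff)
  qed
qed (use generic hecke_operator gen_braid gen_far gen_inverse in auto)

sublocale hecke: hecke_algebra "\<lambda>c. left_scale (\<iota> c)" q "gen n" "gen_inv n" n for n
  by (rule hecke_algebra_block)

text \<open>
  The recursion in the ring of graded operators is the recursion of the skew-symmetrizers in degree
  \<open>n\<close>; the scalar of the other degrees stays \<open>1\<close> by the recursion for the quantum integers.
\<close>

lemma skew_block:
  assumes "k \<le> n"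
  shows "hecke.skew n k = block n 1 (skew_symmetrizer_over \<iota> q R k)"
  using assms
proof (induction k rule: induct_nat_012)
  case (ge2 k)
  let ?N = "q_number q (Suc (Suc k))" and ?M = "q_number q (Suc k)"
  let ?P = "skew_symmetrizer_over \<iota> q R (Suc k)"
  let ?A = "\<lambda>I J. \<iota> (q ^ Suc k) * op_id I J - \<iota> ?M * at_pos2 type_ring (Suc k) (map_matrix \<iota> R) I J"
  have "left_scale (\<iota> (q ^ Suc k)) 1 - left_scale (\<iota> ?M) (gen n (Suc k))
      = block n (\<iota> (q ^ Suc k) * 1 - \<iota> ?M * \<iota> (- inverse q)) ?A"
    unfolding gen_def by (subst block_one[of n, symmetric]) (simp only: left_scale_block block_diff)
  also have "\<iota> (q ^ Suc k) * 1 - \<iota> ?M * \<iota> (- inverse q) = \<iota> ?N"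
    by (simp only: hom_mult[symmetric] hom_diff[symmetric] mult_1_right)
      (simp add: q_number_Suc(1)[OF generic, of "Suc k"] mult.commute)
  finally have A: "left_scale (\<iota> (q ^ Suc k)) 1 - left_scale (\<iota> ?M) (gen n (Suc k)) = block n (\<iota> ?N) ?A" .
  have "hecke.skew n (Suc (Suc k)) = left_scale (\<iota> (1 / ?N)) (block n 1 ?P * block n (\<iota> ?N) ?A * block n 1 ?P)"
    using ge2 by (simp add: A del: power_Suc)
  also have "\<dots> = block n (\<iota> (1 / ?N) * \<iota> ?N) (\<lambda>I J. \<iota> (1 / ?N) * (?P \<diamondop> ?A \<diamondop> ?P) I J)"
    by (simp add: block_mult left_scale_block)
  also have "\<dots> = block n 1 (skew_symmetrizer_over \<iota> q R (Suc (Suc k)))"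
  proof (rule block_cong)
    show "\<iota> (1 / ?N) * \<iota> ?N = 1"
      using q_number_nonzero[OF generic, of "Suc (Suc k)"] by (simp add: hom_mult[symmetric] hom_one)
    let ?Q = "skew_symmetrizer q R (Suc k)"
    let ?B = "\<lambda>I J. q ^ Suc k * op_id I J - ?M * at_pos2 type_ring (Suc k) R I J"
    have P: "?P = map_op ?Q" by (simp add: skew_symmetrizer_over_def map_op_def)
    have B: "?A = map_op ?B"
      by (intro ext) (simp add: map_op_at_pos2 map_op_def hom_diff hom_mult op_id_eq hom_one hom_zero)
    show "\<iota> (1 / ?N) * (?P \<diamondop> ?A \<diamondop> ?P) I J = skew_symmetrizer_over \<iota> q R (Suc (Suc k)) I J" for I J
      unfolding P B map_op_mult[symmetric]
      by (simp add: skew_symmetrizer_over_def Let_def map_op_def hom_mult[symmetric])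
  qed
  finally show ?case .
qed (simp_all add: skew_symmetrizer_over_def block_one map_op_id[unfolded map_op_def])

end

section \<open>The copies of a matrix over an algebra\<close>

locale matrix_over_algebra = hecke_operators \<iota> q R
  for \<iota> :: "'k::field \<Rightarrow> 'a::ring_1" and q and R :: "('k, 'n::finite) braid_matrix" +
  fixes L :: "'a^'n^'n"
begin

text \<open>The scalar \<open>0\<close> in the other degrees is compatible with conjugation by the generators.\<close>

definition copies :: "nat \<Rightarrow> nat \<Rightarrow> ('n, 'a) block_op" where
  "copies n i = block n 0 (L_bar type_ring \<iota> R L i)"

lemma quantum_matrix_block:
  "quantum_matrix (\<lambda>c. left_scale (\<iota> c)) q (gen n) (gen_inv n) n (copies n)"
proof
  show "copies n 1 * gen n j = gen n j * copies n 1" if "2 \<le> j" "j < n" for j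
    unfolding copies_def gen_def block_mult
    using that at_pos_first_commute[of j _ L "map_matrix \<iota> R"]
    by (intro block_cong) (auto simp: map_matrix_def hom_central hom_zero)
  show "copies n (Suc i) = gen n i * copies n i * gen_inv n i" if "1 \<le> i" "i < n" for i
    using that unfolding copies_def gen_def gen_inv_def block_mult
    by (cases i) (auto intro: block_cong)
qed

sublocale quantum: quantum_matrix "\<lambda>c. left_scale (\<iota> c)" q "gen n" "gen_inv n" n "copies n" for n
  by (rule quantum_matrix_block)

end

section \<open>The skew inverse and the weight matrix of the R-trace\<close>

text \<open>
  In this form the braid relation allows a partial trace over the third factor: on the right-hand
  side only the middle generator acts there.
\<close>

lemma (in hecke_algebra) braid_conjugate:
  assumes "1 \<le> i" "Suc i < n"
  shows "s (Suc i) * r i * r (Suc i) = r i * r (Suc i) * s i"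
    and "r (Suc i) * r i * s (Suc i) = s i * r (Suc i) * r i"
proof -
  have inv: "r i * s i = 1" "s i * r i = 1" "r (Suc i) * s (Suc i) = 1" "s (Suc i) * r (Suc i) = 1"
    using assms by (simp_all add: inv_left inv_right)
  note B = braid[OF assms]
  have "s (Suc i) * r i * r (Suc i) = s (Suc i) * (r i * r (Suc i) * r i) * s i"
    using inv(1) by (simp add: mult.assoc)
  also have "\<dots> = (s (Suc i) * r (Suc i)) * r i * r (Suc i) * s i"
    unfolding B by (simp only: mult.assoc)
  finally show "s (Suc i) * r i * r (Suc i) = r i * r (Suc i) * s i" by (simp add: inv)
  have "r (Suc i) * r i * s (Suc i) = (s i * r i) * r (Suc i) * r i * s (Suc i)"
    using inv(2) by simp
  also have "\<dots> = s i * (r (Suc i) * r i * r (Suc i)) * s (Suc i)"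
    unfolding B[symmetric] by (simp only: mult.assoc)
  also have "\<dots> = s i * r (Suc i) * r i * (r (Suc i) * s (Suc i))"
    by (simp only: mult.assoc)
  finally show "r (Suc i) * r i * s (Suc i) = s i * r (Suc i) * r i" by (simp add: inv)
qed

lemma at_pos2_words3:
  fixes M :: "('k::field, 'n::finite) braid_matrix"
  shows "(at_pos2 type_ring 1 M \<diamondop> S) [i, j, k] J = (\<Sum>a\<in>UNIV. \<Sum>b\<in>UNIV. M $ (i, j) $ (a, b) * S [a, b, k] J)"
    and "(at_pos2 type_ring 2 M \<diamondop> S) [i, j, k] J = (\<Sum>a\<in>UNIV. \<Sum>b\<in>UNIV. M $ (j, k) $ (a, b) * S [i, a, b] J)"
proof -
  have "(at_pos2 type_ring 1 M \<diamondop> S) [i, j, k] J = (local_op 0 2 (at_pos2 type_ring 1 M) \<diamondop> S) [i, j, k] J"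
    using at_pos2_local[of 1 2 0 _ M] by (intro op_mult_cong) simp_all
  also have "\<dots> = (\<Sum>a\<in>UNIV. \<Sum>b\<in>UNIV. M $ (i, j) $ (a, b) * S [a, b, k] J)"
    using local_op_mult_left[of "[]" 0 "[i, j]" 2 "at_pos2 type_ring 1 M" S "[k]" J]
    by (simp add: sum_words_two at_pos2_one_entries)
  finally show "(at_pos2 type_ring 1 M \<diamondop> S) [i, j, k] J = \<dots>" .
  have "(at_pos2 type_ring 2 M \<diamondop> S) [i, j, k] J = (local_op 1 2 (at_pos2 type_ring 1 M) \<diamondop> S) [i, j, k] J"
    using at_pos2_local[of 1 2 1 _ M] by (intro op_mult_cong) (simp_all add: numeral_2_eq_2)
  also have "\<dots> = (\<Sum>a\<in>UNIV. \<Sum>b\<in>UNIV. M $ (j, k) $ (a, b) * S [i, a, b] J)"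
    using local_op_mult_left[of "[i]" 1 "[j, k]" 2 "at_pos2 type_ring 1 M" S "[]" J]
    by (simp add: sum_words_two at_pos2_one_entries)
  finally show "(at_pos2 type_ring 2 M \<diamondop> S) [i, j, k] J = \<dots>" .
qed

lemma sum_rotate3: "(\<Sum>a\<in>A. \<Sum>b\<in>B. \<Sum>c\<in>D. f a b c) = (\<Sum>c\<in>D. \<Sum>a\<in>A. \<Sum>b\<in>B. f a b c)"
  for f :: "'i \<Rightarrow> 'j \<Rightarrow> 'l \<Rightarrow> 'a::comm_monoid_add"
proof -
  have "(\<Sum>a\<in>A. \<Sum>b\<in>B. \<Sum>c\<in>D. f a b c) = (\<Sum>a\<in>A. \<Sum>c\<in>D. \<Sum>b\<in>B. f a b c)"
    by (intro sum.cong refl sum.swap)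
  also have "\<dots> = (\<Sum>c\<in>D. \<Sum>a\<in>A. \<Sum>b\<in>B. f a b c)"
    by (rule sum.swap)
  finally show ?thesis .
qed

lemma sum_rotate4:
  "(\<Sum>a\<in>A. \<Sum>b\<in>B. \<Sum>c\<in>D. \<Sum>d\<in>E. f a b c d) = (\<Sum>d\<in>E. \<Sum>a\<in>A. \<Sum>b\<in>B. \<Sum>c\<in>D. f a b c d)"
  for f :: "'i \<Rightarrow> 'j \<Rightarrow> 'l \<Rightarrow> 'm \<Rightarrow> 'a::comm_monoid_add"
proof -
  have "(\<Sum>a\<in>A. \<Sum>b\<in>B. \<Sum>c\<in>D. \<Sum>d\<in>E. f a b c d) = (\<Sum>a\<in>A. \<Sum>d\<in>E. \<Sum>b\<in>B. \<Sum>c\<in>D. f a b c d)"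
    by (intro sum.cong refl sum_rotate3)
  also have "\<dots> = (\<Sum>d\<in>E. \<Sum>a\<in>A. \<Sum>b\<in>B. \<Sum>c\<in>D. f a b c d)"
    by (rule sum.swap)
  finally show ?thesis .
qed

locale skew_hecke =
  fixes q :: "'k::field" and R :: "('k, 'n::finite) braid_matrix"
  assumes symmetry: "hecke_symmetry q R" and generic: "generic q" and skew: "skew_invertible R"
begin

sublocale field: hecke_operators "\<lambda>x. x" q R
  by unfold_locales (auto simp: symmetry generic mult.commute)

definition \<Psi> :: "('k, 'n) braid_matrix" where
  "\<Psi> = (SOME \<Psi>. skew_inverse R \<Psi>)"

abbreviation C :: "'k^'n^'n" where
  "C \<equiv> C_matrix R"

abbreviation R' :: "('k, 'n) braid_matrix" where
  "R' \<equiv> matrix_inv R"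

lemma skew_inverse_right:
  "(\<Sum>j\<in>UNIV. \<Sum>l\<in>UNIV. R $ (i, j) $ (k, l) * \<Psi> $ (l, p) $ (j, r)) = (if i = r \<and> p = k then 1 else 0)"
proof -
  have "skew_inverse R \<Psi>"
    using skew unfolding skew_invertible_def \<Psi>_def by (rule someI_ex)
  then show ?thesis by (simp add: skew_inverse_def)
qed

lemma C_entry: "C $ i $ j = (\<Sum>k\<in>UNIV. \<Psi> $ (i, k) $ (j, k))"
  by (simp add: C_matrix_def \<Psi>_def)

text \<open>
  The defining equation of the skew inverse says that two square matrices with rearranged indices
  have product \<open>1\<close>; this is their product in the other order.
\<close>

lemma skew_inverse_left:
  "(\<Sum>r\<in>UNIV. \<Sum>p\<in>UNIV. \<Psi> $ (l, p) $ (j, r) * R $ (r, j') $ (p, l')) = (if j = j' \<and> l = l' then 1 else 0)"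
proof -
  define A :: "('k, 'n) braid_matrix" where "A = (\<chi> x y. R $ (fst x, fst y) $ (snd x, snd y))"
  define B :: "('k, 'n) braid_matrix" where "B = (\<chi> x y. \<Psi> $ (snd x, snd y) $ (fst x, fst y))"
  have pairs: "(\<Sum>x\<in>UNIV. f x) = (\<Sum>a\<in>UNIV. \<Sum>b\<in>UNIV. f (a, b))" for f :: "'n \<times> 'n \<Rightarrow> 'k"
    by (simp add: sum.cartesian_product)
  have "A ** B = mat 1"
    by (auto simp: vec_eq_iff matrix_matrix_mult_def A_def B_def pairs skew_inverse_right mat_def)
  then have "B ** A = mat 1"
    by (simp add: matrix_left_right_inverse)
  then have "(B ** A) $ (j, l) $ (j', l') = (if j = j' \<and> l = l' then 1 else 0)"
    by (simp add: mat_def)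
  then show ?thesis
    by (simp add: matrix_matrix_mult_def A_def B_def pairs)
qed

text \<open>Contraction of two indices of \<open>R\<close> can be undone by contraction with \<open>\<Psi>\<close>.\<close>

lemma skew_solve:
  assumes "\<And>i l. (\<Sum>a\<in>UNIV. \<Sum>c\<in>UNIV. R $ (i, a) $ (l, c) * f a c) = g i l"
  shows "f a c = (\<Sum>i\<in>UNIV. \<Sum>l\<in>UNIV. \<Psi> $ (c, l) $ (a, i) * g i l)"
proof -
  have "(\<Sum>i\<in>UNIV. \<Sum>l\<in>UNIV. \<Psi> $ (c, l) $ (a, i) * g i l)
      = (\<Sum>i\<in>UNIV. \<Sum>l\<in>UNIV. \<Sum>a'\<in>UNIV. \<Sum>c'\<in>UNIV. \<Psi> $ (c, l) $ (a, i) * R $ (i, a') $ (l, c') * f a' c')"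
    by (simp add: assms[symmetric] sum_distrib_left mult.assoc)
  also have "\<dots> = (\<Sum>c'\<in>UNIV. \<Sum>i\<in>UNIV. \<Sum>l\<in>UNIV. \<Sum>a'\<in>UNIV. \<Psi> $ (c, l) $ (a, i) * R $ (i, a') $ (l, c') * f a' c')"
    by (rule sum_rotate4)
  also have "\<dots> = (\<Sum>a'\<in>UNIV. \<Sum>c'\<in>UNIV. \<Sum>i\<in>UNIV. \<Sum>l\<in>UNIV. \<Psi> $ (c, l) $ (a, i) * R $ (i, a') $ (l, c') * f a' c')"
    by (rule sum_rotate4)
  also have "\<dots> = (\<Sum>a'\<in>UNIV. \<Sum>c'\<in>UNIV. (if a = a' \<and> c = c' then 1 else 0) * f a' c')"
    by (simp only: skew_inverse_left sum_distrib_right[symmetric])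
  also have "\<dots> = (\<Sum>a'\<in>UNIV. \<Sum>c'\<in>UNIV. if c' = c then (if a' = a then f a' c else 0) else 0)"
    by (intro sum.cong refl) auto
  also have "\<dots> = f a c" by simp
  finally show ?thesis by simp
qed

text \<open>The second tensor factor of \<open>R\<close> has \<open>R\<close>-trace \<open>1\<close>: sum the equation of the skew inverse over \<open>p = r\<close>.\<close>

lemma C_trace: "(\<Sum>a\<in>UNIV. \<Sum>b\<in>UNIV. C $ a $ b * R $ (i, b) $ (k, a)) = (if i = k then 1 else 0)"
proof -
  have "(\<Sum>a\<in>UNIV. \<Sum>b\<in>UNIV. C $ a $ b * R $ (i, b) $ (k, a))
      = (\<Sum>a\<in>UNIV. \<Sum>b\<in>UNIV. \<Sum>p\<in>UNIV. R $ (i, b) $ (k, a) * \<Psi> $ (a, p) $ (b, p))"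
    by (simp add: C_entry sum_distrib_left mult.commute)
  also have "\<dots> = (\<Sum>b\<in>UNIV. \<Sum>a\<in>UNIV. \<Sum>p\<in>UNIV. R $ (i, b) $ (k, a) * \<Psi> $ (a, p) $ (b, p))"
    by (rule sum.swap)
  also have "\<dots> = (\<Sum>p\<in>UNIV. \<Sum>b\<in>UNIV. \<Sum>a\<in>UNIV. R $ (i, b) $ (k, a) * \<Psi> $ (a, p) $ (b, p))"
    by (rule sum_rotate3)
  also have "\<dots> = (\<Sum>p\<in>UNIV. if p = i then (if i = k then 1 else 0) else 0)"
    by (intro sum.cong refl) (auto simp: skew_inverse_right)
  finally show ?thesis by simp
qed

lemma map_matrix_id: "map_matrix (\<lambda>x. x) M = M"
  by (simp add: vec_eq_iff map_matrix_def)

text \<open>The two cases of \<open>braid_conjugate\<close>, treated together.\<close>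

definition conjugate_pair :: "('k, 'n) braid_matrix \<Rightarrow> ('k, 'n) braid_matrix \<Rightarrow> bool" where
  "conjugate_pair W U \<longleftrightarrow> W = R' \<and> U = R \<or> W = R \<and> U = R'"

text \<open>The entries of \<open>W\<^sub>2 R\<^sub>1 U\<^sub>2 = U\<^sub>1 R\<^sub>2 W\<^sub>1\<close> in degree 3.\<close>

lemma braid_entries:
  assumes "conjugate_pair W U"
  shows "(\<Sum>a\<in>UNIV. \<Sum>b\<in>UNIV. W $ (j, k) $ (a, b) * (\<Sum>c\<in>UNIV. R $ (i, a) $ (l, c) * U $ (c, b) $ (m, n)))
       = (\<Sum>a\<in>UNIV. \<Sum>b\<in>UNIV. U $ (i, j) $ (a, b) * (\<Sum>c\<in>UNIV. R $ (b, k) $ (c, n) * W $ (a, c) $ (l, m)))"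
proof -
  let ?P = "\<lambda>i M. at_pos2 type_ring i M :: ('n, 'k) tensor_op"
  have e: "(?P 2 W \<diamondop> ?P 1 R \<diamondop> ?P 2 U) [i, j, k] [l, m, n] = (?P 1 U \<diamondop> ?P 2 R \<diamondop> ?P 1 W) [i, j, k] [l, m, n]"
  proof -
    have *: "entry (field.gen_inv 3 (Suc 1) * field.gen 3 1 * field.gen 3 (Suc 1)) [i, j, k] [l, m, n]
      = entry (field.gen 3 1 * field.gen 3 (Suc 1) * field.gen_inv 3 1) [i, j, k] [l, m, n]"
      "entry (field.gen 3 (Suc 1) * field.gen 3 1 * field.gen_inv 3 (Suc 1)) [i, j, k] [l, m, n]
      = entry (field.gen_inv 3 1 * field.gen 3 (Suc 1) * field.gen 3 1) [i, j, k] [l, m, n]"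
      using field.hecke.braid_conjugate[of 1 3] by simp_all
    show ?thesis
      using assms * unfolding conjugate_pair_def field.gen_def field.gen_inv_def block_mult map_matrix_id
      by (auto simp: entry_block numeral_2_eq_2)
  qed
  have P1: "?P 1 M [x, c, b] [l, m, n] = (if b = n then M $ (x, c) $ (l, m) else 0)" for M x c b
    by (simp add: at_pos2_def)
  have P2: "?P 2 M [x, c, b] [l, m, n] = (if x = l then M $ (c, b) $ (m, n) else 0)" for M x c b
    by (simp add: at_pos2_def)
  have delta: "(\<Sum>x\<in>UNIV. \<Sum>c\<in>UNIV. f x c * (if x = y then g c else 0)) = (\<Sum>c\<in>UNIV. f y c * g c)"
    "(\<Sum>c\<in>UNIV. \<Sum>x\<in>UNIV. f x c * (if x = y then g c else 0)) = (\<Sum>c\<in>UNIV. f y c * g c)"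
    for f :: "'n \<Rightarrow> 'n \<Rightarrow> 'k" and g y
  proof -
    show "(\<Sum>c\<in>UNIV. \<Sum>x\<in>UNIV. f x c * (if x = y then g c else 0)) = (\<Sum>c\<in>UNIV. f y c * g c)"
      by (simp add: if_distrib[of "\<lambda>x. _ * x"] cong: if_cong)
    then show "(\<Sum>x\<in>UNIV. \<Sum>c\<in>UNIV. f x c * (if x = y then g c else 0)) = (\<Sum>c\<in>UNIV. f y c * g c)"
      by (subst sum.swap)
  qed
  show ?thesis
    using e unfolding op_mult_assoc at_pos2_words3 P1 P2 delta .
qed

lemma conjugate_pair_inverse:
  assumes "conjugate_pair W U"
  shows "(\<Sum>a\<in>UNIV. \<Sum>b\<in>UNIV. U $ (i, j) $ (a, b) * W $ (a, b) $ (l, m)) = (if i = l \<and> j = m then 1 else 0)"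
proof -
  have "U ** W = mat 1"
    using assms hecke_symmetry_inverse[OF symmetry] by (auto simp: conjugate_pair_def)
  then have "(U ** W) $ (i, j) $ (l, m) = (if i = l \<and> j = m then 1 else 0)"
    by (simp add: mat_def)
  then show ?thesis by (simp add: matrix_matrix_mult_def sum.cartesian_product)
qed

text \<open>
  Take the \<open>R\<close>-trace of \<open>W\<^sub>2 R\<^sub>1 U\<^sub>2 = U\<^sub>1 R\<^sub>2 W\<^sub>1\<close> over the third factor.  On the right, \<open>R\<^sub>2\<close> becomes \<open>1\<close> by
  \<open>C_trace\<close>, and \<open>U W = 1\<close> is left.  Then cancel \<open>R\<^sub>1\<close> on the left with \<open>\<Psi>\<close>; the partial trace of
  \<open>\<Psi>\<close> that appears on the right is \<open>C\<close>.
\<close>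

lemma partial_conjugation:
  assumes "conjugate_pair W U"
  shows "(\<Sum>k\<in>UNIV. \<Sum>n\<in>UNIV. \<Sum>b\<in>UNIV. C $ n $ k * W $ (j, k) $ (r, b) * U $ (p, b) $ (m, n))
    = (if j = m then C $ p $ r else 0)"
proof -
  define G where "G a c = (\<Sum>k\<in>UNIV. \<Sum>n\<in>UNIV. \<Sum>b\<in>UNIV. C $ n $ k * W $ (j, k) $ (a, b) * U $ (c, b) $ (m, n))" for a c
  have "(\<Sum>a\<in>UNIV. \<Sum>c\<in>UNIV. R $ (i, a) $ (l, c) * G a c) = (if i = l \<and> j = m then 1 else 0)" for i l
  proof -
    have "(\<Sum>a\<in>UNIV. \<Sum>c\<in>UNIV. R $ (i, a) $ (l, c) * G a c)
        = (\<Sum>k\<in>UNIV. \<Sum>n\<in>UNIV. C $ n $ k * (\<Sum>a\<in>UNIV. \<Sum>b\<in>UNIV. W $ (j, k) $ (a, b) *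
            (\<Sum>c\<in>UNIV. R $ (i, a) $ (l, c) * U $ (c, b) $ (m, n))))"
    proof -
      let ?t = "\<lambda>a b c k n. C $ n $ k * (W $ (j, k) $ (a, b) * (R $ (i, a) $ (l, c) * U $ (c, b) $ (m, n)))"
      have "(\<Sum>a\<in>UNIV. \<Sum>c\<in>UNIV. R $ (i, a) $ (l, c) * G a c)
          = (\<Sum>a\<in>UNIV. \<Sum>c\<in>UNIV. \<Sum>k\<in>UNIV. \<Sum>n\<in>UNIV. \<Sum>b\<in>UNIV. ?t a b c k n)"
        by (simp only: G_def sum_distrib_left) (simp only: mult_ac)
      also have "\<dots> = (\<Sum>k\<in>UNIV. \<Sum>a\<in>UNIV. \<Sum>c\<in>UNIV. \<Sum>n\<in>UNIV. \<Sum>b\<in>UNIV. ?t a b c k n)"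
        by (rule sum_rotate3)
      also have "\<dots> = (\<Sum>k\<in>UNIV. \<Sum>n\<in>UNIV. \<Sum>a\<in>UNIV. \<Sum>c\<in>UNIV. \<Sum>b\<in>UNIV. ?t a b c k n)"
        by (rule sum.cong[OF refl sum_rotate3])
      also have "\<dots> = (\<Sum>k\<in>UNIV. \<Sum>n\<in>UNIV. \<Sum>a\<in>UNIV. \<Sum>b\<in>UNIV. \<Sum>c\<in>UNIV. ?t a b c k n)"
        by (intro sum.cong[OF refl] sum.swap)
      finally show ?thesis by (simp only: sum_distrib_left)
    qed
    also have "\<dots> = (\<Sum>k\<in>UNIV. \<Sum>n\<in>UNIV. C $ n $ k * (\<Sum>a\<in>UNIV. \<Sum>b\<in>UNIV. U $ (i, j) $ (a, b) *
            (\<Sum>c\<in>UNIV. R $ (b, k) $ (c, n) * W $ (a, c) $ (l, m))))"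
      by (simp only: braid_entries[OF assms])
    also have "\<dots> = (\<Sum>a\<in>UNIV. \<Sum>b\<in>UNIV. \<Sum>c\<in>UNIV. U $ (i, j) $ (a, b) * W $ (a, c) $ (l, m) *
            (\<Sum>n\<in>UNIV. \<Sum>k\<in>UNIV. C $ n $ k * R $ (b, k) $ (c, n)))"
    proof -
      let ?t = "\<lambda>a b c k n. C $ n $ k * (U $ (i, j) $ (a, b) * (R $ (b, k) $ (c, n) * W $ (a, c) $ (l, m)))"
      have "(\<Sum>a\<in>UNIV. \<Sum>b\<in>UNIV. \<Sum>c\<in>UNIV. U $ (i, j) $ (a, b) * W $ (a, c) $ (l, m) *
            (\<Sum>n\<in>UNIV. \<Sum>k\<in>UNIV. C $ n $ k * R $ (b, k) $ (c, n)))
          = (\<Sum>a\<in>UNIV. \<Sum>b\<in>UNIV. \<Sum>c\<in>UNIV. \<Sum>n\<in>UNIV. \<Sum>k\<in>UNIV. ?t a b c k n)"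
        by (simp only: sum_distrib_left) (simp only: mult_ac)
      also have "\<dots> = (\<Sum>a\<in>UNIV. \<Sum>b\<in>UNIV. \<Sum>c\<in>UNIV. \<Sum>k\<in>UNIV. \<Sum>n\<in>UNIV. ?t a b c k n)"
        by (intro sum.cong[OF refl] sum.swap)
      also have "\<dots> = (\<Sum>k\<in>UNIV. \<Sum>a\<in>UNIV. \<Sum>b\<in>UNIV. \<Sum>c\<in>UNIV. \<Sum>n\<in>UNIV. ?t a b c k n)"
        by (rule sum_rotate4)
      also have "\<dots> = (\<Sum>k\<in>UNIV. \<Sum>n\<in>UNIV. \<Sum>a\<in>UNIV. \<Sum>b\<in>UNIV. \<Sum>c\<in>UNIV. ?t a b c k n)"
        by (rule sum.cong[OF refl sum_rotate4])
      finally show ?thesis by (simp only: sum_distrib_left)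
    qed
    also have "\<dots> = (\<Sum>a\<in>UNIV. \<Sum>b\<in>UNIV. U $ (i, j) $ (a, b) * W $ (a, b) $ (l, m))"
      by (simp add: C_trace if_distrib[of "\<lambda>x. _ * x"] cong: if_cong)
    finally show ?thesis by (simp only: conjugate_pair_inverse[OF assms])
  qed
  from skew_solve[OF this] have "G r p = (\<Sum>i\<in>UNIV. \<Sum>l\<in>UNIV. \<Psi> $ (p, l) $ (r, i) * (if i = l \<and> j = m then 1 else 0))" .
  also have "\<dots> = (\<Sum>i\<in>UNIV. \<Sum>l\<in>UNIV. if l = i then (if j = m then \<Psi> $ (p, i) $ (r, i) else 0) else 0)"
    by (intro sum.cong refl) auto
  also have "\<dots> = (if j = m then C $ p $ r else 0)"
    by (simp add: C_entry)
  finally show ?thesis by (simp add: G_def)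
qed

text \<open>
  Both sides solve the same linear system with the coefficients of \<open>R\<close>: for the left-hand side this
  is \<open>partial_conjugation\<close>, and \<open>skew_solve\<close> gives the solution.
\<close>

lemma weighted_inverse_left:
  "(\<Sum>k\<in>UNIV. C $ a $ k * R' $ (j, k) $ (r, c)) = (\<Sum>p\<in>UNIV. \<Psi> $ (a, j) $ (c, p) * C $ p $ r)"
proof -
  have "(\<Sum>b\<in>UNIV. \<Sum>n\<in>UNIV. R $ (p, b) $ (m, n) * (\<Sum>k\<in>UNIV. C $ n $ k * R' $ (j, k) $ (r, b)))
      = (if j = m then C $ p $ r else 0)" for p m
  proof -
    have "(\<Sum>b\<in>UNIV. \<Sum>n\<in>UNIV. R $ (p, b) $ (m, n) * (\<Sum>k\<in>UNIV. C $ n $ k * R' $ (j, k) $ (r, b)))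
        = (\<Sum>k\<in>UNIV. \<Sum>n\<in>UNIV. \<Sum>b\<in>UNIV. C $ n $ k * R' $ (j, k) $ (r, b) * R $ (p, b) $ (m, n))"
      unfolding sum_distrib_left
      by (subst sum_rotate3, subst (2) sum.swap) (simp only: mult_ac)
    then show ?thesis using partial_conjugation[of R' R] by (simp add: conjugate_pair_def)
  qed
  from skew_solve[OF this, of a c] show ?thesis
    by (simp add: if_distrib[of "\<lambda>x. _ * x"] cong: if_cong)
qed

lemma weighted_inverse_right:
  "(\<Sum>n\<in>UNIV. R' $ (p, a) $ (m, n) * C $ n $ c) = (\<Sum>r\<in>UNIV. C $ p $ r * \<Psi> $ (a, r) $ (c, m))"
proof -
  have "(\<Sum>k\<in>UNIV. \<Sum>b\<in>UNIV. R $ (j, k) $ (r, b) * (\<Sum>n\<in>UNIV. R' $ (p, b) $ (m, n) * C $ n $ k))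
      = (if j = m then C $ p $ r else 0)" for j r
  proof -
    have "(\<Sum>k\<in>UNIV. \<Sum>b\<in>UNIV. R $ (j, k) $ (r, b) * (\<Sum>n\<in>UNIV. R' $ (p, b) $ (m, n) * C $ n $ k))
        = (\<Sum>k\<in>UNIV. \<Sum>n\<in>UNIV. \<Sum>b\<in>UNIV. C $ n $ k * R $ (j, k) $ (r, b) * R' $ (p, b) $ (m, n))"
      unfolding sum_distrib_left by (subst (2) sum.swap) (simp only: mult_ac)
    then show ?thesis using partial_conjugation[of R R'] by (simp add: conjugate_pair_def)
  qed
  from skew_solve[OF this, of a c] have "(\<Sum>n\<in>UNIV. R' $ (p, a) $ (m, n) * C $ n $ c) =
    (\<Sum>i\<in>UNIV. \<Sum>l\<in>UNIV. \<Psi> $ (a, l) $ (c, i) * (if i = m then C $ p $ l else 0))" .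
  also have "\<dots> = (\<Sum>l\<in>UNIV. \<Sum>i\<in>UNIV. \<Psi> $ (a, l) $ (c, i) * (if i = m then C $ p $ l else 0))"
    by (rule sum.swap)
  also have "\<dots> = (\<Sum>r\<in>UNIV. C $ p $ r * \<Psi> $ (a, r) $ (c, m))"
    by (simp add: if_distrib[of "\<lambda>x. _ * x"] mult.commute cong: if_cong)
  finally show ?thesis .
qed

text \<open>
  The two lemmas above give \<open>C \<otimes> C\<close> times \<open>R\<^sup>-\<^sup>1\<close> and \<open>R\<^sup>-\<^sup>1\<close> times \<open>C \<otimes> C\<close> the common form
  of \<open>\<Psi>\<close> with \<open>C\<close> on both sides.
\<close>

lemma C_C_commute:
  "(\<Sum>a\<in>UNIV. \<Sum>b\<in>UNIV. R $ (i, j) $ (a, b) * (C $ a $ k * C $ b $ l))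
    = (\<Sum>a\<in>UNIV. \<Sum>b\<in>UNIV. C $ i $ a * C $ j $ b * R $ (a, b) $ (k, l))"
proof -
  define D :: "('k, 'n) braid_matrix" where "D = (\<chi> x y. C $ fst x $ fst y * C $ snd x $ snd y)"
  have pairs: "(\<Sum>x\<in>UNIV. f x) = (\<Sum>a\<in>UNIV. \<Sum>b\<in>UNIV. f (a, b))" for f :: "'n \<times> 'n \<Rightarrow> 'k"
    by (simp add: sum.cartesian_product)
  have "(D ** R') $ (i, j) $ (k, l) = (R' ** D) $ (i, j) $ (k, l)" for i j k l
  proof -
    have "(D ** R') $ (i, j) $ (k, l) = (\<Sum>a\<in>UNIV. C $ i $ a * (\<Sum>b\<in>UNIV. C $ j $ b * R' $ (a, b) $ (k, l)))"
      by (simp add: matrix_matrix_mult_def D_def pairs sum_distrib_left mult.assoc)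
    also have "\<dots> = (\<Sum>a\<in>UNIV. \<Sum>p\<in>UNIV. C $ i $ a * \<Psi> $ (j, a) $ (l, p) * C $ p $ k)"
      unfolding weighted_inverse_left by (simp add: sum_distrib_left mult.assoc)
    also have "\<dots> = (\<Sum>p\<in>UNIV. \<Sum>a\<in>UNIV. C $ i $ a * \<Psi> $ (j, a) $ (l, p) * C $ p $ k)"
      by (rule sum.swap)
    also have "\<dots> = (\<Sum>p\<in>UNIV. (\<Sum>n\<in>UNIV. R' $ (i, j) $ (p, n) * C $ n $ l) * C $ p $ k)"
      unfolding weighted_inverse_right by (simp only: sum_distrib_right)
    also have "\<dots> = (R' ** D) $ (i, j) $ (k, l)"
      by (simp add: matrix_matrix_mult_def D_def pairs) (simp only: sum_distrib_right, simp only: mult_ac)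
    finally show ?thesis .
  qed
  then have "D ** R' = R' ** D" by (simp add: vec_eq_iff split_paired_all)
  then have "R ** (D ** R') ** R = R ** (R' ** D) ** R" by simp
  then have "R ** D ** (R' ** R) = (R ** R') ** D ** R"
    by (simp only: matrix_mul_assoc)
  then have "R ** D = D ** R"
    by (simp add: hecke_symmetry_inverse[OF symmetry])
  then have "(R ** D) $ (i, j) $ (k, l) = (D ** R) $ (i, j) $ (k, l)" by simp
  then show ?thesis by (simp add: matrix_matrix_mult_def D_def pairs)
qed

end

section \<open>Operators that ignore the last tensor factors\<close>

text \<open>
  From degree \<open>k\<close> on, the operator is the identity on the last tensor factor and does not depend on
  the degree.
\<close>

definition stable_op :: "nat \<Rightarrow> ('n, 'a::ring_1) tensor_op \<Rightarrow> bool" where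
  "stable_op k S \<longleftrightarrow> (\<forall>I J a b. length I = length J \<longrightarrow> k \<le> length I \<longrightarrow>
     S (I @ [a]) (J @ [b]) = (if a = b then S I J else 0))"

lemma stableD:
  "stable_op k S \<Longrightarrow> length I = length J \<Longrightarrow> k \<le> length I \<Longrightarrow>
     S (I @ [a]) (J @ [b]) = (if a = b then S I J else 0)"
  unfolding stable_op_def by blast

lemma stable_mono: "stable_op k S \<Longrightarrow> k \<le> l \<Longrightarrow> stable_op l S"
  unfolding stable_op_def by (meson le_trans)

lemma stable_id: "stable_op k op_id"
  by (auto simp: stable_op_def op_id_eq)

lemma stable_mult:
  fixes S T :: "('n::finite, 'a::ring_1) tensor_op"
  assumes "stable_op k S" "stable_op k T"
  shows "stable_op k (S \<diamondop> T)"
  unfolding stable_op_def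
proof (intro allI impI)
  fix I J :: "'n list" and a b
  assume len: "length I = length J" "k \<le> length I"
  have "(S \<diamondop> T) (I @ [a]) (J @ [b])
      = (\<Sum>K | length K = length I. \<Sum>c\<in>UNIV. S (I @ [a]) (K @ [c]) * T (K @ [c]) (J @ [b]))"
    by (simp add: op_mult_eq sum_words_snoc)
  also have "\<dots> = (\<Sum>K | length K = length I. \<Sum>c\<in>UNIV. if c = a then (if a = b then S I K * T K J else 0) else 0)"
    using len by (intro sum.cong refl) (auto simp: stableD[OF assms(1)] stableD[OF assms(2)])
  also have "\<dots> = (if a = b then (S \<diamondop> T) I J else 0)"
    by (simp add: op_mult_eq)
  finally show "(S \<diamondop> T) (I @ [a]) (J @ [b]) = (if a = b then (S \<diamondop> T) I J else 0)" .
qed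

lemma stable_at_pos2:
  assumes "1 \<le> i" "i < k"
  shows "stable_op k (at_pos2 type_ring i M)"
  unfolding stable_op_def
proof (intro allI impI)
  fix I J :: "'a list" and a b
  assume len: "length I = length J" "k \<le> length I"
  then have "i + 1 \<le> length I" "i + 1 \<le> length J" using assms by auto
  then show "at_pos2 type_ring i M (I @ [a]) (J @ [b]) = (if a = b then at_pos2 type_ring i M I J else 0)"
    using len assms by (auto simp: at_pos2_def nth_append)
qed

lemma stable_at_pos:
  assumes "1 \<le> i" "i \<le> k"
  shows "stable_op k (at_pos type_ring i M)"
  unfolding stable_op_def
proof (intro allI impI)
  fix I J :: "'a list" and a b
  assume len: "length I = length J" "k \<le> length I"
  then have "i \<le> length I" "i \<le> length J" using assms by auto
  then show "at_pos type_ring i M (I @ [a]) (J @ [b]) = (if a = b then at_pos type_ring i M I J else 0)"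
    using len assms by (auto simp: at_pos_def nth_append)
qed

lemma stable_tensor_prod:
  assumes "\<And>i. 1 \<le> i \<Longrightarrow> i \<le> k \<Longrightarrow> stable_op k (S i)" "l \<le> k"
  shows "stable_op k (tensor_prod type_ring S l)"
  using assms(2) by (induction l) (auto intro!: stable_mult assms(1) intro: stable_id)

lemma stable_skew_symmetrizer: "stable_op k (skew_symmetrizer q R k)"
proof (induction k rule: induct_nat_012)
  case (ge2 k)
  let ?P = "skew_symmetrizer q R (Suc k)"
  let ?A = "\<lambda>I J. q ^ Suc k * op_id I J - q_number q (Suc k) * at_pos2 type_ring (Suc k) R I J"
  have P: "stable_op (Suc (Suc k)) ?P"
    using ge2(2) by (rule stable_mono) simp
  have "stable_op (Suc (Suc k)) ?A"
    unfolding stable_op_def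
    by (auto simp: stableD[OF stable_at_pos2[of "Suc k" "Suc (Suc k)"]] op_id_eq)
  with P have "stable_op (Suc (Suc k)) (?P \<diamondop> ?A \<diamondop> ?P)" by (intro stable_mult)
  then show ?case by (simp add: Let_def stable_op_def)
qed (simp_all add: stable_id)

lemma stable_L_bar: "1 \<le> k \<Longrightarrow> stable_op k (L_bar type_ring \<iota> R L k)"
proof (induction k rule: nat_induct_at_least)
  case base
  then show ?case by (simp add: stable_at_pos)
next
  case (Suc k)
  then obtain i where "k = Suc i" by (cases k) auto
  then show ?case
    using stable_mono[OF Suc.IH, of "Suc k"] by (auto intro!: stable_mult stable_at_pos2)
qed

lemma stable_L_bar_prod: "stable_op k (tensor_prod type_ring (L_bar type_ring \<iota> R L) k)"
  by (rule stable_tensor_prod) (auto intro: stable_mono[OF stable_L_bar])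

section \<open>The R-trace\<close>

context skew_hecke
begin

text \<open>The operator \<open>C \<otimes> \<dots> \<otimes> C\<close> that enters the \<open>R\<close>-trace.\<close>

definition weight :: "nat \<Rightarrow> ('n, 'k) tensor_op" where
  "weight k = tensor_prod type_ring (\<lambda>i. at_pos type_ring i C) k"

lemma weight_snoc:
  assumes "length I = k" "length J = k"
  shows "weight (Suc k) (I @ [a]) (J @ [b]) = weight k I J * C $ a $ b"
proof -
  have st: "stable_op k (weight k)"
    unfolding weight_def by (rule stable_tensor_prod) (auto intro: stable_at_pos)
  have "weight (Suc k) (I @ [a]) (J @ [b]) =
      (\<Sum>K | length K = k. \<Sum>c\<in>UNIV. weight k (I @ [a]) (K @ [c]) * at_pos type_ring (Suc k) C (K @ [c]) (J @ [b]))"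
    using assms by (simp add: weight_def op_mult_eq sum_words_snoc)
  also have "\<dots> = (\<Sum>K | length K = k. \<Sum>c\<in>UNIV. if c = a then (if K = J then weight k I J * C $ a $ b else 0) else 0)"
    using assms by (intro sum.cong refl) (auto simp: stableD[OF st] at_pos_def nth_append)
  also have "\<dots> = weight k I J * C $ a $ b"
    using assms by simp
  finally show ?thesis .
qed

lemma weight_append:
  assumes "length I = k" "length J = k" "length I' = length J'"
  shows "weight (k + length I') (I @ I') (J @ J') = weight k I J * weight (length I') I' J'"
  using assms(3)
proof (induction I' arbitrary: J' rule: rev_induct)
  case Nil
  then show ?case by (simp add: weight_def op_id_eq)
next
  case (snoc a I')
  then obtain J'' b where "J' = J'' @ [b]" "length J'' = length I'"
    by (metis length_append_singleton length_Suc_conv_rev)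
  then show ?case
    using snoc.IH[of J''] assms(1,2) weight_snoc[of "I @ I'" "k + length I'" "J @ J''"]
    by (simp add: weight_snoc)
qed

text \<open>
  The weight is a product over the tensor factors, so only the two factors on which \<open>R\<close> acts matter,
  and there it is \<open>C_C_commute\<close>.
\<close>

lemma weight_commute:
  assumes "1 \<le> i" "i < n" "length I = n" "length J = n"
  shows "(at_pos2 type_ring i R \<diamondop> weight n) I J = (weight n \<diamondop> at_pos2 type_ring i R) I J"
proof -
  let ?S = "at_pos2 type_ring 1 R"
  let ?l = "local_op (i - 1) 2 ?S"
  have loc: "at_pos2 type_ring i R I' J' = ?l I' J'" if "length I' = n" for I' J'
    using at_pos2_local[of 1 2 "i - 1" I' R J'] that assms by (simp add: numeral_2_eq_2)
  have len: "i - 1 + 2 \<le> length I" "i - 1 + 2 \<le> length J" using assms by auto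
  obtain U B V where I: "I = U @ B @ V" "length U = i - 1" "length B = 2"
    using len(1) by (rule word_split)
  obtain U' B' V' where J: "J = U' @ B' @ V'" "length U' = i - 1" "length B' = 2"
    using len(2) by (rule word_split)
  have V: "length V = length V'" "n = i - 1 + (2 + length V)" using I J assms by auto
  have w: "weight n (U @ B1 @ V) (U' @ B2 @ V') = weight (i - 1) U U' * weight 2 B1 B2 * weight (length V) V V'"
    if "length B1 = 2" "length B2 = 2" for B1 B2
  proof -
    have "weight n (U @ B1 @ V) (U' @ B2 @ V') = weight (i - 1) U U' * weight (2 + length V) (B1 @ V) (B2 @ V')"
      using weight_append[of U "i - 1" U' "B1 @ V" "B2 @ V'"] that I J V by simp
    also have "weight (2 + length V) (B1 @ V) (B2 @ V') = weight 2 B1 B2 * weight (length V) V V'"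
      using weight_append[of B1 2 B2 V V'] that V by simp
    finally show ?thesis by (simp add: mult.assoc)
  qed
  have w2: "weight 2 [a, b] [c, d] = C $ a $ c * C $ b $ d" for a b c d
    using weight_snoc[of "[a]" 1 "[c]" b d] weight_snoc[of "[]" 0 "[]" a c]
    by (simp add: numeral_2_eq_2) (simp add: weight_def op_id_eq)
  have core: "(\<Sum>B1 | length B1 = 2. ?S B B1 * weight 2 B1 B') = (\<Sum>B1 | length B1 = 2. weight 2 B B1 * ?S B1 B')"
  proof -
    obtain a b c d where "B = [a, b]" "B' = [c, d]"
      using I(3) J(3) by (auto simp: numeral_2_eq_2 length_Suc_conv)
    then show ?thesis by (simp add: sum_words_two at_pos2_one_entries w2 C_C_commute)
  qed
  have "(at_pos2 type_ring i R \<diamondop> weight n) I J = (?l \<diamondop> weight n) I J"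
    using assms by (intro op_mult_cong) (auto simp: loc)
  also have "\<dots> = (\<Sum>B1 | length B1 = 2. ?S B B1 * weight n (U @ B1 @ V) J)"
    unfolding I(1) using I by (intro local_op_mult_left) auto
  also have "\<dots> = weight (i - 1) U U' * weight (length V) V V' * (\<Sum>B1 | length B1 = 2. ?S B B1 * weight 2 B1 B')"
    unfolding J(1) sum_distrib_left using J by (intro sum.cong refl) (simp add: w)
  also have "\<dots> = (\<Sum>B1 | length B1 = 2. weight n I (U' @ B1 @ V') * ?S B1 B')"
    unfolding core I(1) sum_distrib_left using I by (intro sum.cong refl) (simp add: w)
  also have "\<dots> = (weight n \<diamondop> ?l) I J"
    unfolding J(1) using J assms by (intro local_op_mult_right[symmetric]) auto
  also have "\<dots> = (weight n \<diamondop> at_pos2 type_ring i R) I J"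
    using assms by (intro op_mult_cong) (auto simp: loc)
  finally show ?thesis .
qed

text \<open>The \<open>R\<close>-trace over the last tensor factor.\<close>

definition partial_trace :: "('n, 'k) tensor_op \<Rightarrow> ('n, 'k) tensor_op" where
  "partial_trace S = (\<lambda>I J. \<Sum>a\<in>UNIV. \<Sum>b\<in>UNIV. C $ a $ b * S (I @ [b]) (J @ [a]))"

lemma partial_trace_mult:
  assumes "stable_op k Y" "stable_op k Z" "length I = k" "length J = k"
  shows "partial_trace (Y \<diamondop> S \<diamondop> Z) I J = (Y \<diamondop> partial_trace S \<diamondop> Z) I J"
proof -
  have 1: "(Y \<diamondop> S \<diamondop> Z) (I @ [b]) (J @ [a]) =
     (\<Sum>K | length K = k. \<Sum>M | length M = k. Y I K * S (K @ [b]) (M @ [a]) * Z M J)" for a b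
  proof -
    have Y: "(Y \<diamondop> T) (I @ [b]) J' = (\<Sum>K | length K = k. Y I K * T (K @ [b]) J')" for T J'
    proof -
      have "(Y \<diamondop> T) (I @ [b]) J' = (\<Sum>K | length K = k. \<Sum>c\<in>UNIV. Y (I @ [b]) (K @ [c]) * T (K @ [c]) J')"
        using assms(3) by (simp add: op_mult_eq sum_words_snoc)
      also have "\<dots> = (\<Sum>K | length K = k. \<Sum>c\<in>UNIV. if c = b then Y I K * T (K @ [b]) J' else 0)"
        using assms(3) by (intro sum.cong refl) (auto simp: stableD[OF assms(1)])
      finally show ?thesis by simp
    qed
    have Z: "(S \<diamondop> Z) (K @ [b]) (J @ [a]) = (\<Sum>M | length M = k. S (K @ [b]) (M @ [a]) * Z M J)" if "length K = k" for K
    proof -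
      have "(S \<diamondop> Z) (K @ [b]) (J @ [a]) = (\<Sum>M | length M = k. \<Sum>c\<in>UNIV. S (K @ [b]) (M @ [c]) * Z (M @ [c]) (J @ [a]))"
        using that by (simp add: op_mult_eq sum_words_snoc)
      also have "\<dots> = (\<Sum>M | length M = k. \<Sum>c\<in>UNIV. if c = a then S (K @ [b]) (M @ [a]) * Z M J else 0)"
        using assms(4) by (intro sum.cong refl) (auto simp: stableD[OF assms(2)])
      finally show ?thesis by simp
    qed
    show ?thesis unfolding op_mult_assoc Y by (simp add: Z sum_distrib_left mult.assoc)
  qed
  have "partial_trace (Y \<diamondop> S \<diamondop> Z) I J = (\<Sum>a\<in>UNIV. \<Sum>b\<in>UNIV. \<Sum>K | length K = k. \<Sum>M | length M = k.
      C $ a $ b * (Y I K * S (K @ [b]) (M @ [a]) * Z M J))"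
    by (simp only: partial_trace_def 1 sum_distrib_left)
  also have "\<dots> = (\<Sum>K | length K = k. \<Sum>a\<in>UNIV. \<Sum>b\<in>UNIV. \<Sum>M | length M = k.
      C $ a $ b * (Y I K * S (K @ [b]) (M @ [a]) * Z M J))"
    by (rule sum_rotate3)
  also have "\<dots> = (\<Sum>K | length K = k. \<Sum>M | length M = k. \<Sum>a\<in>UNIV. \<Sum>b\<in>UNIV.
      C $ a $ b * (Y I K * S (K @ [b]) (M @ [a]) * Z M J))"
    by (rule sum.cong[OF refl sum_rotate3])
  also have "\<dots> = (\<Sum>K | length K = k. \<Sum>M | length M = k. Y I K * (partial_trace S K M * Z M J))"
    by (intro sum.cong refl) (simp only: partial_trace_def sum_distrib_left sum_distrib_right mult_ac)
  also have "\<dots> = (Y \<diamondop> (partial_trace S \<diamondop> Z)) I J"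
    using assms(3) by (simp add: op_mult_eq sum_distrib_left)
  finally show ?thesis by (simp only: op_mult_assoc)
qed

definition C_tr :: 'k where
  "C_tr = (\<Sum>a\<in>UNIV. C $ a $ a)"

lemma partial_trace_id: "partial_trace op_id I J = C_tr * op_id I J"
proof -
  have "partial_trace op_id I J = (\<Sum>a\<in>UNIV. \<Sum>b\<in>UNIV. if b = a then C $ a $ b * op_id I J else 0)"
    unfolding partial_trace_def by (intro sum.cong refl) (auto simp: op_id_eq)
  also have "\<dots> = (\<Sum>a\<in>UNIV. C $ a $ a * op_id I J)" by simp
  finally show ?thesis by (simp only: C_tr_def sum_distrib_right)
qed

lemma partial_trace_R:
  assumes "length I = Suc k" "length J = Suc k"
  shows "partial_trace (at_pos2 type_ring (Suc k) R) I J = op_id I J"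
proof -
  obtain I' c J' d where I: "I = I' @ [c]" "length I' = k" and J: "J = J' @ [d]" "length J' = k"
    using assms by (metis length_Suc_conv_rev)
  have "at_pos2 type_ring (Suc k) R (I @ [b]) (J @ [a]) = (if I' = J' then R $ (c, b) $ (d, a) else 0)" for a b
    using I J by (simp add: at_pos2_def nth_append)
  then have "partial_trace (at_pos2 type_ring (Suc k) R) I J
      = (if I' = J' then (\<Sum>a\<in>UNIV. \<Sum>b\<in>UNIV. C $ a $ b * R $ (c, b) $ (d, a)) else 0)"
    by (simp add: partial_trace_def)
  also have "\<dots> = op_id I J" using I J by (simp add: C_trace op_id_eq)
  finally show ?thesis .
qed

lemma skew_symmetrizer_idem:
  assumes "length I = k" "length J = k"
  shows "(skew_symmetrizer q R k \<diamondop> skew_symmetrizer q R k) I J = skew_symmetrizer q R k I J"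
proof -
  have "field.hecke.skew k k * field.hecke.skew k k = field.hecke.skew k k"
    by (rule field.hecke.skew_idem) simp
  then have "block k (1 * 1) (skew_symmetrizer_over (\<lambda>x. x) q R k \<diamondop> skew_symmetrizer_over (\<lambda>x. x) q R k)
      = block k 1 (skew_symmetrizer_over (\<lambda>x. x) q R k)"
    by (simp add: field.skew_block block_mult)
  from arg_cong[OF this, of "\<lambda>x. entry x I J"] show ?thesis
    using assms by (simp add: entry_block skew_symmetrizer_over_def)
qed

text \<open>
  In the recursion for degree \<open>k + 1\<close> the outer factors have degree \<open>k\<close> and can be taken out of the
  partial trace, which sends \<open>1\<close> to \<open>Tr C\<close> and \<open>R\<^sub>k\<close> to \<open>1\<close>; the remaining square is the skew-symmetrizer
  itself, an idempotent.
\<close>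

lemma partial_trace_skew_symmetrizer:
  assumes "length I = k" "length J = k"
  shows "partial_trace (skew_symmetrizer q R (Suc k)) I J
    = (q ^ k * C_tr - q_number q k) / q_number q (Suc k) * skew_symmetrizer q R k I J"
proof (cases k)
  case 0
  then show ?thesis using generic by (simp add: partial_trace_id)
next
  case (Suc j)
  note k = Suc
  let ?P = "skew_symmetrizer q R k"
  let ?A = "\<lambda>I J. q ^ k * op_id I J - q_number q k * at_pos2 type_ring k R I J"
  have P: "stable_op k ?P" by (rule stable_skew_symmetrizer)
  have rec: "skew_symmetrizer q R (Suc k) = (\<lambda>I J. 1 / q_number q (Suc k) * (?P \<diamondop> ?A \<diamondop> ?P) I J)"
    unfolding k by (simp add: Let_def)
  have "partial_trace (skew_symmetrizer q R (Suc k)) I J = 1 / q_number q (Suc k) * partial_trace (?P \<diamondop> ?A \<diamondop> ?P) I J"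
    unfolding rec partial_trace_def by (simp only: sum_distrib_left mult_ac)
  also have "partial_trace (?P \<diamondop> ?A \<diamondop> ?P) I J = (?P \<diamondop> partial_trace ?A \<diamondop> ?P) I J"
    by (rule partial_trace_mult[OF P P assms])
  also have "\<dots> = (?P \<diamondop> (\<lambda>I J. (q ^ k * C_tr - q_number q k) * op_id I J) \<diamondop> ?P) I J"
  proof -
    have A: "partial_trace ?A K M = (q ^ k * C_tr - q_number q k) * op_id K M" if "length K = k" "length M = k" for K M
    proof -
      have "partial_trace ?A K M = q ^ k * partial_trace op_id K M - q_number q k * partial_trace (at_pos2 type_ring k R) K M"
        unfolding partial_trace_def by (simp add: sum_distrib_left sum_subtractf algebra_simps)
      then show ?thesis
        using that partial_trace_R[of K j M] by (simp add: k partial_trace_id algebra_simps)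
    qed
    show ?thesis
      unfolding op_mult_assoc op_mult_eq using assms(1) by (intro sum.cong refl) (simp add: op_mult_eq A)
  qed
  also have "\<dots> = (q ^ k * C_tr - q_number q k) * (?P \<diamondop> op_id \<diamondop> ?P) I J"
    by (simp add: op_mult_eq sum_distrib_left sum_distrib_right mult_ac)
  also have "(?P \<diamondop> op_id \<diamondop> ?P) I J = ?P I J"
    using skew_symmetrizer_idem[OF assms] by (simp add: op_mult_assoc op_id_mult)
  finally show ?thesis by simp
qed

end

lemma (in central_hom) hom_solve:
  assumes "\<iota> v * x = \<iota> u * y" "v \<noteq> 0"
  shows "x = \<iota> (u / v) * y"
proof -
  have "x = \<iota> (1 / v) * (\<iota> v * x)"
    using assms(2) by (simp add: mult.assoc[symmetric] hom_mult[symmetric] hom_one)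
  also have "\<dots> = \<iota> (u / v) * y"
    unfolding assms(1) by (simp add: mult.assoc[symmetric] hom_mult[symmetric])
  finally show ?thesis .
qed

locale matrix_R_trace = skew_hecke q R + central_hom \<iota>
  for q and R :: "('k::field, 'n::finite) braid_matrix" and \<iota> :: "'k \<Rightarrow> 'a::ring_1" +
  fixes L :: "'a^'n^'n"
begin

sublocale alg: matrix_over_algebra \<iota> q R L
  by unfold_locales (auto simp: symmetry generic)

lemma R_trace_eq:
  "R_trace type_ring \<iota> R k S = (\<Sum>I | length I = k. (map_op (weight k) \<diamondop> S) I I)"
  unfolding R_trace_def tensor_trace_def weight_def map_op_at_pos map_op_tensor_prod
  by (simp add: finsum_type_ring)

lemma map_op_mult_entry:
  "(map_op S \<diamondop> T) I J = (\<Sum>K | length K = length I. \<iota> (S I K) * T K J)"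
  by (simp add: op_mult_eq map_op_def)

lemma R_trace_cong:
  assumes "\<And>I J. length I = k \<Longrightarrow> length J = k \<Longrightarrow> S I J = T I J"
  shows "R_trace type_ring \<iota> R k S = R_trace type_ring \<iota> R k T"
  unfolding R_trace_eq using assms by (intro sum.cong refl) (simp add: op_mult_eq)

lemma R_trace_scale:
  assumes "\<And>x. a * x = x * a"
  shows "R_trace type_ring \<iota> R k (\<lambda>I J. a * S I J) = a * R_trace type_ring \<iota> R k S"
proof -
  have "x * (a * y) = a * (x * y)" for x y by (metis assms mult.assoc)
  then show ?thesis by (simp add: R_trace_eq op_mult_eq sum_distrib_left)
qed

lemma trace_commute:
  "(\<Sum>I | length I = n. (map_op S \<diamondop> T) I I) = (\<Sum>I | length I = n. (T \<diamondop> map_op S) I I)"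
proof -
  have "(\<Sum>I | length I = n. (map_op S \<diamondop> T) I I) = (\<Sum>I | length I = n. \<Sum>K | length K = n. \<iota> (S I K) * T K I)"
    by (simp add: op_mult_eq map_op_def)
  also have "\<dots> = (\<Sum>K | length K = n. \<Sum>I | length I = n. \<iota> (S I K) * T K I)"
    by (rule sum.swap)
  also have "\<dots> = (\<Sum>K | length K = n. (T \<diamondop> map_op S) K K)"
    by (simp add: op_mult_eq map_op_def hom_central)
  finally show ?thesis .
qed

definition block_trace :: "nat \<Rightarrow> ('n, 'a) block_op \<Rightarrow> 'a" where
  "block_trace n y = R_trace type_ring \<iota> R n (entry y)"

lemma block_trace_block: "block_trace n (block n c S) = R_trace type_ring \<iota> R n S"
  unfolding block_trace_def by (rule R_trace_cong) (rule entry_block)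

lemma block_trace_left_scale:
  assumes "\<And>x. a * x = x * a"
  shows "block_trace n (left_scale a y) = a * block_trace n y"
  unfolding block_trace_def left_scale.rep_eq by (rule R_trace_scale) (rule assms)

text \<open>
  The weight lets \<open>R\<^sub>i\<close> pass, and the ordinary trace over a noncommutative ring is cyclic if one of the
  two factors has central entries.
\<close>

lemma block_trace_cyclic:
  assumes "1 \<le> i" "i < n"
  shows "block_trace n (alg.gen n i * y) = block_trace n (y * alg.gen n i)"
proof -
  let ?G = "at_pos2 type_ring i R" and ?y = "entry y"
  have gen: "entry (alg.gen n i) I J = map_op ?G I J" if "length I = n" "length J = n" for I J
    using that by (simp add: alg.gen_def entry_block map_op_at_pos2)
  have "block_trace n (alg.gen n i * y) = R_trace type_ring \<iota> R n (map_op ?G \<diamondop> ?y)"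
    unfolding block_trace_def times_block_op.rep_eq
    by (rule R_trace_cong) (auto simp: op_mult_eq gen)
  also have "\<dots> = (\<Sum>I | length I = n. (map_op (weight n \<diamondop> ?G) \<diamondop> ?y) I I)"
    by (simp only: R_trace_eq op_mult_assoc[symmetric] map_op_mult)
  also have "\<dots> = (\<Sum>I | length I = n. (map_op (?G \<diamondop> weight n) \<diamondop> ?y) I I)"
    using weight_commute[OF assms] by (intro sum.cong refl op_mult_cong) (auto simp: map_op_def)
  also have "\<dots> = (\<Sum>I | length I = n. (map_op (weight n) \<diamondop> (?y \<diamondop> map_op ?G)) I I)"
    by (simp only: map_op_mult op_mult_assoc trace_commute)
  also have "\<dots> = R_trace type_ring \<iota> R n (?y \<diamondop> map_op ?G)"
    by (simp only: R_trace_eq)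
  also have "\<dots> = block_trace n (y * alg.gen n i)"
    unfolding block_trace_def times_block_op.rep_eq
    by (rule R_trace_cong) (auto simp: op_mult_eq gen)
  finally show ?thesis .
qed

lemma quantum_trace_block:
  assumes t: "\<And>x. t * x = x * t"
  shows "quantum_trace (\<lambda>c. left_scale (\<iota> c)) q (alg.gen n) (alg.gen_inv n) n (alg.copies n) (block_trace n) (left_scale t 1)"
proof
  show "block_trace n (y + z) = block_trace n y + block_trace n z" for y z
    by (simp add: block_trace_def R_trace_eq plus_block_op.rep_eq op_mult_eq distrib_left sum.distrib)
  show "block_trace n (alg.gen n i * y) = block_trace n (y * alg.gen n i)" if "1 \<le> i" "i < n" for i y
    using that by (rule block_trace_cyclic)
  have *: "x * (t * y) = t * (x * y)" for x y by (metis t mult.assoc)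
  have "left_scale t x * y = left_scale t (x * y)" "x * left_scale t y = left_scale t (x * y)" for x y :: "('n, 'a) block_op"
    by (rule entry_inject[THEN iffD1];
        simp add: left_scale.rep_eq times_block_op.rep_eq op_mult_eq sum_distrib_left * mult.assoc fun_eq_iff)+
  then show "left_scale t 1 * y = y * left_scale t 1" for y :: "('n, 'a) block_op"
    by simp
qed

text \<open>The abstract expansion, applied to the operators of degree \<open>n\<close>.\<close>

lemma R_trace_char_prod:
  assumes t: "\<And>x. t * x = x * t"
  shows "R_trace type_ring \<iota> R n (skew_symmetrizer_over \<iota> q R n \<diamondop>
      tensor_prod type_ring (\<lambda>i I J. \<iota> (q ^ (2 * (i - 1))) * t * op_id I J - L_bar type_ring \<iota> R L i I J) n)
    = (\<Sum>k\<le>n. \<iota> ((- 1) ^ k * gauss_coeff q n k) * t ^ (n - k) *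
        R_trace type_ring \<iota> R n (skew_symmetrizer_over \<iota> q R n \<diamondop> tensor_prod type_ring (L_bar type_ring \<iota> R L) k))"
proof -
  interpret T: quantum_trace "\<lambda>c. left_scale (\<iota> c)" q "alg.gen n" "alg.gen_inv n" n "alg.copies n" "block_trace n" "left_scale t 1"
    using t by (rule quantum_trace_block)
  let ?F = "\<lambda>i I J. \<iota> (q ^ (2 * (i - 1))) * t * op_id I J - L_bar type_ring \<iota> R L i I J"
  have factor: "left_scale (\<iota> (q ^ (2 * (i - 1)))) (left_scale t 1) - alg.copies n i
      = block n (\<iota> (q ^ (2 * (i - 1))) * t) (?F i)" for i
    unfolding alg.copies_def
    by (subst block_one[of n, symmetric]) (simp only: left_scale_block block_diff mult_1_right mult.assoc diff_zero)
  have skew: "alg.hecke.skew n n = block n 1 (skew_symmetrizer_over \<iota> q R n)"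
    by (rule alg.skew_block) simp
  have pow: "left_scale t 1 ^ j * y = left_scale (t ^ j) y" for j and y :: "('n, 'a) block_op"
  proof (induction j)
    case 0
    show ?case by (simp, transfer) simp
  next
    case (Suc j)
    have "left_scale t 1 * z = left_scale t z" for z :: "('n, 'a) block_op"
      by (rule entry_inject[THEN iffD1])
        (simp add: left_scale.rep_eq times_block_op.rep_eq one_block_op.rep_eq op_mult_eq op_id_eq
          fun_eq_iff if_distrib[of "\<lambda>x. _ * x"] if_distrib[of "\<lambda>x. x * _"] cong: if_cong)
    moreover have "left_scale t (left_scale (t ^ j) y) = left_scale (t ^ Suc j) y"
      by (rule entry_inject[THEN iffD1]) (simp add: left_scale.rep_eq mult.assoc)
    moreover have "left_scale t 1 ^ Suc j * y = left_scale t 1 * (left_scale t 1 ^ j * y)"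
      by (simp only: power_Suc mult.assoc)
    ultimately show ?case using Suc by simp
  qed
  have tp: "t ^ j * x = x * t ^ j" for j x
    by (induction j) (simp, metis mult.assoc power_Suc t)
  have "block_trace n (alg.hecke.skew n n * upto_prod (\<lambda>i. left_scale (\<iota> (q ^ (2 * (i - 1)))) (left_scale t 1) - alg.copies n i) n)
      = R_trace type_ring \<iota> R n (skew_symmetrizer_over \<iota> q R n \<diamondop> tensor_prod type_ring ?F n)"
    unfolding factor upto_prod_block skew block_mult by (rule block_trace_block)
  moreover have "block_trace n (left_scale (\<iota> c) (left_scale t 1 ^ j * (alg.hecke.skew n n * upto_prod (alg.copies n) k)))
      = \<iota> c * t ^ j * R_trace type_ring \<iota> R n (skew_symmetrizer_over \<iota> q R n \<diamondop> tensor_prod type_ring (L_bar type_ring \<iota> R L) k)"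
    for c j k
    unfolding pow skew alg.copies_def upto_prod_block block_mult
    by (subst block_trace_left_scale, rule hom_central, subst block_trace_left_scale, rule tp) (simp add: block_trace_block mult.assoc)
  ultimately show ?thesis using T.trace_char_prod by simp
qed

text \<open>
  The operator \<open>S\<close> is the identity on the last tensor factor, so tracing over this factor concerns
  only the skew-symmetrizer.
\<close>

lemma R_trace_step:
  assumes "stable_op k S"
  shows "R_trace type_ring \<iota> R (Suc k) (skew_symmetrizer_over \<iota> q R (Suc k) \<diamondop> S)
    = \<iota> ((q ^ k * C_tr - q_number q k) / q_number q (Suc k)) * R_trace type_ring \<iota> R k (skew_symmetrizer_over \<iota> q R k \<diamondop> S)"
proof -
  let ?P = "skew_symmetrizer q R (Suc k)" and ?Q = "skew_symmetrizer q R k"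
  let ?c = "(q ^ k * C_tr - q_number q k) / q_number q (Suc k)"
  have over: "skew_symmetrizer_over \<iota> q R l = map_op (skew_symmetrizer q R l)" for l
    by (simp add: skew_symmetrizer_over_def map_op_def)
  have "R_trace type_ring \<iota> R (Suc k) (map_op ?P \<diamondop> S)
      = (\<Sum>I | length I = Suc k. \<Sum>J | length J = Suc k. \<iota> ((weight (Suc k) \<diamondop> ?P) I J) * S J I)"
    by (simp add: R_trace_eq op_mult_assoc[symmetric] map_op_mult[symmetric] map_op_mult_entry)
  also have "\<dots> = (\<Sum>I | length I = k. \<Sum>a\<in>UNIV. \<Sum>J | length J = k. \<Sum>b\<in>UNIV.
      if b = a then \<iota> ((weight (Suc k) \<diamondop> ?P) (I @ [a]) (J @ [a])) * S J I else 0)"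
    unfolding sum_words_snoc by (intro sum.cong refl) (auto simp: stableD[OF assms])
  also have "\<dots> = (\<Sum>I | length I = k. \<Sum>a\<in>UNIV. \<Sum>J | length J = k.
      \<iota> ((weight (Suc k) \<diamondop> ?P) (I @ [a]) (J @ [a])) * S J I)"
    by simp
  also have "\<dots> = (\<Sum>I | length I = k. \<Sum>J | length J = k. \<Sum>a\<in>UNIV.
      \<iota> ((weight (Suc k) \<diamondop> ?P) (I @ [a]) (J @ [a])) * S J I)"
    by (intro sum.cong refl sum.swap)
  also have "\<dots> = (\<Sum>I | length I = k. \<Sum>J | length J = k. \<iota> (?c * (weight k \<diamondop> ?Q) I J) * S J I)"
  proof (intro sum.cong refl)
    fix I J :: "'n list" assume IJ: "I \<in> {I. length I = k}" "J \<in> {J. length J = k}"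
    have "(\<Sum>a\<in>UNIV. (weight (Suc k) \<diamondop> ?P) (I @ [a]) (J @ [a]))
        = (\<Sum>a\<in>UNIV. \<Sum>K | length K = k. \<Sum>b\<in>UNIV. weight k I K * (C $ a $ b * ?P (K @ [b]) (J @ [a])))"
      using IJ by (simp add: op_mult_eq sum_words_snoc weight_snoc mult.assoc)
    also have "\<dots> = (\<Sum>K | length K = k. \<Sum>a\<in>UNIV. \<Sum>b\<in>UNIV. weight k I K * (C $ a $ b * ?P (K @ [b]) (J @ [a])))"
      by (rule sum.swap)
    also have "\<dots> = (\<Sum>K | length K = k. weight k I K * partial_trace ?P K J)"
      by (simp only: partial_trace_def sum_distrib_left)
    also have "\<dots> = (\<Sum>K | length K = k. weight k I K * (?c * ?Q K J))"
      using IJ by (intro sum.cong refl) (simp add: partial_trace_skew_symmetrizer)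
    also have "\<dots> = ?c * (weight k \<diamondop> ?Q) I J"
      using IJ by (simp add: op_mult_eq sum_distrib_left mult_ac)
    finally show "(\<Sum>a\<in>UNIV. \<iota> ((weight (Suc k) \<diamondop> ?P) (I @ [a]) (J @ [a])) * S J I)
        = \<iota> (?c * (weight k \<diamondop> ?Q) I J) * S J I"
      by (simp only: sum_distrib_right[symmetric] hom_sum[symmetric])
  qed
  also have "\<dots> = \<iota> ?c * (\<Sum>I | length I = k. \<Sum>J | length J = k. \<iota> ((weight k \<diamondop> ?Q) I J) * S J I)"
    by (simp only: hom_mult sum_distrib_left mult.assoc)
  also have "(\<Sum>I | length I = k. \<Sum>J | length J = k. \<iota> ((weight k \<diamondop> ?Q) I J) * S J I) = R_trace type_ring \<iota> R k (map_op ?Q \<diamondop> S)"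
    by (simp add: R_trace_eq op_mult_assoc[symmetric] map_op_mult[symmetric] map_op_mult_entry)
  finally show ?thesis by (simp only: over)
qed

end

text \<open>
  The partial trace links the vanishing and the nonvanishing skew-symmetrizer by a scalar, which
  must be zero.
\<close>

lemma (in skew_hecke) C_tr_even:
  assumes vanish: "\<And>I J. length I = Suc m \<Longrightarrow> length J = Suc m \<Longrightarrow> skew_symmetrizer q R (Suc m) I J = 0"
    and nonzero: "length I = m" "length J = m" "skew_symmetrizer q R m I J \<noteq> 0"
  shows "q ^ m * C_tr = q_number q m"
proof -
  have "partial_trace (skew_symmetrizer q R (Suc m)) I J = 0"
    using nonzero by (simp add: partial_trace_def vanish)
  then show ?thesis
    using partial_trace_skew_symmetrizer[OF nonzero(1,2)] nonzero(3) q_number_nonzero[OF generic, of "Suc m"]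
    by simp
qed

text \<open>Bi-rank \<open>(m|0)\<close> enters the computation only through the value of \<open>Tr C\<close>.\<close>

locale even_matrix = matrix_R_trace q R \<iota> L
  for q and R :: "('k::field, 'n::finite) braid_matrix" and \<iota> :: "'k \<Rightarrow> 'a::ring_1" and L +
  fixes m :: nat
  assumes even: "q ^ m * C_tr = q_number q m"
begin

text \<open>The factor of \<open>R_trace_step\<close> for the value of \<open>Tr C\<close> that belongs to bi-rank \<open>(m|0)\<close>.\<close>

lemma even_factor:
  assumes "k < m"
  shows "q ^ m * ((q ^ k * C_tr - q_number q k) / q_number q (Suc k)) = q_number q (m - k) / q_number q (Suc k)"
proof -
  obtain d where m: "m = k + d" using assms less_imp_add_positive by blast
  have qn: "q - inverse q \<noteq> 0" "q \<noteq> 0"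
    using generic generic_power_neq[OF generic, of 1] by (auto simp: generic_def)
  have "(q ^ k * q_number q m - q ^ m * q_number q k) * (q - inverse q)
      = q ^ k * (q ^ m - inverse q ^ m) - q ^ m * (q ^ k - inverse q ^ k)"
    by (simp only: left_diff_distrib mult.assoc q_number_times[OF generic])
  also have "\<dots> = q ^ m * inverse q ^ k - q ^ k * inverse q ^ m"
    by (simp add: algebra_simps)
  also have "\<dots> = (q ^ k * inverse q ^ k) * q ^ d - (q ^ k * inverse q ^ k) * inverse q ^ d"
    by (simp add: m power_add mult_ac)
  also have "q ^ k * inverse q ^ k = 1" using qn by (simp add: power_inverse)
  also have "1 * q ^ d - 1 * inverse q ^ d = q_number q (m - k) * (q - inverse q)"
    by (simp add: q_number_times[OF generic] m)
  finally have "q ^ k * q_number q m - q ^ m * q_number q k = q_number q (m - k)"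
    using qn by simp
  moreover have "q ^ m * (q ^ k * C_tr - q_number q k) = q ^ k * q_number q m - q ^ m * q_number q k"
    unfolding even[symmetric] by (simp add: algebra_simps)
  ultimately show ?thesis by simp
qed

text \<open>
  The factors of \<open>R_trace_step\<close> multiply to a power of \<open>q\<close> times an inverse Gaussian coefficient; all
  denominators are multiplied out.
\<close>

lemma R_trace_reduce:
  assumes "k + d \<le> m" "stable_op k S"
  shows "\<iota> (q ^ (m * d) * q_fact q (k + d) * q_fact q (m - (k + d))) * R_trace type_ring \<iota> R (k + d) (skew_symmetrizer_over \<iota> q R (k + d) \<diamondop> S)
    = \<iota> (q_fact q k * q_fact q (m - k)) * R_trace type_ring \<iota> R k (skew_symmetrizer_over \<iota> q R k \<diamondop> S)"
  using assms(1)
proof (induction d)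
  case (Suc d)
  let ?j = "k + d" and ?T = "\<lambda>j. R_trace type_ring \<iota> R j (skew_symmetrizer_over \<iota> q R j \<diamondop> S)"
  let ?c = "(q ^ ?j * C_tr - q_number q ?j) / q_number q (Suc ?j)"
  have st: "stable_op ?j S" using assms(2) by (rule stable_mono) simp
  have m: "m - ?j = Suc (m - Suc ?j)" using Suc.prems by simp
  have "q ^ (m * Suc d) * q_fact q (Suc ?j) * q_fact q (m - Suc ?j) * ?c
      = q ^ (m * d) * q_fact q (Suc ?j) * q_fact q (m - Suc ?j) * (q ^ m * ?c)"
    by (simp only: mult_Suc_right power_add mult_ac)
  also have "\<dots> = q ^ (m * d) * q_fact q ?j * q_fact q (m - ?j)"
    unfolding even_factor[of ?j, OF Suc_le_lessD[OF Suc.prems[unfolded add_Suc_right]]]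
    using q_number_nonzero[OF generic, of "Suc ?j"] by (simp add: m q_fact_Suc)
  finally have c: "q ^ (m * Suc d) * q_fact q (Suc ?j) * q_fact q (m - Suc ?j) * ?c = \<dots>" .
  have "\<iota> (q ^ (m * Suc d) * q_fact q (k + Suc d) * q_fact q (m - (k + Suc d))) * ?T (k + Suc d)
      = \<iota> (q ^ (m * Suc d) * q_fact q (Suc ?j) * q_fact q (m - Suc ?j) * ?c) * ?T ?j"
    unfolding add_Suc_right R_trace_step[OF st] by (simp only: hom_mult mult.assoc)
  also have "\<dots> = \<iota> (q_fact q k * q_fact q (m - k)) * ?T k"
    unfolding c using Suc by simp
  finally show ?case .
qed simp

text \<open>The general formula also covers \<open>k = 0\<close>, where the trace over the empty word is \<open>1\<close>.\<close>

lemma elem_sym_eq: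
  "elem_sym type_ring \<iota> q R L k
    = R_trace type_ring \<iota> R k (skew_symmetrizer_over \<iota> q R k \<diamondop> tensor_prod type_ring (L_bar type_ring \<iota> R L) k)"
proof (cases k)
  case 0
  have "{I :: 'n list. length I = 0} = {[]}" by auto
  then show ?thesis using 0
    by (simp add: elem_sym_def R_trace_def tensor_trace_def finsum_type_ring skew_symmetrizer_over_def
        op_mult_eq op_id_eq hom_one)
qed (simp add: elem_sym_def)

text \<open>
  Expansion yields \<open>gauss_coeff q m k\<close>, reduction to \<open>k\<close> tensor factors the inverse Gaussian coefficient;
  the powers of \<open>q\<close> combine to \<open>q ^ m * q ^ ((m - k) * (m - 1)) = q ^ k * q ^ (m * (m - k))\<close>.
\<close>

theorem char_poly_identity:
  assumes t: "\<And>x. t * x = x * t"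
  shows "(\<Sum>k\<in>{0..m}. t ^ (m - k) * \<iota> ((- q) ^ k) * elem_sym type_ring \<iota> q R L k) =
    \<iota> (q ^ m) * R_trace type_ring \<iota> R m (skew_symmetrizer_over \<iota> q R m \<diamondop>
      tensor_prod type_ring (\<lambda>i I J. \<iota> (q ^ (2 * (i - 1))) * t * op_id I J - L_bar type_ring \<iota> R L i I J) m)"
proof -
  let ?T = "\<lambda>j k. R_trace type_ring \<iota> R j (skew_symmetrizer_over \<iota> q R j \<diamondop> tensor_prod type_ring (L_bar type_ring \<iota> R L) k)"
  have tp: "t ^ j * x = x * t ^ j" for j x
    by (induction j) (simp, metis mult.assoc power_Suc t)
  have q0: "q \<noteq> 0" using generic by (simp add: generic_def)
  have summand: "\<iota> (q ^ m) * (\<iota> ((- 1) ^ k * gauss_coeff q m k) * t ^ (m - k) * ?T m k) = t ^ (m - k) * \<iota> ((- q) ^ k) * ?T k k"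
    if "k \<le> m" for k
  proof -
    let ?u = "q_fact q k * q_fact q (m - k)" and ?v = "q ^ (m * (m - k)) * q_fact q m"
    have u: "?u \<noteq> 0" and v: "?v \<noteq> 0" using q_fact_nonzero[OF generic] q0 by auto
    have "\<iota> ?v * ?T m k = \<iota> ?u * ?T k k"
      using R_trace_reduce[OF _ stable_L_bar_prod, of k "m - k"] that by simp
    then have T: "?T m k = \<iota> (?u / ?v) * ?T k k"
      using v by (rule hom_solve)
    have "q ^ m * ((- 1) ^ k * gauss_coeff q m k) * (?u / ?v) = (- 1) ^ k * q ^ m * (gauss_coeff q m k * ?u) / ?v"
      by simp
    also have "\<dots> = (- 1) ^ k * (q ^ m * q ^ ((m - k) * (m - 1)) / q ^ (m * (m - k)))"
      unfolding gauss_coeff_q_fact[OF generic that] using q_fact_nonzero[OF generic, of m] by simp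
    also have "q ^ m * q ^ ((m - k) * (m - 1)) = q ^ k * q ^ (m * (m - k))"
    proof -
      obtain d where d: "m = k + d" using \<open>k \<le> m\<close> le_Suc_ex by blast
      have "m + d * (m - 1) = k + m * d"
      proof (cases m)
        case (Suc p)
        then have "k + d = Suc p" using d by simp
        then show ?thesis by (simp add: Suc mult.commute)
      qed (use d in simp)
      moreover have "m - k = d" using d by simp
      ultimately show ?thesis by (simp only: power_add[symmetric])
    qed
    also have "(- 1) ^ k * (q ^ k * q ^ (m * (m - k)) / q ^ (m * (m - k))) = (- q) ^ k"
      using q0 by (simp add: power_minus[of q])
    finally have coeff: "q ^ m * ((- 1) ^ k * gauss_coeff q m k) * (?u / ?v) = (- q) ^ k" .
    have "\<iota> (q ^ m) * (\<iota> ((- 1) ^ k * gauss_coeff q m k) * t ^ (m - k) * ?T m k)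
        = t ^ (m - k) * (\<iota> (q ^ m) * \<iota> ((- 1) ^ k * gauss_coeff q m k) * \<iota> (?u / ?v) * ?T k k)"
      unfolding T by (simp only: tp mult.assoc)
    also have "\<dots> = t ^ (m - k) * \<iota> ((- q) ^ k) * ?T k k"
      unfolding hom_mult[symmetric] coeff by (rule mult.assoc[symmetric])
    finally show ?thesis .
  qed
  show ?thesis
    unfolding R_trace_char_prod[OF t] elem_sym_eq sum_distrib_left
    by (simp add: atLeast0AtMost summand cong: sum.cong_simp)
qed

end

section \<open>Ideals of the free algebra\<close>

lemma ideal_type_ring_iff:
  fixes I :: "'a::ring_1 set"
  shows "ideal I type_ring \<longleftrightarrow>
    0 \<in> I \<and> (\<forall>a\<in>I. \<forall>b\<in>I. a + b \<in> I) \<and> (\<forall>x. \<forall>a\<in>I. x * a \<in> I \<and> a * x \<in> I)" (is "_ \<longleftrightarrow> ?R")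
proof
  interpret ring "type_ring :: 'a ring" by (rule ring_type_ring)
  assume "ideal I type_ring"
  then interpret ideal I "type_ring :: 'a ring" .
  show ?R using I_l_closed I_r_closed a_closed zero_closed by simp
next
  assume R: ?R
  interpret ring "type_ring :: 'a ring" by (rule ring_type_ring)
  have inv: "inv\<^bsub>add_monoid (type_ring :: 'a ring)\<^esub> a = - a" for a
  proof -
    have "\<ominus>\<^bsub>type_ring\<^esub> a + a = 0" using l_neg[of a] by simp
    then show ?thesis by (simp add: a_inv_def eq_neg_iff_add_eq_0)
  qed
  show "ideal I type_ring"
  proof (rule idealI[OF ring_type_ring])
    show "subgroup I (add_monoid type_ring)"
    proof
      show "inv\<^bsub>add_monoid type_ring\<^esub> a \<in> I" if "a \<in> I" for a
        using R that unfolding inv by (metis mult_minus1)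
    qed (use R in auto)
  qed (use R in auto)
qed

lemma ideal_genideal: "ideal (Idl\<^bsub>type_ring\<^esub> (S :: 'a::ring_1 set)) type_ring"
  by (rule ring.genideal_ideal[OF ring_type_ring]) simp

text \<open>The basis vector of the tensor algebra that belongs to a list of indices.\<close>

definition word :: "'x list \<Rightarrow> ('x, 'k::ring_1) free_algebra" where
  "word w = Poly_Mapping.single (Word w) 1"

lemma single_word_mult:
  "Poly_Mapping.single (Word u) a * Poly_Mapping.single (Word v) b = Poly_Mapping.single (Word (u @ v)) (a * b)"
  by (simp add: mult_single)

lemma word_mult: "word u * word v = word (u @ v)"
  by (simp add: word_def single_word_mult)

lemma free_const_word: "free_const c * word w = Poly_Mapping.single (Word w) c"
  by (simp add: free_const_def word_def zero_free_word_def single_word_mult)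

lemma free_gen_word: "free_gen x = word [x]"
  by (simp add: free_gen_def word_def)

lemma poly_mapping_sum_singles: "p = (\<Sum>k\<in>Poly_Mapping.keys p. Poly_Mapping.single k (Poly_Mapping.lookup p k))"
proof (rule poly_mapping_eqI)
  fix i
  have "Poly_Mapping.lookup (\<Sum>k\<in>Poly_Mapping.keys p. Poly_Mapping.single k (Poly_Mapping.lookup p k)) i
      = (\<Sum>k\<in>Poly_Mapping.keys p. if k = i then Poly_Mapping.lookup p i else 0)"
    by (simp add: lookup_sum lookup_single when_def cong: if_cong)
  then show "Poly_Mapping.lookup p i = Poly_Mapping.lookup (\<Sum>k\<in>Poly_Mapping.keys p. Poly_Mapping.single k (Poly_Mapping.lookup p k)) i"
    by (simp add: in_keys_iff)
qed

lemma poly_mapping_additive_induct [case_names single sum]: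
  fixes p :: "'i \<Rightarrow>\<^sub>0 'a::comm_monoid_add"
  assumes single: "\<And>w c. P (Poly_Mapping.single w c)" and sum: "\<And>p q. P p \<Longrightarrow> P q \<Longrightarrow> P (p + q)"
  shows "P p"
proof -
  have P0: "P 0" using single[of _ 0] by simp
  have "P (\<Sum>k\<in>S. Poly_Mapping.single k (Poly_Mapping.lookup p k))" for S
    by (induction S rule: infinite_finite_induct) (simp_all add: P0 single sum)
  then show ?thesis using poly_mapping_sum_singles[of p] by metis
qed

lemma free_algebra_induct [case_names single sum]:
  fixes p :: "('x, 'k::ring_1) free_algebra"
  assumes single: "\<And>w c. P (Poly_Mapping.single (Word w) c)"
    and sum: "\<And>p q. P p \<Longrightarrow> P q \<Longrightarrow> P (p + q)"
  shows "P p"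
proof (induction p rule: poly_mapping_additive_induct)
  case (single w c)
  then show ?case using assms(1) by (cases w) simp
qed (rule sum)

interpretation free_hom: central_hom "free_const :: 'k::field \<Rightarrow> ('x, 'k) free_algebra"
proof
  fix a b :: 'k and x :: "('x, 'k) free_algebra"
  show "free_const 1 = (1 :: ('x, 'k) free_algebra)" by (simp add: free_const_def)
  show "free_const (a + b) = (free_const a + free_const b :: ('x, 'k) free_algebra)" by (simp add: free_const_def single_add)
  show "free_const (a * b) = (free_const a * free_const b :: ('x, 'k) free_algebra)" by (simp add: free_const_def mult_single)
  show "free_const a * x = x * free_const a"
    by (induction x rule: free_algebra_induct)
      (simp_all add: free_const_def zero_free_word_def single_word_mult mult.commute distrib_left distrib_right)
qed

context skew_hecke
begin

section \<open>The exterior algebra and the skew-symmetrizers\<close>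

abbreviation relation_ideal :: "('n, 'k) free_algebra set" where
  "relation_ideal \<equiv> exterior_ideal q R"

lemma relation_ideal: "ideal relation_ideal type_ring"
  unfolding exterior_ideal_def by (rule ideal_genideal)

lemmas relation_ideal_closed = relation_ideal[unfolded ideal_type_ring_iff]

lemma relation_ideal_zero: "0 \<in> relation_ideal"
  and relation_ideal_add: "a \<in> relation_ideal \<Longrightarrow> b \<in> relation_ideal \<Longrightarrow> a + b \<in> relation_ideal"
  and relation_ideal_mult: "a \<in> relation_ideal \<Longrightarrow> x * a \<in> relation_ideal" "a \<in> relation_ideal \<Longrightarrow> a * x \<in> relation_ideal"
  using relation_ideal_closed by auto

lemma relation_ideal_sum: "(\<And>i. i \<in> S \<Longrightarrow> f i \<in> relation_ideal) \<Longrightarrow> (\<Sum>i\<in>S. f i) \<in> relation_ideal"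
  by (induction S rule: infinite_finite_induct) (auto intro: relation_ideal_zero relation_ideal_add)

lemma tensor2_words: "tensor2 v = (\<Sum>i\<in>UNIV. \<Sum>j\<in>UNIV. Poly_Mapping.single (Word [i, j]) (v $ (i, j)))"
  by (simp add: tensor2_def free_gen_word word_mult free_const_word)

lemma generator_in_relation_ideal: "tensor2 (v v* (mat (inverse q) + R)) \<in> relation_ideal"
  unfolding exterior_ideal_def
  using ring.genideal_self[OF ring_type_ring, of "range (\<lambda>v. tensor2 (v v* (mat (inverse q) + R)))"] by auto

lemma skew_symmetrizer_absorb:
  assumes "1 \<le> i" "i < k" "length I = k" "length J = k"
  shows "(at_pos2 type_ring i R \<diamondop> skew_symmetrizer q R k) I J = - inverse q * skew_symmetrizer q R k I J"
proof -
  have "field.gen k i * field.hecke.skew k k = left_scale (- inverse q) (field.hecke.skew k k)"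
    using field.hecke.skew_eigen(2)[of k k i] assms by simp
  then have "entry (block k (- inverse q * 1) (at_pos2 type_ring i R \<diamondop> skew_symmetrizer_over (\<lambda>x. x) q R k)) I J
      = entry (block k (- inverse q * 1) (\<lambda>I J. - inverse q * skew_symmetrizer_over (\<lambda>x. x) q R k I J)) I J"
    by (simp only: field.skew_block order_refl field.gen_def block_mult left_scale_block map_matrix_id)
  then show ?thesis using assms by (simp add: entry_block skew_symmetrizer_over_def)
qed

text \<open>
  The relations of the exterior algebra, placed between two words, are killed by the skew-symmetrizer
  since \<open>R\<^sub>i\<close> acts on it as \<open>- inverse q\<close>.
\<close>

lemma generator_skew_symmetrizer:
  assumes "length U + 2 + length V = k" "length J = k"
  shows "(\<Sum>c\<in>UNIV. \<Sum>d\<in>UNIV. (mat (inverse q) + R) $ (a, b) $ (c, d) * skew_symmetrizer q R k (U @ [c, d] @ V) J) = 0"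
proof -
  let ?P = "skew_symmetrizer q R k" and ?i = "Suc (length U)"
  have len: "length (U @ [a, b] @ V) = k" using assms by simp
  have "(at_pos2 type_ring ?i R \<diamondop> ?P) (U @ [a, b] @ V) J = (local_op (length U) 2 (at_pos2 type_ring 1 R) \<diamondop> ?P) (U @ [a, b] @ V) J"
    using at_pos2_local[of 1 2 "length U" _ R] assms by (intro op_mult_cong) auto
  also have "\<dots> = (\<Sum>c\<in>UNIV. \<Sum>d\<in>UNIV. R $ (a, b) $ (c, d) * ?P (U @ [c, d] @ V) J)"
    using local_op_mult_left[of U "length U" "[a, b]" 2 "at_pos2 type_ring 1 R" ?P V J]
    by (simp add: sum_words_two at_pos2_one_entries)
  finally have R: "(\<Sum>c\<in>UNIV. \<Sum>d\<in>UNIV. R $ (a, b) $ (c, d) * ?P (U @ [c, d] @ V) J) = - inverse q * ?P (U @ [a, b] @ V) J"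
    using skew_symmetrizer_absorb[of ?i k "U @ [a, b] @ V" J] assms by simp
  have "(\<Sum>c\<in>UNIV. \<Sum>d\<in>UNIV. mat (inverse q) $ (a, b) $ (c, d) * ?P (U @ [c, d] @ V) J)
      = (\<Sum>c\<in>UNIV. \<Sum>d\<in>UNIV. if d = b then (if c = a then inverse q * ?P (U @ [a, b] @ V) J else 0) else 0)"
    by (intro sum.cong refl) (auto simp: mat_def)
  then have "(\<Sum>c\<in>UNIV. \<Sum>d\<in>UNIV. mat (inverse q) $ (a, b) $ (c, d) * ?P (U @ [c, d] @ V) J) = inverse q * ?P (U @ [a, b] @ V) J"
    by simp
  with R show ?thesis by (simp add: distrib_right sum.distrib)
qed

text \<open>A coordinate of the image of a tensor of degree \<open>k\<close> under the skew-symmetrizer.\<close>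

definition skew_functional :: "nat \<Rightarrow> 'n list \<Rightarrow> ('n, 'k) free_algebra \<Rightarrow> 'k" where
  "skew_functional k J p = (\<Sum>I | length I = k. Poly_Mapping.lookup p (Word I) * skew_symmetrizer q R k I J)"

lemma skew_functional_add: "skew_functional k J (p + p') = skew_functional k J p + skew_functional k J p'"
  by (simp add: skew_functional_def lookup_add distrib_right sum.distrib)

lemma skew_functional_zero: "skew_functional k J 0 = 0"
  by (simp add: skew_functional_def)

lemma skew_functional_sum: "skew_functional k J (\<Sum>i\<in>S. f i) = (\<Sum>i\<in>S. skew_functional k J (f i))"
  by (induction S rule: infinite_finite_induct) (simp_all add: skew_functional_add skew_functional_zero)

lemma skew_functional_single:
  "skew_functional k J (Poly_Mapping.single (Word I) c) = (if length I = k then c * skew_symmetrizer q R k I J else 0)"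
proof -
  have "skew_functional k J (Poly_Mapping.single (Word I) c)
      = (\<Sum>K | length K = k. if K = I then c * skew_symmetrizer q R k I J else 0)"
    unfolding skew_functional_def by (intro sum.cong refl) (auto simp: lookup_single when_def)
  then show ?thesis by simp
qed

lemma skew_functional_generator:
  assumes "length J = k"
  shows "skew_functional k J (x * tensor2 (v v* (mat (inverse q) + R)) * y) = 0"
proof (induction x rule: free_algebra_induct)
  case (single U \<alpha>)
  show ?case
  proof (induction y rule: free_algebra_induct)
    case (single V \<beta>)
    let ?M = "mat (inverse q) + R" and ?P = "skew_symmetrizer q R k"
    have "skew_functional k J (Poly_Mapping.single (Word U) \<alpha> * tensor2 (v v* ?M) * Poly_Mapping.single (Word V) \<beta>)
        = (\<Sum>c\<in>UNIV. \<Sum>d\<in>UNIV. if length U + 2 + length V = k then \<alpha> * (v v* ?M) $ (c, d) * \<beta> * ?P (U @ [c, d] @ V) J else 0)"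
      by (simp add: tensor2_words sum_distrib_left sum_distrib_right single_word_mult skew_functional_sum skew_functional_single
          cong: if_cong)
    also have "\<dots> = 0"
    proof (cases "length U + 2 + length V = k")
      case True
      have "(\<Sum>c\<in>UNIV. \<Sum>d\<in>UNIV. \<alpha> * (v v* ?M) $ (c, d) * \<beta> * ?P (U @ [c, d] @ V) J)
          = (\<Sum>c\<in>UNIV. \<Sum>d\<in>UNIV. \<Sum>x\<in>UNIV. \<alpha> * \<beta> * v $ x * (?M $ x $ (c, d) * ?P (U @ [c, d] @ V) J))"
        unfolding vector_matrix_mult_def by (simp only: vec_lambda_beta sum_distrib_left sum_distrib_right) (simp only: mult_ac)
      also have "\<dots> = (\<Sum>x\<in>UNIV. \<Sum>c\<in>UNIV. \<Sum>d\<in>UNIV. \<alpha> * \<beta> * v $ x * (?M $ x $ (c, d) * ?P (U @ [c, d] @ V) J))"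
        by (rule sum_rotate3)
      also have "\<dots> = (\<Sum>x\<in>UNIV. \<alpha> * \<beta> * v $ x * (\<Sum>c\<in>UNIV. \<Sum>d\<in>UNIV. ?M $ x $ (c, d) * ?P (U @ [c, d] @ V) J))"
        by (simp only: sum_distrib_left)
      also have "\<dots> = 0"
      proof (rule sum.neutral, rule ballI)
        fix x :: "'n \<times> 'n"
        show "\<alpha> * \<beta> * v $ x * (\<Sum>c\<in>UNIV. \<Sum>d\<in>UNIV. ?M $ x $ (c, d) * ?P (U @ [c, d] @ V) J) = 0"
          using generator_skew_symmetrizer[OF True assms, of "fst x" "snd x"] by simp
      qed
      finally show ?thesis using True by simp
    qed simp
    finally show ?case .
  qed (simp add: distrib_left skew_functional_add)
qed (simp add: distrib_right skew_functional_add)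

text \<open>
  The elements all of whose two-sided multiples are killed form an ideal, and this ideal contains the
  generators.
\<close>

lemma skew_functional_relation_ideal:
  assumes "length J = k" "p \<in> relation_ideal"
  shows "skew_functional k J p = 0"
proof -
  define N where "N = {p. \<forall>x y. skew_functional k J (x * p * y) = 0}"
  have "ideal N type_ring"
    unfolding ideal_type_ring_iff N_def
  proof (intro conjI ballI allI)
    fix x p assume p: "p \<in> {p. \<forall>x y. skew_functional k J (x * p * y) = 0}"
    have "skew_functional k J (a * (x * p) * b) = skew_functional k J ((a * x) * p * b)"
      "skew_functional k J (a * (p * x) * b) = skew_functional k J (a * p * (x * b))" for a b
      by (simp_all only: mult.assoc)
    then show "x * p \<in> {p. \<forall>x y. skew_functional k J (x * p * y) = 0}"
      "p * x \<in> {p. \<forall>x y. skew_functional k J (x * p * y) = 0}"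
      using p by auto
  qed (auto simp: distrib_left distrib_right skew_functional_add skew_functional_zero)
  moreover have "range (\<lambda>v. tensor2 (v v* (mat (inverse q) + R))) \<subseteq> N"
    unfolding N_def using skew_functional_generator[OF assms(1)] by auto
  ultimately have "relation_ideal \<subseteq> N"
    unfolding exterior_ideal_def by (rule ring.genideal_minimal[OF ring_type_ring])
  then have "skew_functional k J (1 * p * 1) = 0" using assms(2) unfolding N_def by blast
  then show ?thesis by simp
qed

text \<open>
  One half of the comparison of exterior algebra and skew-symmetrizer: if a component of the
  exterior algebra vanishes, so does the skew-symmetrizer.
\<close>

lemma word_in_relation_ideal:
  assumes "length I = k" "length J = k" "word I \<in> relation_ideal"
  shows "skew_symmetrizer q R k I J = 0"
  using skew_functional_relation_ideal[OF assms(2,3)] assms(1) by (simp add: word_def skew_functional_single)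

text \<open>
  The words as a column vector over the tensor algebra itself; the product with an operator \<open>S\<close> then
  lists the images of all words under \<open>S\<close>.
\<close>

definition words_column :: "('n, ('n, 'k) free_algebra) tensor_op" where
  "words_column = (\<lambda>K _. word K)"

text \<open>Modulo the relations, \<open>S\<close> multiplies all tensors of degree \<open>n\<close> by \<open>c\<close>.\<close>

definition acts_as :: "nat \<Rightarrow> 'k \<Rightarrow> ('n, 'k) tensor_op \<Rightarrow> bool" where
  "acts_as n c S \<longleftrightarrow> (\<forall>I. length I = n \<longrightarrow>
     (free_hom.map_op S \<diamondop> words_column) I [] - free_const c * word I \<in> relation_ideal)"

lemma acts_as_id: "acts_as n 1 op_id"
  by (simp add: acts_as_def free_hom.map_op_id op_id_mult words_column_def free_hom.hom_one relation_ideal_zero)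

lemma acts_as_mult:
  assumes "acts_as n c S" "acts_as n d T"
  shows "acts_as n (c * d) (S \<diamondop> T)"
  unfolding acts_as_def
proof (intro allI impI)
  fix I :: "'n list" assume I: "length I = n"
  let ?S = "free_hom.map_op S" and ?T = "free_hom.map_op T"
  have "(free_hom.map_op (S \<diamondop> T) \<diamondop> words_column) I [] - free_const (c * d) * word I
      = (\<Sum>K | length K = n. ?S I K * ((?T \<diamondop> words_column) K [] - free_const d * word K))
        + free_const d * ((?S \<diamondop> words_column) I [] - free_const c * word I)"
  proof -
    have "(\<Sum>K | length K = n. ?S I K * (free_const d * word K)) = free_const d * (?S \<diamondop> words_column) I []"
      unfolding op_mult_eq sum_distrib_left I words_column_def
      by (intro sum.cong refl) (metis free_hom.hom_central mult.assoc)
    moreover have "(free_hom.map_op (S \<diamondop> T) \<diamondop> words_column) I [] = (\<Sum>K | length K = n. ?S I K * (?T \<diamondop> words_column) K [])"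
      unfolding free_hom.map_op_mult op_mult_assoc by (subst op_mult_eq) (simp add: I)
    moreover have "free_const (c * d) * word I = free_const d * (free_const c * word I)"
      by (simp add: free_hom.hom_mult[symmetric] mult.assoc[symmetric] mult.commute)
    ultimately show ?thesis by (simp add: right_diff_distrib sum_subtractf)
  qed
  also have "\<dots> \<in> relation_ideal"
    using assms I unfolding acts_as_def
    by (intro relation_ideal_add relation_ideal_sum relation_ideal_mult) auto
  finally show "(free_hom.map_op (S \<diamondop> T) \<diamondop> words_column) I [] - free_const (c * d) * word I \<in> relation_ideal" .
qed

lemma acts_as_linear:
  assumes "acts_as n c S" "acts_as n d T"
  shows "acts_as n (a * c - b * d) (\<lambda>I J. a * S I J - b * T I J)"
  unfolding acts_as_def
proof (intro allI impI)
  fix I :: "'n list" assume I: "length I = n"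
  have "(free_hom.map_op (\<lambda>I J. a * S I J - b * T I J) \<diamondop> words_column) I [] - free_const (a * c - b * d) * word I
    = free_const a * ((free_hom.map_op S \<diamondop> words_column) I [] - free_const c * word I)
      + free_const (- b) * ((free_hom.map_op T \<diamondop> words_column) I [] - free_const d * word I)"
    by (simp add: op_mult_eq free_hom.map_op_def free_hom.hom_diff free_hom.hom_mult free_hom.hom_minus
        sum_subtractf sum_negf sum_distrib_left left_diff_distrib right_diff_distrib mult.assoc)
  also have "\<dots> \<in> relation_ideal"
    using assms I unfolding acts_as_def by (intro relation_ideal_add relation_ideal_mult) auto
  finally show "(free_hom.map_op (\<lambda>I J. a * S I J - b * T I J) \<diamondop> words_column) I [] - free_const (a * c - b * d) * word I \<in> relation_ideal" .
qed

lemma acts_as_R: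
  assumes "1 \<le> i" "i < n"
  shows "acts_as n (- inverse q) (at_pos2 type_ring i R)"
  unfolding acts_as_def
proof (intro allI impI)
  fix I :: "'n list" assume I: "length I = n"
  have len: "i - 1 + 2 \<le> length I" using assms I by simp
  obtain U B V where "I = U @ B @ V" "length U = i - 1" "length B = 2"
    using len by (rule word_split)
  then obtain a b where split: "I = U @ [a, b] @ V" "length U = i - 1"
    by (auto simp: numeral_2_eq_2 length_Suc_conv)
  let ?F = "map_matrix (free_const :: _ \<Rightarrow> ('n, 'k) free_algebra) R"
  have "(free_hom.map_op (at_pos2 type_ring i R) \<diamondop> words_column) I []
      = (local_op (i - 1) 2 (at_pos2 type_ring 1 ?F) \<diamondop> words_column) I []"
    unfolding free_hom.map_op_at_pos2[symmetric]
    using at_pos2_local[of 1 2 "i - 1" _ ?F] assms I by (intro op_mult_cong) (auto simp: numeral_2_eq_2)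
  also have "\<dots> = (\<Sum>c\<in>UNIV. \<Sum>d\<in>UNIV. free_const (R $ (a, b) $ (c, d)) * word (U @ [c, d] @ V))"
    unfolding split(1) using local_op_mult_left[of U "i - 1" "[a, b]" 2 "at_pos2 type_ring 1 ?F" words_column V "[]"] split(2)
    by (simp add: sum_words_two at_pos2_one_entries words_column_def map_matrix_def)
  also have "\<dots> - free_const (- inverse q) * word I = word U * tensor2 (axis (a, b) 1 v* (mat (inverse q) + R)) * word V"
  proof -
    have "axis (a, b) 1 v* M = M $ (a, b)" for M :: "('k, 'n) braid_matrix"
      by (simp add: vec_eq_iff vector_matrix_mult_def axis_def if_distrib[of "\<lambda>x. _ * x"] if_distrib[of "\<lambda>x. x * _"] cong: if_cong)
    then have "word U * tensor2 (axis (a, b) 1 v* (mat (inverse q) + R)) * word V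
        = (\<Sum>c\<in>UNIV. \<Sum>d\<in>UNIV. Poly_Mapping.single (Word (U @ [c, d] @ V)) ((mat (inverse q) + R) $ (a, b) $ (c, d)))"
      by (simp add: tensor2_words word_def sum_distrib_left sum_distrib_right single_word_mult)
    also have "\<dots> = (\<Sum>c\<in>UNIV. \<Sum>d\<in>UNIV. Poly_Mapping.single (Word (U @ [c, d] @ V)) (R $ (a, b) $ (c, d)))
        + (\<Sum>c\<in>UNIV. \<Sum>d\<in>UNIV. if d = b then (if c = a then Poly_Mapping.single (Word I) (inverse q) else 0) else 0)"
      unfolding sum.distrib[symmetric] split(1) by (intro sum.cong refl) (auto simp: mat_def single_add[symmetric] add.commute)
    also have "\<dots> = (\<Sum>c\<in>UNIV. \<Sum>d\<in>UNIV. free_const (R $ (a, b) $ (c, d)) * word (U @ [c, d] @ V)) - free_const (- inverse q) * word I"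
      by (simp add: free_const_word single_uminus)
    finally show ?thesis by simp
  qed
  also have "\<dots> \<in> relation_ideal"
    by (intro relation_ideal_mult generator_in_relation_ideal)
  finally show "(free_hom.map_op (at_pos2 type_ring i R) \<diamondop> words_column) I [] - free_const (- inverse q) * word I \<in> relation_ideal" .
qed

text \<open>In the exterior algebra every \<open>R\<^sub>i\<close> is \<open>- inverse q\<close>, and on this character skew-symmetrizers are \<open>1\<close>.\<close>

lemma acts_as_skew_symmetrizer:
  assumes "k \<le> n"
  shows "acts_as n 1 (skew_symmetrizer q R k)"
  using assms
proof (induction k rule: induct_nat_012)
  case (ge2 k)
  let ?N = "q_number q (Suc (Suc k))" and ?P = "skew_symmetrizer q R (Suc k)"
  let ?A = "\<lambda>I J. q ^ Suc k * op_id I J - q_number q (Suc k) * at_pos2 type_ring (Suc k) R I J"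
  have "acts_as n (q ^ Suc k * 1 - q_number q (Suc k) * - inverse q) ?A"
    using ge2 by (intro acts_as_linear acts_as_id acts_as_R) auto
  also have "q ^ Suc k * 1 - q_number q (Suc k) * - inverse q = ?N"
    using q_number_Suc(1)[OF generic, of "Suc k"] by (simp add: mult.commute)
  finally have "acts_as n (1 * ?N * 1) (?P \<diamondop> ?A \<diamondop> ?P)"
    using ge2 by (intro acts_as_mult) auto
  then have "acts_as n (1 / ?N * (1 * ?N * 1) - 0 * 1) (\<lambda>I J. 1 / ?N * (?P \<diamondop> ?A \<diamondop> ?P) I J - 0 * op_id I J)"
    by (intro acts_as_linear acts_as_id)
  then show ?case
    using q_number_nonzero[OF generic, of "Suc (Suc k)"] by (simp add: Let_def)
qed (simp_all add: acts_as_id)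

text \<open>
  The other half: the skew-symmetrizer acts as \<open>1\<close> on the exterior algebra, so if it vanishes, all
  words are zero there.
\<close>

lemma skew_symmetrizer_zero_imp_word:
  assumes "\<And>I J. length I = k \<Longrightarrow> length J = k \<Longrightarrow> skew_symmetrizer q R k I J = 0" "length I = k"
  shows "word I \<in> relation_ideal"
proof -
  have "(free_hom.map_op (skew_symmetrizer q R k) \<diamondop> words_column) I [] = 0"
    using assms by (simp add: op_mult_eq free_hom.map_op_def free_hom.hom_zero)
  moreover have "(free_hom.map_op (skew_symmetrizer q R k) \<diamondop> words_column) I [] - free_const 1 * word I \<in> relation_ideal"
    using acts_as_skew_symmetrizer[of k k] assms(2) unfolding acts_as_def by blast
  ultimately have "- word I \<in> relation_ideal" by (simp add: free_hom.hom_one)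
  then show ?thesis using relation_ideal_mult(1)[of "- word I" "-1"] by simp
qed

end

section \<open>The bi-rank and the trace of the weight matrix\<close>

text \<open>The denominator is a nonzero constant, so the series is a polynomial of degree \<open>m\<close>.\<close>

lemma bi_rank_dims:
  assumes "has_bi_rank q R m 0" "m \<ge> 1"
  shows "exterior_dim q R m \<noteq> 0" "exterior_dim q R (Suc m) = 0"
proof -
  obtain a b :: "rat poly" where ab: "b \<noteq> 0" "degree a = m" "degree b = 0"
    and eq: "fps_of_poly b * exterior_series q R = fps_of_poly a"
    using assms(1) unfolding has_bi_rank_def by blast
  obtain c where b: "b = [:c:]" using ab(3) by (rule degree_eq_zeroE)
  have c: "c \<noteq> 0" using ab(1) b by simp
  have const: "fps_of_poly b = fps_const c" by (simp add: b fps_of_poly_const)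
  have coeffs: "c * of_nat (exterior_dim q R k) = coeff a k" for k
    using arg_cong[OF eq[unfolded const], of "\<lambda>f. fps_nth f k"] by (simp add: exterior_series_def)
  have "coeff a m \<noteq> 0" using ab(2) assms(2) by (metis degree_0 leading_coeff_0_iff not_one_le_zero)
  then show "exterior_dim q R m \<noteq> 0" using coeffs[of m] by (metis mult_zero_right of_nat_0)
  have "coeff a (Suc m) = 0" using ab(2) by (simp add: coeff_eq_0)
  then show "exterior_dim q R (Suc m) = 0" using coeffs[of "Suc m"] c by simp
qed

lemma coset_eq_iff:
  fixes I :: "'a::ring_1 set"
  assumes "ideal I type_ring"
  shows "I +>\<^bsub>type_ring\<^esub> a = I +>\<^bsub>type_ring\<^esub> b \<longleftrightarrow> a - b \<in> I"
  using ring.quotient_eq_iff_same_a_r_cos[OF ring_type_ring assms, of a b] by (simp add: minus_type_ring)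

context skew_hecke
begin

abbreviation coset :: "('n, 'k) free_algebra \<Rightarrow> ('n, 'k) free_algebra set" where
  "coset p \<equiv> relation_ideal +>\<^bsub>type_ring\<^esub> p"

lemma coset_hom: "ring_hom_ring type_ring (exterior_algebra q R) coset"
  unfolding exterior_algebra_def by (rule ideal.rcos_ring_hom_ring[OF relation_ideal])

lemma exterior_zero: "\<zero>\<^bsub>exterior_algebra q R\<^esub> = coset 0"
proof -
  interpret ring_hom_ring type_ring "exterior_algebra q R" coset by (rule coset_hom)
  show ?thesis using hom_zero by simp
qed

lemma coset_eq_zero_iff: "coset p = \<zero>\<^bsub>exterior_algebra q R\<^esub> \<longleftrightarrow> p \<in> relation_ideal"
  by (simp add: exterior_zero coset_eq_iff[OF relation_ideal])

text \<open>
  The scalars form a field in the exterior algebra as long as \<open>1 \<noteq> 0\<close> there, which holds because the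
  skew-symmetrizer of degree 0 is not zero.
\<close>

lemma exterior_scalars_subfield: "subfield (exterior_scalars q R) (exterior_algebra q R)"
proof -
  interpret h: ring_hom_ring type_ring "exterior_algebra q R" coset by (rule coset_hom)
  have const: "ring_hom_ring (type_ring :: 'k ring) type_ring (free_const :: 'k \<Rightarrow> ('n, 'k) free_algebra)"
    by (intro ring_hom_ringI2 ring_type_ring ring_hom_memI)
      (simp_all add: free_hom.hom_add free_hom.hom_mult free_hom.hom_one)
  interpret c: ring_hom_ring "type_ring :: 'k ring" "exterior_algebra q R" "\<lambda>c. coset (free_const c)"
    using ring_hom_trans[OF ring_hom_ring.homh[OF const] h.homh]
    by (intro ring_hom_ringI2 ring_type_ring h.S.ring_axioms) (simp add: comp_def)
  have "subfield (UNIV :: 'k set) type_ring"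
    using field.carrier_is_subfield[OF field_from_type_algebra] by simp
  moreover have "\<one>\<^bsub>exterior_algebra q R\<^esub> \<noteq> \<zero>\<^bsub>exterior_algebra q R\<^esub>"
  proof
    assume "\<one>\<^bsub>exterior_algebra q R\<^esub> = \<zero>\<^bsub>exterior_algebra q R\<^esub>"
    then have "coset 1 = \<zero>\<^bsub>exterior_algebra q R\<^esub>" using h.hom_one by simp
    then have "word [] \<in> relation_ideal"
      unfolding coset_eq_zero_iff by (simp add: word_def zero_free_word_def[symmetric])
    then show False using word_in_relation_ideal[of "[]" 0 "[]"] by (simp add: op_id_eq)
  qed
  ultimately show ?thesis
    using c.img_is_subfield(2) unfolding exterior_scalars_def by blast
qed

text \<open>The component is spanned by finitely many words, so its dimension is well defined.\<close>

lemma exterior_dim_zero_iff: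
  "exterior_dim q R k = 0 \<longleftrightarrow> (\<forall>w. length w = k \<longrightarrow> word w \<in> relation_ideal)"
proof -
  interpret h: ring_hom_ring type_ring "exterior_algebra q R" coset by (rule coset_hom)
  let ?K = "exterior_scalars q R" and ?E = "exterior_component q R k"
  note K = exterior_scalars_subfield
  define H where "H = {p :: ('n, 'k) free_algebra. Poly_Mapping.keys p \<subseteq> {Word w | w. length w = k}}"
  have E: "?E = coset ` H" by (simp add: exterior_component_def H_def)
  have H_add: "p + p' \<in> H" if "p \<in> H" "p' \<in> H" for p p'
    using that keys_add[of p p'] unfolding H_def by blast
  have H_const: "free_const c * p \<in> H" if "p \<in> H" for c p
    using that keys_mult[of "free_const c" p] unfolding H_def free_const_def by (auto split: if_splits)
  \<comment> \<open>Induction over the support: closed additive sets need only be checked on multiples of words.\<close>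
  have H_sum: "p \<in> S" if "p \<in> H" "0 \<in> S" "\<And>x y. x \<in> S \<Longrightarrow> y \<in> S \<Longrightarrow> x + y \<in> S"
    "\<And>w c. length w = k \<Longrightarrow> free_const c * word w \<in> S" for p S
  proof -
    have "(\<Sum>x\<in>T. Poly_Mapping.single x (Poly_Mapping.lookup p x)) \<in> S" if "T \<subseteq> Poly_Mapping.keys p" for T
      using that
    proof (induction T rule: infinite_finite_induct)
      case (insert x T)
      then obtain w where "x = Word w" "length w = k" using \<open>p \<in> H\<close> unfolding H_def by auto
      then have "Poly_Mapping.single x (Poly_Mapping.lookup p x) \<in> S"
        using \<open>\<And>w c. length w = k \<Longrightarrow> free_const c * word w \<in> S\<close>[of w] by (simp add: free_const_word)
      then show ?case using insert \<open>\<And>x y. x \<in> S \<Longrightarrow> y \<in> S \<Longrightarrow> x + y \<in> S\<close> by simp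
    qed (simp_all add: \<open>0 \<in> S\<close>)
    from this[OF order_refl] show ?thesis by (simp only: poly_mapping_sum_singles[of p, symmetric])
  qed
  have zeroE: "\<zero>\<^bsub>exterior_algebra q R\<^esub> \<in> ?E"
    unfolding E exterior_zero by (rule imageI) (simp add: H_def)
  obtain ws where ws: "set ws = (\<lambda>w. coset (word w)) ` {w. length w = k}"
    using finite_list[of "(\<lambda>w. coset (word w)) ` {w. length w = k}"] by auto
  have ws_carrier: "set ws \<subseteq> carrier (exterior_algebra q R)" unfolding ws by auto
  let ?Sp = "h.S.Span ?K ws"
  have "?E \<subseteq> ?Sp"
  proof
    fix x assume "x \<in> ?E"
    then obtain p where p: "p \<in> H" "x = coset p" unfolding E by auto
    have "p \<in> {p. coset p \<in> ?Sp}"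
    proof (rule H_sum[OF p(1)])
      have sub: "subgroup ?Sp (add_monoid (exterior_algebra q R))"
        by (rule h.S.Span_is_add_subgroup[OF K ws_carrier])
      show "0 \<in> {p. coset p \<in> ?Sp}"
        using subgroup.one_closed[OF sub] by (simp add: exterior_zero)
      show "x + y \<in> {p. coset p \<in> ?Sp}" if "x \<in> {p. coset p \<in> ?Sp}" "y \<in> {p. coset p \<in> ?Sp}" for x y
        using subgroup.m_closed[OF sub, of "coset x" "coset y"] that h.hom_add[of x y] by simp
      show "free_const c * word w \<in> {p. coset p \<in> ?Sp}" if "length w = k" for w c
      proof -
        have "coset (word w) \<in> ?Sp"
          using h.S.Span_base_incl[OF K ws_carrier] that unfolding ws by auto
        then have "coset (free_const c) \<otimes>\<^bsub>exterior_algebra q R\<^esub> coset (word w) \<in> ?Sp"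
          using h.S.Span_smult_closed[OF K ws_carrier] by (simp add: exterior_scalars_def)
        then show ?thesis using h.hom_mult[of "free_const c" "word w"] by simp
      qed
    qed
    then show "x \<in> ?Sp" by (simp add: p(2))
  qed
  moreover have "subalgebra ?K ?E (exterior_algebra q R)"
  proof
    show "?E \<subseteq> carrier (add_monoid (exterior_algebra q R))" unfolding E by auto
    show "x \<otimes>\<^bsub>add_monoid (exterior_algebra q R)\<^esub> y \<in> ?E" if "x \<in> ?E" "y \<in> ?E" for x y
    proof -
      obtain p p' where "p \<in> H" "p' \<in> H" "x = coset p" "y = coset p'" using \<open>x \<in> ?E\<close> \<open>y \<in> ?E\<close> unfolding E by auto
      then show ?thesis unfolding E using h.hom_add[of p p'] H_add by auto
    qed
    show "\<one>\<^bsub>add_monoid (exterior_algebra q R)\<^esub> \<in> ?E" using zeroE by simp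
    show "inv\<^bsub>add_monoid (exterior_algebra q R)\<^esub> x \<in> ?E" if "x \<in> ?E" for x
    proof -
      obtain p where p: "p \<in> H" "x = coset p" using \<open>x \<in> ?E\<close> unfolding E by auto
      have "\<ominus>\<^bsub>exterior_algebra q R\<^esub> coset p = coset (free_const (- 1) * p)"
      proof (rule h.S.minus_equality)
        have "coset (free_const (- 1) * p) \<oplus>\<^bsub>exterior_algebra q R\<^esub> coset p = coset (free_const (- 1) * p + p)"
          using h.hom_add[of "free_const (- 1) * p" p] by simp
        also have "\<dots> = \<zero>\<^bsub>exterior_algebra q R\<^esub>"
          by (simp add: exterior_zero free_hom.hom_minus free_hom.hom_one)
        finally show "coset (free_const (- 1) * p) \<oplus>\<^bsub>exterior_algebra q R\<^esub> coset p = \<zero>\<^bsub>exterior_algebra q R\<^esub>" .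
      qed auto
      then show ?thesis using H_const[OF p(1), of "- 1"] p(2) unfolding E a_inv_def by auto
    qed
    show "c \<otimes>\<^bsub>exterior_algebra q R\<^esub> x \<in> ?E" if "c \<in> ?K" "x \<in> ?E" for c x
    proof -
      obtain p d where "p \<in> H" "x = coset p" "c = coset (free_const d)"
        using \<open>c \<in> ?K\<close> \<open>x \<in> ?E\<close> unfolding E exterior_scalars_def by auto
      then show ?thesis unfolding E using h.hom_mult[of "free_const d" p] H_const[of p d] by auto
    qed
  qed
  ultimately have fin: "h.S.finite_dimension ?K ?E"
    using h.S.subalbegra_incl_imp_finite_dimension[OF K h.S.Span_finite_dimension[OF K ws_carrier]] by blast
  have dim: "h.S.dimension (exterior_dim q R k) ?K ?E"
    using h.S.finite_dimensionE[OF K fin] by (simp add: exterior_dim_def over_def)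
  show ?thesis
  proof
    assume "exterior_dim q R k = 0"
    then have "?E = {\<zero>\<^bsub>exterior_algebra q R\<^esub>}" using dim h.S.dimension_zero[OF K] by simp
    moreover have "coset (word w) \<in> ?E" if "length w = k" for w
      unfolding E using that by (auto simp: H_def word_def)
    ultimately show "\<forall>w. length w = k \<longrightarrow> word w \<in> relation_ideal"
      using coset_eq_zero_iff by auto
  next
    assume words: "\<forall>w. length w = k \<longrightarrow> word w \<in> relation_ideal"
    have "p \<in> relation_ideal" if "p \<in> H" for p
      by (rule H_sum[OF that]) (use words in \<open>auto intro: relation_ideal_zero relation_ideal_add relation_ideal_mult\<close>)
    then have "?E \<subseteq> {\<zero>\<^bsub>exterior_algebra q R\<^esub>}"
      unfolding E using coset_eq_zero_iff by blast
    then have "?E = {\<zero>\<^bsub>exterior_algebra q R\<^esub>}" using zeroE by blast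
    then have "h.S.dimension 0 ?K ?E" by simp
    then show "exterior_dim q R k = 0"
      using dim h.S.dimension_is_inj[OF K] by blast
  qed
qed

lemma C_tr_bi_rank:
  assumes "has_bi_rank q R m 0" "m \<ge> 1"
  shows "q ^ m * C_tr = q_number q m"
proof -
  note dims = bi_rank_dims[OF assms]
  have vanish: "skew_symmetrizer q R (Suc m) I J = 0" if "length I = Suc m" "length J = Suc m" for I J
    using dims(2) that unfolding exterior_dim_zero_iff by (auto intro: word_in_relation_ideal)
  have "\<exists>I J. length I = m \<and> length J = m \<and> skew_symmetrizer q R m I J \<noteq> 0"
    using dims(1) skew_symmetrizer_zero_imp_word[of m] unfolding exterior_dim_zero_iff by blast
  then show ?thesis using C_tr_even[OF vanish] by blast
qed

end

section \<open>Naturality under ring homomorphisms\<close>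

text \<open>
  Every construction in the definition of the \<open>R\<close>-trace and of the elements \<open>e\<^sub>k\<close> commutes with a ring
  homomorphism from a ring that is a type to any other ring.
\<close>

locale type_ring_hom = ring_hom_ring "type_ring :: 'r::ring_1 ring" B h for B (structure) and h
begin

definition image_op :: "('n, 'r) tensor_op \<Rightarrow> ('n, 'a) tensor_op" where
  "image_op S = (\<lambda>I J. h (S I J))"

lemma h_closed [simp]: "h x \<in> carrier B"
  using hom_closed by simp

lemma h_zero: "h 0 = \<zero>" and h_one: "h 1 = \<one>" and h_add: "h (x + y) = h x \<oplus> h y"
  and h_mult: "h (x * y) = h x \<otimes> h y"
  using hom_zero hom_one hom_add[of x y] hom_mult[of x y] by simp_all

lemma h_minus: "h (x - y) = h x \<ominus> h y"
proof -
  have "h (x - y) \<oplus> h y = h x" by (simp add: h_add[symmetric])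
  then show ?thesis
    by (metis S.add.inv_solve_right a_minus_def h_closed)
qed

lemma h_sum: "finite T \<Longrightarrow> h (sum f T) = (\<Oplus>i\<in>T. h (f i))"
  by (induction T rule: finite_induct) (simp_all add: h_zero h_add Pi_def)

lemma h_power: "h (x ^ k) = h x [^] k"
  by (induction k) (simp_all add: h_one h_mult power_Suc2 del: power_Suc)

lemma image_op_mult: "image_op S \<star>\<^bsub>B\<^esub> image_op T = image_op (S \<diamondop> T)"
  by (intro ext) (simp add: tensor_mult_def[of B] image_op_def op_mult_eq h_sum h_mult)

lemma image_op_id: "tensor_id B = image_op op_id"
  by (intro ext) (simp add: tensor_id_def image_op_def h_one h_zero)

lemma image_op_at_pos: "at_pos B i (map_matrix h M) = image_op (at_pos type_ring i M)"
  by (intro ext) (simp add: at_pos_def image_op_def map_matrix_def h_zero)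

lemma image_op_at_pos2: "at_pos2 B i (map_matrix h M) = image_op (at_pos2 type_ring i M)"
  by (intro ext) (simp add: at_pos2_def image_op_def map_matrix_def h_zero)

lemma image_op_tensor_prod: "tensor_prod B (\<lambda>i. image_op (S i)) k = image_op (tensor_prod type_ring S k)"
  by (induction k) (simp_all add: image_op_id image_op_mult)

lemma map_matrix_comp: "map_matrix (\<lambda>c. h (\<iota> c)) M = map_matrix h (map_matrix \<iota> M)"
  by (simp add: map_matrix_def vec_eq_iff)

lemma image_op_L_bar: "L_bar B (\<lambda>c. h (\<iota> c)) R (map_matrix h L) k = image_op (L_bar type_ring \<iota> R L k)"
  by (induction k rule: induct_nat_012)
    (simp_all add: image_op_id image_op_at_pos image_op_at_pos2 image_op_mult map_matrix_comp[where \<iota> = \<iota>])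

lemma image_op_trace: "tensor_trace B k (image_op S) = h (tensor_trace type_ring k S)"
  by (simp add: tensor_trace_def finsum_type_ring h_sum) (simp add: image_op_def)

lemma image_op_R_trace: "R_trace B (\<lambda>c. h (\<iota> c)) R k (image_op S) = h (R_trace type_ring \<iota> R k S)"
  unfolding R_trace_def map_matrix_comp[where \<iota> = \<iota>] image_op_at_pos image_op_tensor_prod image_op_mult image_op_trace ..

lemma image_op_skew_symmetrizer:
  "skew_symmetrizer_over (\<lambda>c. h (\<iota> c)) q R k = image_op (skew_symmetrizer_over \<iota> q R k)"
  by (simp add: skew_symmetrizer_over_def image_op_def)

lemma h_elem_sym: "elem_sym B (\<lambda>c. h (\<iota> c)) q R (map_matrix h L) k = h (elem_sym type_ring \<iota> q R L k)"
proof -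
  have L: "L_bar B (\<lambda>c. h (\<iota> c)) R (map_matrix h L) = (\<lambda>k. image_op (L_bar type_ring \<iota> R L k))"
    by (rule ext) (rule image_op_L_bar)
  show ?thesis
    unfolding elem_sym_def L image_op_tensor_prod image_op_skew_symmetrizer image_op_mult image_op_R_trace
    by (simp add: h_one)
qed

end

section \<open>Polynomials over the Reflection Equation algebra\<close>

text \<open>
  Polynomials in a central variable \<open>t\<close> over the free algebra on the entries of \<open>L\<close>.  Finitely supported
  functions are used because their convolution product does not ask for commuting coefficients.
\<close>

type_synonym ('n, 'k) free_poly = "nat \<Rightarrow>\<^sub>0 ('n \<times> 'n, 'k) free_algebra"

lemma lookup_mult_nat:
  fixes p q :: "nat \<Rightarrow>\<^sub>0 'a::semiring_0"
  shows "Poly_Mapping.lookup (p * q) n = (\<Sum>i\<le>n. Poly_Mapping.lookup p i * Poly_Mapping.lookup q (n - i))"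
proof (induction p rule: poly_mapping_additive_induct)
  case (single k c)
  show ?case
  proof (induction q rule: poly_mapping_additive_induct)
    case (single l d)
    have "(\<Sum>i\<le>n. Poly_Mapping.lookup (Poly_Mapping.single k c) i * Poly_Mapping.lookup (Poly_Mapping.single l d) (n - i))
      = (\<Sum>i\<le>n. if i = k then (if k + l = n then c * d else 0) else 0)"
      by (intro sum.cong refl) (auto simp: lookup_single when_def)
    also have "\<dots> = (if k + l = n then c * d else 0)" by auto
    finally show ?case by (simp add: mult_single lookup_single when_def)
  qed (simp add: distrib_left lookup_add sum.distrib)
qed (simp add: distrib_right lookup_add sum.distrib)

definition poly_const :: "'k \<Rightarrow> ('n, 'k::field) free_poly" where
  "poly_const c = Poly_Mapping.single 0 (free_const c)"

definition poly_t :: "('n, 'k::field) free_poly" where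
  "poly_t = Poly_Mapping.single 1 1"

definition poly_gens :: "(('n, 'k::field) free_poly)^('n::finite)^'n" where
  "poly_gens = (\<chi> i j. Poly_Mapping.single 0 (free_gen (i, j)))"

lemma poly_const_central_hom: "central_hom (poly_const :: 'k::field \<Rightarrow> ('n, 'k) free_poly)"
proof
  fix a b :: 'k and x :: "('n, 'k) free_poly"
  show "poly_const 1 = (1 :: ('n, 'k) free_poly)" by (simp add: poly_const_def free_hom.hom_one)
  show "poly_const (a + b) = (poly_const a + poly_const b :: ('n, 'k) free_poly)"
    by (simp add: poly_const_def free_hom.hom_add single_add)
  show "poly_const (a * b) = (poly_const a * poly_const b :: ('n, 'k) free_poly)"
    by (simp add: poly_const_def free_hom.hom_mult mult_single)
  show "poly_const a * x = x * poly_const a"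
    by (induction x rule: poly_mapping_additive_induct)
      (simp_all add: poly_const_def mult_single free_hom.hom_central distrib_left distrib_right)
qed

lemma poly_t_central: "poly_t * x = x * poly_t"
  by (induction x rule: poly_mapping_additive_induct)
    (simp_all add: poly_t_def mult_single distrib_left distrib_right)

text \<open>
  Constant polynomials are the image of a ring homomorphism, so the elements \<open>e\<^sub>k\<close> of the polynomial ring
  are those of the free algebra.
\<close>

lemma elem_sym_free_poly:
  fixes R :: "('k::field, 'n::finite) braid_matrix"
  shows "elem_sym type_ring poly_const q R poly_gens k
    = Poly_Mapping.single 0 (elem_sym type_ring free_const q R (\<chi> i j. free_gen (i, j)) k)"
proof -
  interpret s: type_ring_hom type_ring "Poly_Mapping.single 0 :: ('n \<times> 'n, 'k) free_algebra \<Rightarrow> ('n, 'k) free_poly"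
    by (intro type_ring_hom.intro ring_hom_ringI2 ring_type_ring ring_hom_memI) (simp_all add: single_add mult_single)
  have "(poly_gens :: (('n, 'k) free_poly)^'n^'n) = map_matrix (Poly_Mapping.single 0) (\<chi> i j. free_gen (i, j))"
    by (simp add: poly_gens_def map_matrix_def vec_eq_iff)
  then show ?thesis
    using s.h_elem_sym[of free_const q R "\<chi> i j. free_gen (i, j)" k] by (simp add: poly_const_def[abs_def])
qed

lemma rea_ideal: "ideal (rea_ideal R) type_ring"
  unfolding rea_ideal_def by (rule ideal_genideal)

lemma rea_coset_hom: "type_ring_hom (rea R) (\<lambda>p. rea_ideal R +>\<^bsub>type_ring\<^esub> p)"
  unfolding rea_def by (intro type_ring_hom.intro ideal.rcos_ring_hom_ring rea_ideal)

text \<open>Reduction of the coefficients modulo the relations of the Reflection Equation algebra.\<close>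

definition rea_eval ::
  "('k::field, 'n::finite) braid_matrix \<Rightarrow> ('n, 'k) free_poly
     \<Rightarrow> nat \<Rightarrow> ('n \<times> 'n, 'k) free_algebra set" where
  "rea_eval R p = (\<lambda>n. rea_ideal R +>\<^bsub>type_ring\<^esub> Poly_Mapping.lookup p n)"

lemma rea_eval_single:
  "rea_eval R (Poly_Mapping.single n a)
    = up_ring.monom (rea_poly R) (rea_ideal R +>\<^bsub>type_ring\<^esub> a) n"
proof -
  interpret c: type_ring_hom "rea R" "\<lambda>p. rea_ideal R +>\<^bsub>type_ring\<^esub> p" by (rule rea_coset_hom)
  show ?thesis
    by (auto simp: rea_eval_def UP_def lookup_single when_def c.h_zero fun_eq_iff)
qed

lemma rea_eval_hom: "type_ring_hom (rea_poly R) (rea_eval R)"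
proof -
  interpret c: type_ring_hom "rea R" "\<lambda>p. rea_ideal R +>\<^bsub>type_ring\<^esub> p" by (rule rea_coset_hom)
  have closed: "rea_eval R p \<in> up (rea R)" for p
  proof (rule mem_upI)
    show "rea_eval R p n \<in> carrier (rea R)" for n by (simp add: rea_eval_def)
    have "bound \<zero>\<^bsub>rea R\<^esub> (Max (insert 0 (Poly_Mapping.keys p))) (rea_eval R p)"
    proof
      fix n assume n: "Max (insert 0 (Poly_Mapping.keys p)) < n"
      then have "n \<notin> Poly_Mapping.keys p" by (meson Max_ge finite_insert finite_keys insertI2 not_le)
      then show "rea_eval R p n = \<zero>\<^bsub>rea R\<^esub>" by (simp add: rea_eval_def in_keys_iff c.h_zero)
    qed
    then show "\<exists>n. bound \<zero>\<^bsub>rea R\<^esub> n (rea_eval R p)" ..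
  qed
  have "ring (rea_poly R)"
    by (rule UP_ring.UP_ring) (simp add: UP_ring_def c.S.ring_axioms)
  moreover have "rea_eval R \<in> ring_hom type_ring (rea_poly R)"
  proof (rule ring_hom_memI)
    show "rea_eval R p \<in> carrier (rea_poly R)" for p using closed by (simp add: UP_def)
    show "rea_eval R (p \<otimes>\<^bsub>type_ring\<^esub> p') = rea_eval R p \<otimes>\<^bsub>rea_poly R\<^esub> rea_eval R p'" for p p'
      using closed[of p] closed[of p']
      by (simp add: UP_def fun_eq_iff) (simp add: rea_eval_def lookup_mult_nat c.h_sum c.h_mult)
    show "rea_eval R (p \<oplus>\<^bsub>type_ring\<^esub> p') = rea_eval R p \<oplus>\<^bsub>rea_poly R\<^esub> rea_eval R p'" for p p'
      using closed[of p] closed[of p']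
      by (simp add: UP_def fun_eq_iff) (simp add: rea_eval_def lookup_add c.h_add)
    show "rea_eval R \<one>\<^bsub>type_ring\<^esub> = \<one>\<^bsub>rea_poly R\<^esub>"
      by (auto simp: UP_def fun_eq_iff rea_eval_def lookup_one when_def c.h_zero c.h_one)
  qed
  ultimately show ?thesis
    by (intro type_ring_hom.intro ring_hom_ringI2 ring_type_ring)
qed

theorem proposition6:
  fixes R :: "'k::real_normed_field^('n::finite \<times> 'n)^('n \<times> 'n)" and q :: 'k and m :: nat
  assumes "hecke_symmetry q R"
    and "generic q"
    and "skew_invertible R"
    and "has_bi_rank q R m 0"
    and "m \<ge> 2"
  shows "(\<Oplus>\<^bsub>rea_poly R\<^esub>k\<in>{0..m}. t_var R [^]\<^bsub>rea_poly R\<^esub> (m - k)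
            \<otimes>\<^bsub>rea_poly R\<^esub> const_poly R ((- q) ^ k) \<otimes>\<^bsub>rea_poly R\<^esub> coeff_poly R (rea_e q R k)) =
         const_poly R (q ^ m) \<otimes>\<^bsub>rea_poly R\<^esub>
           R_trace (rea_poly R) (const_poly R) R m
             (skew_symmetrizer_over (const_poly R) q R m
                \<star>\<^bsub>rea_poly R\<^esub> tensor_prod (rea_poly R) (char_factor q R) m)"
proof -
  interpret skew_hecke q R using assms(1-3) by unfold_locales
  interpret hom: central_hom "poly_const :: 'k \<Rightarrow> ('n, 'k) free_poly" by (rule poly_const_central_hom)
  interpret even_matrix q R "poly_const :: 'k \<Rightarrow> ('n, 'k) free_poly" poly_gens m
    using assms(5) C_tr_bi_rank[OF assms(4)] by unfold_locales simp
  interpret c: type_ring_hom "rea R" "\<lambda>p. rea_ideal R +>\<^bsub>type_ring\<^esub> p" by (rule rea_coset_hom)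
  interpret h: type_ring_hom "rea_poly R" "rea_eval R" by (rule rea_eval_hom)
  let ?L = "(\<chi> i j. free_gen (i, j)) :: (('n \<times> 'n, 'k) free_algebra)^'n^'n"
  have t: "t_var R = rea_eval R poly_t"
    by (simp add: t_var_def poly_t_def rea_eval_single c.h_one)
  have const: "const_poly R = (\<lambda>c. rea_eval R (poly_const c))"
    by (simp add: fun_eq_iff const_poly_def coeff_poly_def rea_const_def poly_const_def rea_eval_single)
  have L: "map_matrix (coeff_poly R) (rea_L R) = map_matrix (rea_eval R) poly_gens"
    by (simp add: map_matrix_def vec_eq_iff coeff_poly_def rea_L_def poly_gens_def rea_eval_single)
  have e: "coeff_poly R (rea_e q R k) = rea_eval R (elem_sym type_ring poly_const q R poly_gens k)" for k
  proof -
    have "rea_e q R k = rea_ideal R +>\<^bsub>type_ring\<^esub> elem_sym type_ring free_const q R ?L k"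
      using c.h_elem_sym[of free_const q R ?L k]
      by (simp add: rea_e_def rea_const_def[abs_def] rea_L_def map_matrix_def)
    then show ?thesis by (simp add: elem_sym_free_poly rea_eval_single coeff_poly_def)
  qed
  let ?F = "\<lambda>i I J. poly_const (q ^ (2 * (i - 1))) * poly_t * op_id I J - L_bar type_ring poly_const R poly_gens i I J"
  have F: "char_factor q R = (\<lambda>i. h.image_op (?F i))"
  proof -
    have entry: "char_factor q R i I J = h.image_op (?F i) I J" for i I J
      unfolding char_factor_def Let_def const L t h.image_op_L_bar h.image_op_id
      by (simp add: h.image_op_def h.h_minus h.h_mult)
    show ?thesis by (intro ext) (simp only: entry)
  qed
  have "(\<Oplus>\<^bsub>rea_poly R\<^esub>k\<in>{0..m}. t_var R [^]\<^bsub>rea_poly R\<^esub> (m - k)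
            \<otimes>\<^bsub>rea_poly R\<^esub> const_poly R ((- q) ^ k) \<otimes>\<^bsub>rea_poly R\<^esub> coeff_poly R (rea_e q R k))
      = rea_eval R (\<Sum>k\<in>{0..m}. poly_t ^ (m - k) * poly_const ((- q) ^ k) * elem_sym type_ring poly_const q R poly_gens k)"
    by (simp add: t const e h.h_sum h.h_mult h.h_power)
  also have "\<dots> = rea_eval R (poly_const (q ^ m) * R_trace type_ring poly_const R m
      (skew_symmetrizer_over poly_const q R m \<diamondop> tensor_prod type_ring ?F m))"
    by (subst char_poly_identity[OF poly_t_central]) (rule refl)
  also have "\<dots> = const_poly R (q ^ m) \<otimes>\<^bsub>rea_poly R\<^esub>
           R_trace (rea_poly R) (const_poly R) R m
             (skew_symmetrizer_over (const_poly R) q R m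
                \<star>\<^bsub>rea_poly R\<^esub> tensor_prod (rea_poly R) (char_factor q R) m)"
    unfolding F const h.image_op_skew_symmetrizer h.image_op_tensor_prod h.image_op_mult h.image_op_R_trace
    by (rule h.h_mult)
  finally show ?thesis .
qed

end
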